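(* Let $n\ge 2$, let $1<p<+\infty$, let $F$ be as in the context, and let $\Omega$ be a bounded open set of $\mathbb{R}^n$. Then the spectrum of $-\mathcal Q_p$ in $\Omega$ is a closed set.
   Context: $F:\mathbb{R}^n\to[0,+\infty[$ is a convex function with $F(t\xi)=|t|F(\xi)$ for all $t\in\mathbb{R}$, $\xi\in\mathbb{R}^n$, and $a|\xi|\le F(\xi)$ for all $\xi$, for some constant $a>0$; $F\in C^2(\mathbb{R}^n\setminus\{0\})$ and the Hessian $\nabla^2_\xi[F^p](\xi)$ is positive definite for every $\xi\in\mathbb{R}^n\setminus\{0\}$. Open sets are nonempty. The anisotropic $p$-Laplacian is $\mathcal Q_p u=\operatorname{div}\left(F^{p-1}(\nabla u)\nabla_\xi F(\nabla u)\right)$ (the vector $F^{p-1}(\xi)\nabla_\xi F(\xi)=\frac1p\nabla_\xi[F^p](\xi)$ is understood to be $0$ at $\xi=0$). A function $u\in W^{1,p}_0(\Omega)$, $u\ne 0$, is an eigenfunction of $-\mathcal Q_p$ in $\Omega$ (with Dirichlet boundary condition) if there is a real number $\lambda$, called the corresponding eigenvalue, such that $$\int_\Omega \langle F^{p-1}(\nabla u)\nabla_\xi F(\nabla u),\nabla\varphi\rangle\,dx=\lambda\int_\Omega |u|^{p-2}u\,\varphi\,dx\quad\text{for all }\varphi\in W^{1,p}_0(\Omega).$$ The spectrum of $-\mathcal Q_p$ in $\Omega$ is the set of all its eigenvalues, regarded as a subset of $\mathbb{R}$. *)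

theory Defs
  imports "HOL-Analysis.Analysis"
begin

definition grad :: "(real ^ 'n \<Rightarrow> real) \<Rightarrow> real ^ 'n \<Rightarrow> real ^ 'n" where
  "grad f x = (\<chi> i. frechet_derivative f (at x) (axis i 1))"

definition hessian :: "(real ^ 'n \<Rightarrow> real) \<Rightarrow> real ^ 'n \<Rightarrow> real ^ 'n ^ 'n" where
  "hessian f x = jacobian (grad f) (at x)"

definition positive_definite :: "real ^ 'n ^ 'n \<Rightarrow> bool" where
  "positive_definite A \<longleftrightarrow> transpose A = A \<and> (\<forall>v. v \<noteq> 0 \<longrightarrow> v \<bullet> (A *v v) > 0)"

text \<open>\<open>Ck_on k f S\<close>: \<open>f\<close> is of class \<open>C\<^sup>k\<close> on the set \<open>S\<close>, which is meant to be open
  (derivatives are taken at interior points).\<close>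

fun Ck_on :: "nat \<Rightarrow> (real ^ 'n \<Rightarrow> real) \<Rightarrow> (real ^ 'n) set \<Rightarrow> bool" where
  "Ck_on 0 f S \<longleftrightarrow> continuous_on S f"
| "Ck_on (Suc k) f S \<longleftrightarrow>
     (\<forall>x\<in>S. f differentiable (at x)) \<and> (\<forall>i. Ck_on k (\<lambda>x. grad f x $ i) S)"

text \<open>The space \<open>C\<^sub>c\<^sup>\<infinity>(\<Omega>)\<close>, its elements being extended by zero to the whole space.\<close>

definition test_functions :: "(real ^ 'n) set \<Rightarrow> (real ^ 'n \<Rightarrow> real) set" where
  "test_functions \<Omega> =
     {\<phi>. (\<forall>k. Ck_on k \<phi> UNIV) \<and> compact (closure {x. \<phi> x \<noteq> 0}) \<and> closure {x. \<phi> x \<noteq> 0} \<subseteq> \<Omega>}"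

text \<open>Elements of \<open>L\<^sup>p(\<Omega>)\<close> and \<open>W\<^sup>1\<^sup>,\<^sup>p(\<Omega>)\<close> are represented by functions on the whole space;
  only their values almost everywhere in \<open>\<Omega>\<close> matter.\<close>

definition Lp :: "real \<Rightarrow> (real ^ 'n) set \<Rightarrow> (real ^ 'n \<Rightarrow> 'b :: euclidean_space) set" where
  "Lp p \<Omega> = {f. f \<in> borel_measurable (lebesgue_on \<Omega>) \<and>
                integrable (lebesgue_on \<Omega>) (\<lambda>x. norm (f x) powr p)}"

definition Lp_norm :: "real \<Rightarrow> (real ^ 'n) set \<Rightarrow> (real ^ 'n \<Rightarrow> 'b :: euclidean_space) \<Rightarrow> real" where
  "Lp_norm p \<Omega> f = (LINT x|lebesgue_on \<Omega>. norm (f x) powr p) powr (1 / p)"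

definition has_weak_gradient ::
  "(real ^ 'n \<Rightarrow> real) \<Rightarrow> (real ^ 'n \<Rightarrow> real ^ 'n) \<Rightarrow> (real ^ 'n) set \<Rightarrow> bool" where
  "has_weak_gradient u g \<Omega> \<longleftrightarrow>
     (\<forall>K. compact K \<and> K \<subseteq> \<Omega> \<longrightarrow> u absolutely_integrable_on K \<and> g absolutely_integrable_on K) \<and>
     (\<forall>\<phi>\<in>test_functions \<Omega>.
        (LINT x|lebesgue_on \<Omega>. u x *\<^sub>R grad \<phi> x) = - (LINT x|lebesgue_on \<Omega>. \<phi> x *\<^sub>R g x))"

text \<open>The weak gradient is unique up to null sets, so any choice of representative will do.\<close>

definition weak_grad :: "(real ^ 'n) set \<Rightarrow> (real ^ 'n \<Rightarrow> real) \<Rightarrow> real ^ 'n \<Rightarrow> real ^ 'n" where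
  "weak_grad \<Omega> u = (SOME g. has_weak_gradient u g \<Omega>)"

definition W1p :: "real \<Rightarrow> (real ^ 'n) set \<Rightarrow> (real ^ 'n \<Rightarrow> real) set" where
  "W1p p \<Omega> = {u. u \<in> Lp p \<Omega> \<and> (\<exists>g. has_weak_gradient u g \<Omega> \<and> g \<in> Lp p \<Omega>)}"

definition W1p_norm :: "real \<Rightarrow> (real ^ 'n) set \<Rightarrow> (real ^ 'n \<Rightarrow> real) \<Rightarrow> real" where
  "W1p_norm p \<Omega> u = Lp_norm p \<Omega> u + Lp_norm p \<Omega> (weak_grad \<Omega> u)"

text \<open>\<open>W\<^sub>0\<^sup>1\<^sup>,\<^sup>p(\<Omega>)\<close> is the closure of \<open>C\<^sub>c\<^sup>\<infinity>(\<Omega>)\<close> in \<open>W\<^sup>1\<^sup>,\<^sup>p(\<Omega>)\<close>.\<close>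

definition W01p :: "real \<Rightarrow> (real ^ 'n) set \<Rightarrow> (real ^ 'n \<Rightarrow> real) set" where
  "W01p p \<Omega> = {u \<in> W1p p \<Omega>. \<exists>\<phi>. (\<forall>k::nat. \<phi> k \<in> test_functions \<Omega>) \<and>
                  (\<lambda>k. W1p_norm p \<Omega> (\<lambda>x. u x - \<phi> k x)) \<longlonglongrightarrow> 0}"

definition flux :: "(real ^ 'n \<Rightarrow> real) \<Rightarrow> real \<Rightarrow> real ^ 'n \<Rightarrow> real ^ 'n" where
  "flux F p \<xi> = (if \<xi> = 0 then 0 else F \<xi> powr (p - 1) *\<^sub>R grad F \<xi>)"

text \<open>\<open>\<bar>u\<bar> powr (p - 2) * u\<close> is \<open>0\<close> where \<open>u = 0\<close>, also when \<open>p \<le> 2\<close>.  For \<open>u\<close> and \<open>\<phi>\<close>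
  in \<open>W\<^sub>0\<^sup>1\<^sup>,\<^sup>p(\<Omega>)\<close> both integrands are integrable when \<open>F\<close> is convex, absolutely
  homogeneous and continuously differentiable away from \<open>0\<close>, so the totalised
  integral takes no default value.\<close>

definition is_eigenfunction ::
  "(real ^ 'n \<Rightarrow> real) \<Rightarrow> real \<Rightarrow> (real ^ 'n) set \<Rightarrow> real \<Rightarrow> (real ^ 'n \<Rightarrow> real) \<Rightarrow> bool" where
  "is_eigenfunction F p \<Omega> \<mu> u \<longleftrightarrow>
     u \<in> W01p p \<Omega> \<and> \<not> (AE x in lebesgue_on \<Omega>. u x = 0) \<and>
     (\<forall>\<phi>\<in>W01p p \<Omega>.
        (LINT x|lebesgue_on \<Omega>. flux F p (weak_grad \<Omega> u x) \<bullet> weak_grad \<Omega> \<phi> x) =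
        \<mu> * (LINT x|lebesgue_on \<Omega>. \<bar>u x\<bar> powr (p - 2) * u x * \<phi> x))"

definition spectrum :: "(real ^ 'n \<Rightarrow> real) \<Rightarrow> real \<Rightarrow> (real ^ 'n) set \<Rightarrow> real set" where
  "spectrum F p \<Omega> = {\<mu>. \<exists>u. is_eigenfunction F p \<Omega> \<mu> u}"

end

theory Submission
  imports Defs "HOL-Complex_Analysis.Great_Picard"
begin

text \<open>Let \<open>\<mu>\<^sub>k\<close> be eigenvalues converging to \<open>\<nu>\<close>, with eigenfunctions \<open>u\<^sub>k\<close> normalised by
  \<open>\<integral> \<bar>u\<^sub>k\<bar>\<^sup>p = 1\<close>.  Write \<open>A(\<xi>) = F(\<xi>)\<^sup>p\<^sup>-\<^sup>1 \<nabla>F(\<xi>)\<close> for the flux and \<open>B(s) = \<bar>s\<bar>\<^sup>p\<^sup>-\<^sup>2 s\<close>.  The idea is to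
  show that a subsequence of \<open>u\<^sub>k\<close> converges \<^emph>\<open>strongly\<close> in \<open>W\<^sup>1\<^sup>,\<^sup>p\<close>; then the weak equation passes
  to the limit, and the limit is an eigenfunction because the normalisation survives.

  Testing the equation of \<open>u\<^sub>k\<close> with \<open>u\<^sub>k\<close> and using Euler's identity \<open>\<langle>A(\<xi>), \<xi>\<rangle> = F(\<xi>)\<^sup>p\<close> bounds
  \<open>\<integral> \<bar>\<nabla>u\<^sub>k\<bar>\<^sup>p\<close> by a multiple of \<open>\<mu>\<^sub>k\<close> (\<open>weak_eigenpair_gradient_bound\<close>).  By Rellich's theorem
  (\<open>rellich\<close>) a subsequence of \<open>u\<^sub>k\<close> is Cauchy in \<open>L\<^sup>p\<close>.  The gradients are treated
  directly, without passing through a weak limit: subtracting the equations of \<open>u\<^sub>i\<close> and \<open>u\<^sub>j\<close>, both tested with \<open>u\<^sub>i - u\<^sub>j\<close>, gives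
  \<open>\<integral> \<langle>A(\<nabla>u\<^sub>i) - A(\<nabla>u\<^sub>j), \<nabla>u\<^sub>i - \<nabla>u\<^sub>j\<rangle> = \<integral> (\<mu>\<^sub>i B(u\<^sub>i) - \<mu>\<^sub>j B(u\<^sub>j)) (u\<^sub>i - u\<^sub>j)\<close>,
  which tends to \<open>0\<close>.  The Hessian condition makes \<open>A\<close> strictly monotone
  (\<open>flux_strictly_monotone\<close>), and strict monotonicity is enough to conclude that \<open>\<nabla>u\<^sub>k\<close> is Cauchy
  in \<open>L\<^sup>p\<close> (\<open>Cauchy_Lp_gradients\<close>).

  This last step, like the passage to the limit in the equation, is an instance of one principle
  (\<open>homogeneous_comparison\<close>).  If \<open>h\<close> and \<open>D \<ge> 0\<close> are continuous and positively homogeneous of degree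
  \<open>p\<close>, and \<open>h\<close> vanishes where \<open>D\<close> does, then compactness of the unit sphere gives
  \<open>h \<le> \<epsilon> \<bar>x\<bar>\<^sup>p + C\<^sub>\<epsilon> D\<close> for every \<open>\<epsilon> > 0\<close>.  Hence along sequences bounded in \<open>L\<^sup>p\<close>, if
  \<open>\<integral> D\<close> tends to \<open>0\<close> then so does \<open>\<integral> h\<close>.  The choice \<open>D = \<langle>A(\<xi>) - A(\<eta>), \<xi> - \<eta>\<rangle>\<close>,
  \<open>h = \<bar>\<xi> - \<eta>\<bar>\<^sup>p\<close> gives strong convergence of gradients; \<open>D = \<bar>\<xi> - \<eta>\<bar>\<^sup>p\<close>,
  \<open>h = \<bar>\<langle>A(\<xi>) - A(\<eta>), \<zeta>\<rangle>\<bar>\<close> lets the equation pass to the limit, on the left with \<open>A\<close> and on the right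
  with \<open>B\<close>.  These inequalities also replace those of Hoelder and Minkowski: convergence
  in \<open>L\<^sup>p\<close> is expressed by the modular \<open>\<integral> \<bar>f\<bar>\<^sup>p\<close> throughout.

  Two facts about Sobolev functions carry the rest.  Weak gradients are unique almost everywhere
  (\<open>weak_gradient_unique\<close>), by testing against smooth approximations of indicators of boxes; this
  makes the chosen representative \<open>weak_grad\<close> linear and continuous, so that \<open>W\<^sub>0\<^sup>1\<^sup>,\<^sup>p\<close> can be handled as
  the set of pairs \<open>(u, g)\<close> that are \<open>L\<^sup>p\<close> limits of pairs \<open>(\<phi>, \<nabla>\<phi>)\<close>.  Rellich's theorem is reduced to
  test functions and proved by comparing a function with its averages over the cells of a fine cubic
  grid: the error is controlled by the gradient, and the averages over a countable family
  of cells converge along a diagonal subsequence.\<close>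

section \<open>Positively homogeneous functions\<close>

definition pos_homogeneous :: "real \<Rightarrow> ('a::real_vector \<Rightarrow> 'b::real_vector) \<Rightarrow> bool" where
  "pos_homogeneous q h \<longleftrightarrow> (\<forall>t>0. \<forall>x. h (t *\<^sub>R x) = t powr q *\<^sub>R h x)"

lemma pos_homogeneousD: "pos_homogeneous q h \<Longrightarrow> t > 0 \<Longrightarrow> h (t *\<^sub>R x) = t powr q *\<^sub>R h x"
  by (simp add: pos_homogeneous_def)

lemma pos_homogeneous_zero:
  fixes h :: "'a::real_vector \<Rightarrow> 'b::real_vector"
  assumes "pos_homogeneous q h" "q > 0"
  shows "h 0 = 0"
proof -
  have "h 0 = 2 powr q *\<^sub>R h 0"
    using pos_homogeneousD[OF assms(1), of 2 0] by (simp only: scaleR_zero_right)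
  hence "(2 powr q - 1) *\<^sub>R h 0 = 0"
    by (simp only: scaleR_diff_left scaleR_one) simp
  moreover have "(2::real) powr q > 1"
    using assms(2) by (simp add: gr_one_powr)
  ultimately show ?thesis using assms(2) by simp
qed

lemma pos_homogeneous_sphere:
  fixes h :: "'a::real_normed_vector \<Rightarrow> 'b::real_vector"
  assumes "pos_homogeneous q h" "x \<noteq> 0"
  shows "h x = norm x powr q *\<^sub>R h (x /\<^sub>R norm x)"
  using pos_homogeneousD[OF assms(1), of "norm x" "x /\<^sub>R norm x"] assms(2) by simp

lemma pos_homogeneous_bounded:
  fixes h :: "'a::euclidean_space \<Rightarrow> 'b::real_normed_vector"
  assumes hom: "pos_homogeneous q h" "q > 0" and cont: "continuous_on (- {0}) h"
  obtains C where "C \<ge> 0" "\<And>x. norm (h x) \<le> C * norm x powr q"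
proof -
  have "compact (h ` sphere 0 1)"
    by (intro compact_continuous_image continuous_on_subset[OF cont]) auto
  then obtain C where C: "C > 0" "\<And>x. x \<in> sphere 0 1 \<Longrightarrow> norm (h x) \<le> C"
    by (metis bounded_pos compact_imp_bounded imageI)
  show thesis
  proof (rule that[of C])
    fix x
    show "norm (h x) \<le> C * norm x powr q"
    proof (cases "x = 0")
      case False
      have "norm (h x) = norm x powr q * norm (h (x /\<^sub>R norm x))"
        using pos_homogeneous_sphere[OF hom(1) False] by (metis abs_of_nonneg powr_ge_zero norm_scaleR)
      also have "\<dots> \<le> norm x powr q * C"
        using False by (intro mult_left_mono C(2)) auto
      finally show ?thesis by (simp add: mult.commute)
    qed (use pos_homogeneous_zero[OF hom] in auto)
  qed (use C in auto)
qed

text \<open>Only continuity at the origin is at stake: there the function is dominated by a positive power of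
  the norm.\<close>

lemma pos_homogeneous_continuous:
  fixes h :: "'a::euclidean_space \<Rightarrow> 'b::real_normed_vector"
  assumes hom: "pos_homogeneous q h" "q > 0" and cont: "continuous_on (- {0}) h"
  shows "continuous_on UNIV h"
proof (rule continuous_at_imp_continuous_on, rule ballI)
  fix x :: 'a
  show "isCont h x"
  proof (cases "x = 0")
    case True
    obtain C where C: "C \<ge> 0" "\<And>x. norm (h x) \<le> C * norm x powr q"
      using pos_homogeneous_bounded[OF assms] by blast
    have "((\<lambda>x::'a. norm x powr q) \<longlongrightarrow> norm (0::'a) powr q) (at 0)"
      using \<open>q > 0\<close> by (intro tendsto_powr' tendsto_intros) auto
    hence "((\<lambda>x::'a. C * norm x powr q) \<longlongrightarrow> 0) (at 0)"
      using tendsto_mult_right_zero[where c = C and f = "\<lambda>x::'a. norm x powr q" and F = "at 0"] by simp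
    hence "(h \<longlongrightarrow> 0) (at 0)"
      by (rule Lim_null_comparison[rotated]) (use C in auto)
    thus ?thesis
      using True pos_homogeneous_zero[OF hom] by (simp add: isCont_def)
  next
    case False
    thus ?thesis using cont by (simp add: continuous_on_eq_continuous_at open_Compl)
  qed
qed

text \<open>By homogeneity it suffices to look at the unit sphere.  The part of the sphere where
  \<open>h \<ge> \<epsilon>\<close> is compact and \<open>D\<close> has no zero on it, so there \<open>D\<close> is bounded below and \<open>h\<close> above.\<close>

lemma homogeneous_comparison:
  fixes h D :: "'a::euclidean_space \<Rightarrow> real"
  assumes hom: "pos_homogeneous q h" "pos_homogeneous q D" "q > 0"
    and cont: "continuous_on UNIV h" "continuous_on UNIV D"
    and nonneg: "\<And>x. 0 \<le> D x"
    and zero: "\<And>x. D x = 0 \<Longrightarrow> h x = 0"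
    and "\<epsilon> > 0"
  obtains C where "C > 0" "\<And>x. h x \<le> \<epsilon> * norm x powr q + C * D x"
proof -
  \<comment> \<open>The bad part of the sphere, where \<open>\<epsilon> \<bar>x\<bar>\<^sup>q\<close> alone does not dominate \<open>h\<close>.\<close>
  define K where "K = sphere 0 1 \<inter> {x. \<epsilon> \<le> h x}"
  have "compact K"
    unfolding K_def by (intro compact_Int_closed closed_Collect_le cont continuous_intros) auto
  have sphere: "\<exists>C>0. \<forall>x\<in>sphere 0 1. h x \<le> \<epsilon> + C * D x"
  proof (cases "K = {}")
    case True
    have "h x \<le> \<epsilon> + 1 * D x" if "x \<in> sphere 0 1" for x
    proof -
      have "h x < \<epsilon>" using True that unfolding K_def by (simp add: disjoint_iff) (meson linorder_not_le)
      thus ?thesis using nonneg[of x] by simp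
    qed
    thus ?thesis using zero_less_one by blast
  next
    case False
    obtain x0 where x0: "x0 \<in> K" "\<And>x. x \<in> K \<Longrightarrow> D x0 \<le> D x"
      using continuous_attains_inf[OF \<open>compact K\<close> False continuous_on_subset[OF cont(2)]] by auto
    obtain x1 where x1: "x1 \<in> K" "\<And>x. x \<in> K \<Longrightarrow> h x \<le> h x1"
      using continuous_attains_sup[OF \<open>compact K\<close> False continuous_on_subset[OF cont(1)]] by auto
    have "h x0 > 0" "h x1 > 0" using x0(1) x1(1) \<open>\<epsilon> > 0\<close> by (auto simp: K_def)
    hence pos: "D x0 > 0" using zero[of x0] nonneg[of x0] by (cases "D x0 = 0") auto
    have "h x \<le> \<epsilon> + (h x1 / D x0) * D x" if "x \<in> sphere 0 1" for x
    proof (cases "x \<in> K")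
      case True
      have "h x \<le> (h x1 / D x0) * D x0" using x1(2)[OF True] pos by simp
      also have "\<dots> \<le> (h x1 / D x0) * D x"
        using x0(2)[OF True] pos \<open>h x1 > 0\<close> by (intro mult_left_mono) auto
      finally show ?thesis using \<open>\<epsilon> > 0\<close> by simp
    next
      case False
      hence "h x < \<epsilon>" using that by (simp add: K_def)
      moreover have "0 \<le> (h x1 / D x0) * D x" using pos \<open>h x1 > 0\<close> nonneg[of x] by simp
      ultimately show ?thesis by linarith
    qed
    thus ?thesis using pos \<open>h x1 > 0\<close> by (intro exI[of _ "h x1 / D x0"]) auto
  qed
  then obtain C where C: "C > 0" "\<And>x. x \<in> sphere 0 1 \<Longrightarrow> h x \<le> \<epsilon> + C * D x" by blast
  show thesis
  proof (rule that[OF C(1)])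
    fix x
    show "h x \<le> \<epsilon> * norm x powr q + C * D x"
    proof (cases "x = 0")
      case False
      let ?y = "x /\<^sub>R norm x"
      have "h x = norm x powr q * h ?y" "D x = norm x powr q * D ?y"
        using pos_homogeneous_sphere[OF hom(1) False] pos_homogeneous_sphere[OF hom(2) False] by simp_all
      moreover have "norm x powr q * h ?y \<le> norm x powr q * (\<epsilon> + C * D ?y)"
        using False by (intro mult_left_mono C(2)) auto
      ultimately show ?thesis by (simp add: algebra_simps)
    qed (use pos_homogeneous_zero[OF hom(1,3)] pos_homogeneous_zero[OF hom(2,3)] in auto)
  qed
qed

lemma powr_add_le:
  fixes a b p :: real
  assumes "0 \<le> a" "0 \<le> b" "0 \<le> p"
  shows "(a + b) powr p \<le> 2 powr p * (a powr p + b powr p)"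
proof -
  have "(a + b) powr p \<le> (2 * max a b) powr p"
    using assms by (intro powr_mono2) auto
  also have "\<dots> = 2 powr p * max a b powr p"
    using assms by (simp add: powr_mult)
  also have "\<dots> \<le> 2 powr p * (a powr p + b powr p)"
    by (intro mult_left_mono) (auto simp: max_def)
  finally show ?thesis .
qed

text \<open>Splitting at \<open>t = e\<close>, with \<open>e\<close> at our disposal: this is how convergence of \<open>p\<close>-th moments
  on a set of finite measure gives convergence in \<open>L\<^sup>1\<close>.\<close>

lemma powr_le_affine:
  fixes t p e :: real
  assumes "0 \<le> t" "1 < p" "e > 0"
  shows "t \<le> e + e powr (1 - p) * t powr p"
proof (cases "t \<le> e")
  case True
  thus ?thesis by (intro order.trans[OF True]) simp
next
  case False
  have "e powr (p - 1) \<le> t powr (p - 1)" using False assms by (intro powr_mono2) auto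
  hence "t * e powr (p - 1) \<le> t * t powr (p - 1)" using assms by (intro mult_left_mono) auto
  also have "\<dots> = t powr p" using False assms by (simp add: powr_mult_base)
  finally have "t \<le> e powr (1 - p) * t powr p"
    using assms by (simp add: powr_diff field_simps)
  thus ?thesis using assms by linarith
qed

lemma pos_homogeneousI:
  "(\<And>t x. t > 0 \<Longrightarrow> h (t *\<^sub>R x) = t powr q *\<^sub>R h x) \<Longrightarrow> pos_homogeneous q h"
  by (simp add: pos_homogeneous_def)

lemma pos_homogeneous_compose_linear:
  assumes "pos_homogeneous q h" "linear l"
  shows "pos_homogeneous q (\<lambda>w. h (l w))"
  by (rule pos_homogeneousI) (simp add: linear_scale[OF assms(2)] pos_homogeneousD[OF assms(1)])

lemma pos_homogeneous_diff:
  "pos_homogeneous q f \<Longrightarrow> pos_homogeneous q g \<Longrightarrow> pos_homogeneous q (\<lambda>w. f w - g w)"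
  by (simp add: pos_homogeneous_def scaleR_diff_right)

lemma pos_homogeneous_abs:
  fixes h :: "'a::real_vector \<Rightarrow> real"
  assumes "pos_homogeneous q h"
  shows "pos_homogeneous q (\<lambda>w. \<bar>h w\<bar>)"
  by (rule pos_homogeneousI) (simp add: pos_homogeneousD[OF assms] abs_mult)

lemma pos_homogeneous_inner:
  fixes h :: "'a::real_vector \<Rightarrow> 'b::real_inner"
  assumes "pos_homogeneous (q - 1) h" "linear l"
  shows "pos_homogeneous q (\<lambda>w. h w \<bullet> l w)"
proof (rule pos_homogeneousI)
  fix t :: real and x assume t: "t > 0"
  have "h (t *\<^sub>R x) \<bullet> l (t *\<^sub>R x) = (t * t powr (q - 1)) * (h x \<bullet> l x)"
    by (simp add: pos_homogeneousD[OF assms(1) t] linear_scale[OF assms(2)])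
  also have "t * t powr (q - 1) = t powr q" using powr_mult_base[of t "q - 1"] t by simp
  finally show "h (t *\<^sub>R x) \<bullet> l (t *\<^sub>R x) = t powr q *\<^sub>R (h x \<bullet> l x)" by simp
qed

lemma pos_homogeneous_norm_powr:
  assumes "linear l"
  shows "pos_homogeneous q (\<lambda>w. norm (l w) powr q)"
  by (rule pos_homogeneousI) (simp add: linear_scale[OF assms] powr_mult)

text \<open>The duality map \<open>s \<mapsto> \<bar>s\<bar>\<^sup>p\<^sup>-\<^sup>2 s\<close>, the one-dimensional counterpart of the flux.\<close>

definition signed_power :: "real \<Rightarrow> real \<Rightarrow> real" where
  "signed_power p s = \<bar>s\<bar> powr (p - 2) * s"

lemma signed_power_homogeneous: "pos_homogeneous (p - 1) (signed_power p)"
  unfolding pos_homogeneous_def signed_power_def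
proof (intro allI impI)
  fix t s :: real assume "t > 0"
  have "t powr (p - 1) = t powr (p - 2) * t"
    using powr_mult_base[of t "p - 2"] \<open>t > 0\<close> by (simp add: mult.commute)
  thus "\<bar>t *\<^sub>R s\<bar> powr (p - 2) * (t *\<^sub>R s) = t powr (p - 1) *\<^sub>R (\<bar>s\<bar> powr (p - 2) * s)"
    using \<open>t > 0\<close> by (simp add: abs_mult powr_mult)
qed

lemma signed_power_continuous:
  assumes "1 < p"
  shows "continuous_on UNIV (signed_power p)"
proof (rule pos_homogeneous_continuous[OF signed_power_homogeneous])
  show "continuous_on (- {0}) (signed_power p)"
    unfolding signed_power_def[abs_def] by (intro continuous_intros) auto
qed (use assms in simp)

lemma signed_power_mult_self:
  assumes "1 < p"
  shows "signed_power p s * s = \<bar>s\<bar> powr p"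
proof (cases "s = 0")
  case False
  have "signed_power p s * s = \<bar>s\<bar> * (\<bar>s\<bar> * \<bar>s\<bar> powr (p - 2))"
    by (simp add: signed_power_def)
  also have "\<dots> = \<bar>s\<bar> powr p"
    using False powr_mult_base[of "\<bar>s\<bar>" "p - 2"] powr_mult_base[of "\<bar>s\<bar>" "p - 1"] by simp
  finally show ?thesis .
qed (use assms in \<open>simp add: signed_power_def\<close>)

section \<open>The Lebesgue space of a bounded open set\<close>

locale bounded_open_domain =
  fixes \<Omega> :: "(real ^ 'n) set" and p :: real
  assumes p: "1 < p" and domain_bounded: "bounded \<Omega>" and domain_open: "open \<Omega>"
begin

abbreviation "M \<equiv> lebesgue_on \<Omega>"

text \<open>The \<open>p\<close>-th power of the \<open>L\<^sup>p\<close> norm.  It satisfies the triangle inequality only up to the factor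
  \<open>2\<^sup>p\<close>, which is harmless for limits, and it avoids roots.\<close>

definition modular :: "(real ^ 'n \<Rightarrow> 'b :: euclidean_space) \<Rightarrow> real" where
  "modular f = (LINT x|M. norm (f x) powr p)"

lemma lmeasurable: "\<Omega> \<in> lmeasurable"
  using domain_bounded domain_open by (rule lmeasurable_open)

lemma sets_lebesgue [simp]: "\<Omega> \<in> sets lebesgue"
  using lmeasurable by (rule fmeasurableD)

lemma finite_measure: "finite_measure M"
  by (rule finite_measure_lebesgue_on[OF lmeasurable])

lemma integrable_const_M [simp]: "integrable M (\<lambda>_. c :: 'b :: euclidean_space)"
  by (rule finite_measure.integrable_const[OF finite_measure])

lemma modular_nonneg: "0 \<le> modular f"
  unfolding modular_def by (rule integral_nonneg_AE) simp

lemma Lp_measurable: "f \<in> Lp p \<Omega> \<Longrightarrow> f \<in> borel_measurable M"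
  and Lp_integrable: "f \<in> Lp p \<Omega> \<Longrightarrow> integrable M (\<lambda>x. norm (f x) powr p)"
  by (simp_all add: Lp_def)

lemma LpI_bound:
  assumes f: "f \<in> borel_measurable M" and g: "integrable M g"
    and le: "\<And>x. x \<in> \<Omega> \<Longrightarrow> norm (f x) powr p \<le> g x"
  shows "f \<in> Lp p \<Omega>"
proof -
  have "integrable M (\<lambda>x. norm (f x) powr p)"
    using g by (rule Bochner_Integration.integrable_bound)
      (use f le in \<open>auto intro!: AE_I2 simp: order.trans[OF le abs_ge_self]\<close>)
  thus ?thesis using f by (simp add: Lp_def)
qed

lemma Lp_add_aux:
  assumes "f \<in> Lp p \<Omega>" "g \<in> Lp p \<Omega>" "h \<in> borel_measurable M"
    and le: "\<And>x. norm (h x) \<le> norm (f x) + norm (g x)"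
  shows "h \<in> Lp p \<Omega>" "modular h \<le> 2 powr p * (modular f + modular g)"
proof -
  have le': "norm (h x) powr p \<le> 2 powr p * (norm (f x) powr p + norm (g x) powr p)" for x
  proof -
    have "norm (h x) powr p \<le> (norm (f x) + norm (g x)) powr p"
      using le p by (intro powr_mono2) auto
    also have "\<dots> \<le> 2 powr p * (norm (f x) powr p + norm (g x) powr p)"
      using p by (intro powr_add_le) auto
    finally show ?thesis .
  qed
  show "h \<in> Lp p \<Omega>"
    by (rule LpI_bound[OF assms(3) _ le']) (use assms(1,2) in \<open>auto simp: Lp_integrable\<close>)
  hence "modular h \<le> (LINT x|M. 2 powr p * (norm (f x) powr p + norm (g x) powr p))"
    unfolding modular_def using le' assms(1,2)
    by (intro integral_mono) (auto simp: Lp_integrable)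
  also have "\<dots> = 2 powr p * (modular f + modular g)"
    unfolding modular_def using assms(1,2) by (simp add: Lp_integrable)
  finally show "modular h \<le> 2 powr p * (modular f + modular g)" .
qed

lemma Lp_add: "f \<in> Lp p \<Omega> \<Longrightarrow> g \<in> Lp p \<Omega> \<Longrightarrow> (\<lambda>x. f x + g x) \<in> Lp p \<Omega>"
  and modular_add_le: "f \<in> Lp p \<Omega> \<Longrightarrow> g \<in> Lp p \<Omega> \<Longrightarrow>
    modular (\<lambda>x. f x + g x) \<le> 2 powr p * (modular f + modular g)"
proof -
  assume *: "f \<in> Lp p \<Omega>" "g \<in> Lp p \<Omega>"
  have m: "(\<lambda>x. f x + g x) \<in> borel_measurable M"
    by (intro borel_measurable_add borel_measurable_diff Lp_measurable *)
  show "(\<lambda>x. f x + g x) \<in> Lp p \<Omega>" "modular (\<lambda>x. f x + g x) \<le> 2 powr p * (modular f + modular g)"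
    by (rule Lp_add_aux[OF * m norm_triangle_ineq])+
qed

lemma Lp_diff: "f \<in> Lp p \<Omega> \<Longrightarrow> g \<in> Lp p \<Omega> \<Longrightarrow> (\<lambda>x. f x - g x) \<in> Lp p \<Omega>"
  and modular_diff_le: "f \<in> Lp p \<Omega> \<Longrightarrow> g \<in> Lp p \<Omega> \<Longrightarrow>
    modular (\<lambda>x. f x - g x) \<le> 2 powr p * (modular f + modular g)"
proof -
  assume *: "f \<in> Lp p \<Omega>" "g \<in> Lp p \<Omega>"
  have m: "(\<lambda>x. f x - g x) \<in> borel_measurable M"
    by (intro borel_measurable_add borel_measurable_diff Lp_measurable *)
  show "(\<lambda>x. f x - g x) \<in> Lp p \<Omega>" "modular (\<lambda>x. f x - g x) \<le> 2 powr p * (modular f + modular g)"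
    by (rule Lp_add_aux[OF * m norm_triangle_ineq4])+
qed

lemma modular_triangle:
  assumes "f \<in> Lp p \<Omega>" "g \<in> Lp p \<Omega>" "h \<in> Lp p \<Omega>"
  shows "modular (\<lambda>x. f x - h x) \<le>
    2 powr p * (modular (\<lambda>x. f x - g x) + modular (\<lambda>x. g x - h x))"
  using modular_add_le[OF Lp_diff[OF assms(1,2)] Lp_diff[OF assms(2,3)]] by simp

lemma modular_minus_commute: "modular (\<lambda>x. f x - g x) = modular (\<lambda>x. g x - f x)"
  by (simp add: modular_def norm_minus_commute)

lemma Lp_scaleR: "f \<in> Lp p \<Omega> \<Longrightarrow> (\<lambda>x. c *\<^sub>R f x) \<in> Lp p \<Omega>"
  by (auto simp: Lp_def powr_mult)

lemma modular_scaleR: "modular (\<lambda>x. c *\<^sub>R f x) = \<bar>c\<bar> powr p * modular f"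
  by (simp add: modular_def powr_mult)

lemma Lp_Pair:
  assumes "f \<in> Lp p \<Omega>" "g \<in> Lp p \<Omega>"
  shows "(\<lambda>x. (f x, g x)) \<in> Lp p \<Omega>"
    "modular (\<lambda>x. (f x, g x)) \<le> 2 powr p * (modular f + modular g)"
proof -
  note [measurable] = Lp_measurable[OF assms(1)] Lp_measurable[OF assms(2)]
  have m: "(\<lambda>x. (f x, g x)) \<in> borel_measurable M" by (simp add: borel_prod[symmetric])
  have le: "norm (f x, g x) \<le> norm (f x) + norm (g x)" for x
    by (simp add: norm_Pair sqrt_sum_squares_le_sum)
  show "(\<lambda>x. (f x, g x)) \<in> Lp p \<Omega>"
    "modular (\<lambda>x. (f x, g x)) \<le> 2 powr p * (modular f + modular g)"
    by (rule Lp_add_aux[OF assms m le])+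
qed

lemma modular_cong_AE:
  assumes "f \<in> borel_measurable M" "g \<in> borel_measurable M" "AE x in M. f x = g x"
  shows "modular f = modular g"
  unfolding modular_def using assms by (intro integral_cong_AE) auto

lemma Lp_imp_integrable:
  assumes "f \<in> Lp p \<Omega>"
  shows "integrable M f"
proof (rule Bochner_Integration.integrable_bound)
  show "integrable M (\<lambda>x. 1 + norm (f x) powr p)"
    using assms by (simp add: Lp_integrable)
  show "AE x in M. norm (f x) \<le> norm (1 + norm (f x) powr p)"
    using powr_le_affine[of "norm (f _)" p 1] p by (intro AE_I2) simp
qed (use assms in \<open>simp add: Lp_measurable\<close>)

lemma L1_le_modular:
  assumes "f \<in> Lp p \<Omega>" "e > 0"
  shows "(LINT x|M. norm (f x)) \<le> e * measure lebesgue \<Omega> + e powr (1 - p) * modular f"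
proof -
  have "(LINT x|M. norm (f x)) \<le> (LINT x|M. e + e powr (1 - p) * norm (f x) powr p)"
    using assms p powr_le_affine[of "norm (f _)" p e]
    by (intro integral_mono) (auto simp: Lp_integrable Lp_imp_integrable)
  also have "\<dots> = e * measure M (space M) + e powr (1 - p) * modular f"
    unfolding modular_def using assms by (simp add: Lp_integrable mult.commute)
  also have "measure M (space M) = measure lebesgue \<Omega>"
    by (simp add: measure_restrict_space)
  finally show ?thesis .
qed

lemma L1_tendsto_zero:
  assumes f: "\<And>k. f k \<in> Lp p \<Omega>" and lim: "(\<lambda>k. modular (f k)) \<longlonglongrightarrow> 0"
  shows "(\<lambda>k. LINT x|M. norm (f k x)) \<longlonglongrightarrow> 0"
proof (rule LIMSEQ_I)
  fix r :: real assume "r > 0"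
  define e where "e = r / (2 * (measure lebesgue \<Omega> + 1))"
  have "e > 0" using \<open>r > 0\<close> unfolding e_def by (intro divide_pos_pos) (auto simp: add_nonneg_pos)
  have e: "e * measure lebesgue \<Omega> < r / 2"
  proof -
    have "e * measure lebesgue \<Omega> < e * (measure lebesgue \<Omega> + 1)"
      using \<open>e > 0\<close> by simp
    also have "\<dots> = r / 2" 
      unfolding e_def using measure_nonneg[of lebesgue \<Omega>] by (simp add: field_simps add_nonneg_eq_0_iff)
    finally show ?thesis .
  qed
  have "(\<lambda>k. e powr (1 - p) * modular (f k)) \<longlonglongrightarrow> 0"
    using tendsto_mult_right_zero[OF lim] .
  then have "\<forall>\<^sub>F k in sequentially. e powr (1 - p) * modular (f k) < r / 2"
    by (rule order_tendstoD(2)) (use \<open>r > 0\<close> in auto)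
  then obtain N where N: "\<And>k. k \<ge> N \<Longrightarrow> e powr (1 - p) * modular (f k) < r / 2"
    by (auto simp: eventually_sequentially)
  show "\<exists>N. \<forall>k\<ge>N. norm ((LINT x|M. norm (f k x)) - 0) < r"
  proof (intro exI allI impI)
    fix k assume "k \<ge> N"
    have "(LINT x|M. norm (f k x)) < r"
      using L1_le_modular[OF f \<open>e > 0\<close>, of k] N[OF \<open>k \<ge> N\<close>] e by linarith
    moreover have "(LINT x|M. norm (f k x)) \<ge> 0" by simp
    ultimately show "norm ((LINT x|M. norm (f k x)) - 0) < r" by simp
  qed
qed

definition Cauchy_Lp :: "(nat \<Rightarrow> real ^ 'n \<Rightarrow> 'b :: euclidean_space) \<Rightarrow> bool" where
  "Cauchy_Lp f \<longleftrightarrow> (\<forall>e>0. \<exists>N. \<forall>i\<ge>N. \<forall>j\<ge>N. modular (\<lambda>x. f i x - f j x) < e)"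

lemma Cauchy_LpD:
  "Cauchy_Lp f \<Longrightarrow> e > 0 \<Longrightarrow> \<exists>N. \<forall>i\<ge>N. \<forall>j\<ge>N. modular (\<lambda>x. f i x - f j x) < e"
  by (simp add: Cauchy_Lp_def)

text \<open>Since \<open>\<Omega>\<close> has finite measure, a Cauchy sequence in \<open>L\<^sup>p\<close> is Cauchy in \<open>L\<^sup>1\<close>, so a
  subsequence converges almost everywhere; Fatou's lemma turns the Cauchy estimate into an
  estimate for the distance to the pointwise limit.\<close>

lemma Lp_complete:
  fixes f :: "nat \<Rightarrow> real ^ 'n \<Rightarrow> 'b :: euclidean_space"
  assumes f: "\<And>k. f k \<in> Lp p \<Omega>" and cauchy: "Cauchy_Lp f"
  obtains g where "g \<in> Lp p \<Omega>" "(\<lambda>k. modular (\<lambda>x. f k x - g x)) \<longlonglongrightarrow> 0"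
proof -
  note [measurable] = Lp_measurable[OF f]
  have L1: "\<exists>N. \<forall>i\<ge>N. \<forall>j\<ge>N. LINT x|M. norm (f i x - f j x) < e" if "e > 0" for e
  proof (rule ccontr)
    assume "\<not> ?thesis"
    hence "\<forall>N. \<exists>i j. i \<ge> N \<and> j \<ge> N \<and> \<not> (LINT x|M. norm (f i x - f j x)) < e" by blast
    then obtain I J where IJ: "\<And>N. I N \<ge> N" "\<And>N. J N \<ge> N"
        "\<And>N. \<not> (LINT x|M. norm (f (I N) x - f (J N) x)) < e" by metis
    have "(\<lambda>N. modular (\<lambda>x. f (I N) x - f (J N) x)) \<longlonglongrightarrow> 0"
    proof (rule LIMSEQ_I)
      fix r :: real assume "r > 0"
      then obtain N0 where "\<forall>i\<ge>N0. \<forall>j\<ge>N0. modular (\<lambda>x. f i x - f j x) < r"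
        using Cauchy_LpD[OF cauchy] by blast
      thus "\<exists>N0. \<forall>N\<ge>N0. norm (modular (\<lambda>x. f (I N) x - f (J N) x) - 0) < r"
        using IJ(1,2) by (intro exI[of _ N0] allI impI)
          (simp add: modular_nonneg, meson order.trans)
    qed
    hence "(\<lambda>N. LINT x|M. norm (f (I N) x - f (J N) x)) \<longlonglongrightarrow> 0"
      by (intro L1_tendsto_zero[of "\<lambda>N x. f (I N) x - f (J N) x"] Lp_diff f)
    hence "\<exists>N. (LINT x|M. norm (f (I N) x - f (J N) x)) < e"
      using order_tendstoD(2)[of _ 0 sequentially e] \<open>e > 0\<close>
      by (metis (no_types, lifting) eventually_sequentially order_refl)
    thus False using IJ(3) by blast
  qed
  obtain r where r: "strict_mono r" "AE x in M. Cauchy (\<lambda>i. f (r i) x)"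
    using cauchy_L1_AE_cauchy_subseq[of M f] L1 Lp_imp_integrable[OF f] by blast
  define g where "g x = lim (\<lambda>i. f (r i) x)" for x
  have [measurable]: "g \<in> borel_measurable M"
    unfolding g_def by measurable
  have lim: "AE x in M. (\<lambda>i. f (r i) x) \<longlonglongrightarrow> g x"
    using r(2) by eventually_elim (simp add: g_def Cauchy_convergent convergent_LIMSEQ_iff[symmetric])
  have nn: "(\<integral>\<^sup>+x. ennreal (norm (f k x - g x) powr p) \<partial>M) \<le> ennreal e"
    if N: "\<forall>i\<ge>N. \<forall>j\<ge>N. modular (\<lambda>x. f i x - f j x) < e" and "k \<ge> N" for N e k
  proof -
    have eq: "(\<integral>\<^sup>+x. ennreal (norm (f k x - f j x) powr p) \<partial>M) = ennreal (modular (\<lambda>x. f k x - f j x))" for j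
      unfolding modular_def using Lp_diff[OF f f] by (intro nn_integral_eq_integral) (auto simp: Lp_integrable)
    have "(\<integral>\<^sup>+x. ennreal (norm (f k x - g x) powr p) \<partial>M)
        = (\<integral>\<^sup>+x. liminf (\<lambda>i. ennreal (norm (f k x - f (r i) x) powr p)) \<partial>M)"
    proof (rule nn_integral_cong_AE)
      show "AE x in M. ennreal (norm (f k x - g x) powr p) =
          liminf (\<lambda>i. ennreal (norm (f k x - f (r i) x) powr p))"
        using lim
      proof eventually_elim
        case (elim x)
        have "(\<lambda>i. norm (f k x - f (r i) x) powr p) \<longlonglongrightarrow> norm (f k x - g x) powr p"
          using elim p by (intro tendsto_powr' tendsto_intros) auto
        hence "(\<lambda>i. ennreal (norm (f k x - f (r i) x) powr p)) \<longlonglongrightarrow> ennreal (norm (f k x - g x) powr p)"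
          by (rule tendsto_ennrealI)
        thus ?case by (rule lim_imp_Liminf[OF sequentially_bot, symmetric])
      qed
    qed
    also have "\<dots> \<le> liminf (\<lambda>i. \<integral>\<^sup>+x. ennreal (norm (f k x - f (r i) x) powr p) \<partial>M)"
      by (rule nn_integral_liminf) measurable
    also have "\<dots> = liminf (\<lambda>i. ennreal (modular (\<lambda>x. f k x - f (r i) x)))"
      by (simp add: eq)
    also have "\<dots> \<le> ennreal e"
    proof (rule Liminf_le)
      show "\<forall>\<^sub>F i in sequentially. ennreal (modular (\<lambda>x. f k x - f (r i) x)) \<le> ennreal e"
      proof (rule eventually_sequentiallyI[of N])
        fix i assume "N \<le> i"
        hence "N \<le> r i" using seq_suble[OF r(1), of i] by linarith
        thus "ennreal (modular (\<lambda>x. f k x - f (r i) x)) \<le> ennreal e"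
          using N \<open>k \<ge> N\<close> by (intro ennreal_leI) (auto intro: less_imp_le)
      qed
    qed simp
    finally show ?thesis .
  qed
  have diff: "(\<lambda>x. f k x - g x) \<in> Lp p \<Omega> \<and> modular (\<lambda>x. f k x - g x) \<le> e"
    if N: "\<forall>i\<ge>N. \<forall>j\<ge>N. modular (\<lambda>x. f i x - f j x) < e" and "k \<ge> N" "e > 0" for N e k
  proof -
    have "integrable M (\<lambda>x. norm (f k x - g x) powr p)"
      using nn[OF N \<open>k \<ge> N\<close>] by (intro integrableI_bounded) (auto intro: le_less_trans)
    hence "(\<lambda>x. f k x - g x) \<in> Lp p \<Omega>" by (simp add: Lp_def)
    moreover have "ennreal (modular (\<lambda>x. f k x - g x)) \<le> ennreal e"
      unfolding modular_def using nn[OF N \<open>k \<ge> N\<close>] calculation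
      by (subst nn_integral_eq_integral[symmetric]) (auto simp: Lp_integrable)
    hence "modular (\<lambda>x. f k x - g x) \<le> e"
      using \<open>e > 0\<close> by simp
    ultimately show ?thesis by blast
  qed
  show thesis
  proof
    obtain N where "\<forall>i\<ge>N. \<forall>j\<ge>N. modular (\<lambda>x. f i x - f j x) < 1"
      using Cauchy_LpD[OF cauchy zero_less_one] by blast
    from diff[OF this order_refl] have "(\<lambda>x. f N x - (f N x - g x)) \<in> Lp p \<Omega>"
      by (rule Lp_diff[OF f conjunct1]) simp
    thus "g \<in> Lp p \<Omega>" by simp
    show "(\<lambda>k. modular (\<lambda>x. f k x - g x)) \<longlonglongrightarrow> 0"
    proof (rule LIMSEQ_I)
      fix e :: real assume "e > 0"
      then obtain N where N: "\<forall>i\<ge>N. \<forall>j\<ge>N. modular (\<lambda>x. f i x - f j x) < e / 2"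
        using Cauchy_LpD[OF cauchy, of "e / 2"] by auto
      show "\<exists>N. \<forall>k\<ge>N. norm (modular (\<lambda>x. f k x - g x) - 0) < e"
      proof (intro exI allI impI)
        fix k assume "k \<ge> N"
        with diff[OF N this] \<open>e > 0\<close> modular_nonneg[of "\<lambda>x. f k x - g x"]
        show "norm (modular (\<lambda>x. f k x - g x) - 0) < e" by auto
      qed
    qed
  qed
qed

lemma Cauchy_Lp_convergent:
  assumes f: "\<And>k. f k \<in> Lp p \<Omega>" "g \<in> Lp p \<Omega>" and lim: "(\<lambda>k. modular (\<lambda>x. f k x - g x)) \<longlonglongrightarrow> 0"
  shows "Cauchy_Lp f"
  unfolding Cauchy_Lp_def
proof (intro allI impI)
  fix e :: real assume "e > 0"
  define d where "d = e / (2 * 2 powr p)"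
  have d: "d > 0" "2 powr p * (d + d) = e" using \<open>e > 0\<close> by (auto simp: d_def field_simps)
  obtain N where N: "\<And>k. k \<ge> N \<Longrightarrow> modular (\<lambda>x. f k x - g x) < d"
    using order_tendstoD(2)[OF lim d(1)] by (auto simp: eventually_sequentially)
  show "\<exists>N. \<forall>i\<ge>N. \<forall>j\<ge>N. modular (\<lambda>x. f i x - f j x) < e"
  proof (intro exI allI impI)
    fix i j assume "i \<ge> N" "j \<ge> N"
    have "modular (\<lambda>x. f i x - f j x) \<le> 2 powr p * (modular (\<lambda>x. f i x - g x) + modular (\<lambda>x. g x - f j x))"
      by (intro modular_triangle f)
    also have "\<dots> < 2 powr p * (d + d)"
      using N[OF \<open>i \<ge> N\<close>] N[OF \<open>j \<ge> N\<close>] 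
      by (intro mult_strict_left_mono add_strict_mono) (auto simp: modular_minus_commute[of g])
    finally show "modular (\<lambda>x. f i x - f j x) < e" using d by simp
  qed
qed

lemma homogeneous_integrable:
  fixes h :: "'b::euclidean_space \<Rightarrow> real"
  assumes "pos_homogeneous p h" "continuous_on UNIV h" "f \<in> Lp p \<Omega>"
  shows "integrable M (\<lambda>x. h (f x))"
proof -
  obtain C where C: "C \<ge> 0" "\<And>x. norm (h x) \<le> C * norm x powr p"
    using pos_homogeneous_bounded[OF assms(1) _ continuous_on_subset[OF assms(2)]] p by auto
  show ?thesis
  proof (rule Bochner_Integration.integrable_bound)
    show "integrable M (\<lambda>x. C * norm (f x) powr p)"
      using assms(3) by (simp add: Lp_integrable)
    show "(\<lambda>x. h (f x)) \<in> borel_measurable M"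
      using borel_measurable_continuous_onI[OF assms(2)] Lp_measurable[OF assms(3)] by (rule measurable_compose_rev)
    show "AE x in M. norm (h (f x)) \<le> norm (C * norm (f x) powr p)"
      using C by (intro AE_I2) (simp add: abs_mult)
  qed
qed

text \<open>The uniform form of the comparison principle, with one \<open>d\<close> for the whole ball of radius \<open>R\<close>; this is
  what makes it applicable to double sequences \<open>(f\<^sub>i, f\<^sub>j)\<close> in proofs of the Cauchy property.\<close>

lemma homogeneous_comparison_integral:
  fixes h D :: "'b::euclidean_space \<Rightarrow> real"
  assumes hom: "pos_homogeneous p h" "pos_homogeneous p D"
    and cont: "continuous_on UNIV h" "continuous_on UNIV D"
    and nonneg: "\<And>x. 0 \<le> D x"
    and zero: "\<And>x. D x = 0 \<Longrightarrow> h x = 0"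
    and "e > 0"
  obtains d where "d > 0" "\<And>f. f \<in> Lp p \<Omega> \<Longrightarrow> modular f \<le> R \<Longrightarrow> (LINT x|M. D (f x)) < d \<Longrightarrow>
    (LINT x|M. h (f x)) < e"
proof -
  define e' where "e' = e / (2 * (\<bar>R\<bar> + 1))"
  have e': "e' > 0" "e' * \<bar>R\<bar> < e / 2" using \<open>e > 0\<close> by (auto simp: e'_def field_simps intro!: divide_pos_pos)
  obtain C where C: "C > 0" "\<And>x. h x \<le> e' * norm x powr p + C * D x"
    using homogeneous_comparison[OF hom _ cont nonneg zero e'(1)] p by auto
  show thesis
  proof (rule that[of "e / (2 * C)"])
    show "e / (2 * C) > 0" using \<open>e > 0\<close> C(1) by simp
    fix f assume f: "f \<in> Lp p \<Omega>" "modular f \<le> R" and D: "(LINT x|M. D (f x)) < e / (2 * C)"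
    have "(LINT x|M. h (f x)) \<le> (LINT x|M. e' * norm (f x) powr p + C * D (f x))"
      using C(2) f homogeneous_integrable[OF hom(1) cont(1) f(1)] homogeneous_integrable[OF hom(2) cont(2) f(1)]
      by (intro integral_mono) (auto simp: Lp_integrable)
    also have "\<dots> = e' * modular f + C * (LINT x|M. D (f x))"
      unfolding modular_def using f homogeneous_integrable[OF hom(2) cont(2) f(1)]
      by (simp add: Lp_integrable)
    also have "\<dots> < e / 2 + e / 2"
    proof (rule add_strict_mono)
      have "e' * modular f \<le> e' * \<bar>R\<bar>" using f(2) e'(1) by (intro mult_left_mono) auto
      thus "e' * modular f < e / 2" using e'(2) by linarith
      show "C * (LINT x|M. D (f x)) < e / 2" using D C(1) by (simp add: field_simps)
    qed
    finally show "(LINT x|M. h (f x)) < e" by simp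
  qed
qed

end

section \<open>Smooth functions and smooth indicators of boxes\<close>

lemma grad_eqI:
  assumes "(f has_derivative f') (at x)"
  shows "grad f x $ i = f' (axis i 1)"
  using frechet_derivative_at[OF assms] by (simp add: grad_def)

lemma linear_real_eq_inner:
  fixes l :: "real ^ 'n \<Rightarrow> real"
  assumes "linear l"
  shows "l v = (\<chi> i. l (axis i 1)) \<bullet> v"
proof -
  have "v = (\<Sum>i\<in>UNIV. v $ i *\<^sub>R axis i 1)"
    using basis_expansion[of v] by (simp add: scalar_mult_eq_scaleR)
  hence "l v = l (\<Sum>i\<in>UNIV. v $ i *\<^sub>R axis i 1)"
    by (rule arg_cong)
  also have "\<dots> = (\<Sum>i\<in>UNIV. v $ i * l (axis i 1))"
    using assms by (simp add: linear_sum linear_scale)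
  also have "\<dots> = (\<chi> i. l (axis i 1)) \<bullet> v"
    by (simp add: inner_vec_def mult.commute)
  finally show ?thesis .
qed

lemma has_derivative_grad:
  assumes "f differentiable (at x)"
  shows "(f has_derivative (\<lambda>v. grad f x \<bullet> v)) (at x)"
proof -
  have d: "(f has_derivative frechet_derivative f (at x)) (at x)"
    using assms by (simp add: frechet_derivative_works)
  have "frechet_derivative f (at x) = (\<lambda>v. grad f x \<bullet> v)"
    unfolding grad_def by (rule ext) (rule linear_real_eq_inner[OF has_derivative_linear[OF d]])
  thus ?thesis using d by (simp only:)
qed

lemma has_derivative_grad_unique:
  assumes "(f has_derivative (\<lambda>v. g \<bullet> v)) (at x)"
  shows "grad f x = g"
  by (simp add: vec_eq_iff grad_eqI[OF assms] inner_axis)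

lemma Ck_on_SucD: "Ck_on (Suc k) f UNIV \<Longrightarrow> Ck_on k f UNIV"
proof (induction k arbitrary: f)
  case 0
  hence "isCont f x" for x by (simp add: differentiable_imp_continuous_within)
  thus ?case by (simp add: continuous_at_imp_continuous_on)
next
  case (Suc k)
  have "\<forall>i. Ck_on (Suc k) (\<lambda>x. grad f x $ i) UNIV" and d: "\<forall>x\<in>UNIV. f differentiable (at x)"
    using iffD1[OF Ck_on.simps(2) Suc.prems] by blast+
  hence "\<forall>i. Ck_on k (\<lambda>x. grad f x $ i) UNIV" by (blast intro: Suc.IH)
  thus ?case using d unfolding Ck_on.simps(2) by blast
qed

lemma Ck_on_const: "Ck_on k (\<lambda>_::real^'n. c) UNIV"
proof (induction k arbitrary: c)
  case (Suc k)
  have "grad (\<lambda>_::real^'n. c) x $ i = 0" for x and i :: "'n::finite"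
    by (rule grad_eqI) (rule has_derivative_const)
  thus ?case using Suc by simp
qed simp

lemma Ck_on_add:
  assumes "Ck_on k f UNIV" "Ck_on k g UNIV"
  shows "Ck_on k (\<lambda>x. f x + g x) UNIV"
  using assms
proof (induction k arbitrary: f g)
  case (Suc k)
  hence d: "f differentiable at x" "g differentiable at x" for x by auto
  have "grad (\<lambda>x. f x + g x) x $ i = grad f x $ i + grad g x $ i" for x i
    using grad_eqI[OF has_derivative_add[OF has_derivative_grad[OF d(1)] has_derivative_grad[OF d(2)]]]
    by (simp add: inner_axis)
  hence "Ck_on k (\<lambda>x. grad (\<lambda>x. f x + g x) x $ i) UNIV" for i
    using Suc.prems by (simp add: Suc.IH)
  thus ?case using d by simp
qed (simp add: continuous_on_add)

lemma Ck_on_mult: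
  assumes "Ck_on k f UNIV" "Ck_on k g UNIV"
  shows "Ck_on k (\<lambda>x. f x * g x) UNIV"
  using assms
proof (induction k arbitrary: f g)
  case (Suc k)
  hence d: "f differentiable at x" "g differentiable at x" for x by auto
  have "grad (\<lambda>x. f x * g x) x $ i = f x * grad g x $ i + grad f x $ i * g x" for x i
    using grad_eqI[OF has_derivative_mult[OF has_derivative_grad[OF d(1)] has_derivative_grad[OF d(2)]]]
    by (simp add: inner_axis)
  moreover have "Ck_on k f UNIV" "Ck_on k g UNIV"
    using Suc.prems by (blast intro: Ck_on_SucD)+
  ultimately have "Ck_on k (\<lambda>x. grad (\<lambda>x. f x * g x) x $ i) UNIV" for i
    using Suc.prems by (simp add: Ck_on_add Suc.IH)
  thus ?case using d by (simp add: differentiable_mult)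
qed (simp add: continuous_on_mult)

lemma Ck_on_prod:
  assumes "finite I" "\<And>i. i \<in> I \<Longrightarrow> Ck_on k (f i) UNIV"
  shows "Ck_on k (\<lambda>x. \<Prod>i\<in>I. f i x) UNIV"
  using assms by (induction I rule: finite_induct) (simp_all add: Ck_on_const Ck_on_mult)

text \<open>The family \<open>H\<close> lists the successive derivatives of \<open>H 0\<close>.  The free factor \<open>c\<close> makes the
  statement stable under partial differentiation, so that it can be proved by induction.\<close>

lemma Ck_on_compose_coordinate:
  fixes H :: "nat \<Rightarrow> real \<Rightarrow> real"
  assumes H: "\<And>j t. (H j has_real_derivative H (Suc j) t) (at t)"
  shows "Ck_on k (\<lambda>x::real^'n. c * H j (s * x $ i + b)) UNIV"
proof (induction k arbitrary: c j)
  case 0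
  have "continuous_on UNIV (H j)" by (meson H DERIV_isCont continuous_at_imp_continuous_on)
  thus ?case by (auto intro!: continuous_intros continuous_on_compose2[of UNIV "H j"])
next
  case (Suc k)
  have d: "((\<lambda>x. c * H j (s * x $ i + b)) has_derivative (\<lambda>v. c * (s * v $ i * H (Suc j) (s * x $ i + b)))) (at x)"
    for x :: "real^'n"
  proof -
    have "((\<lambda>x. s * x $ i + b) has_derivative (\<lambda>v. s * v $ i)) (at x)"
      by (auto intro!: derivative_eq_intros bounded_linear.has_derivative[OF bounded_linear_vec_nth])
    from DERIV_compose_FDERIV[OF H this] show ?thesis
      by (rule has_derivative_mult_right)
  qed
  have "grad (\<lambda>x. c * H j (s * x $ i + b)) x $ l = (c * s * axis l 1 $ i) * H (Suc j) (s * x $ i + b)"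
    for x and l :: 'n
    by (subst grad_eqI[OF d]) (simp add: algebra_simps)
  moreover have "(\<lambda>x. c * H j (s * x $ i + b)) differentiable (at x)" for x :: "real^'n"
    using d by (rule differentiableI)
  ultimately show ?case using Suc by simp
qed

text \<open>The class of functions \<open>P(1/t) exp(-1/t)\<close>, extended by \<open>0\<close> to \<open>t \<le> 0\<close>, is closed under
  differentiation; this is why the classical flat function \<open>exp(-1/t)\<close>, the case \<open>P = 1\<close>, is smooth.\<close>

definition flat :: "real poly \<Rightarrow> real \<Rightarrow> real" where
  "flat P t = (if t > 0 then poly P (1 / t) * exp (- 1 / t) else 0)"

lemma poly_div_exp_tendsto_0: "((\<lambda>x. poly P x / exp x) \<longlongrightarrow> (0::real)) at_top"
proof -
  have "((\<lambda>x::real. \<Sum>i\<le>degree P. coeff P i * (x ^ i / exp x)) \<longlongrightarrow> (\<Sum>i\<le>degree P. coeff P i * 0)) at_top"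
    by (intro tendsto_intros tendsto_power_div_exp_0)
  thus ?thesis by (simp add: poly_altdef sum_divide_distrib)
qed

text \<open>The polynomial on the right comes from the chain rule.  At \<open>0\<close> the difference quotient
  is \<open>s P(s) exp(-s)\<close> with \<open>s = 1/t\<close>, and the exponential wins.\<close>

lemma flat_deriv: "(flat P has_real_derivative flat ([:0, 0, 1:] * (P - pderiv P)) t) (at t)"
proof (cases t "0::real" rule: linorder_cases)
  case greater
  have i: "((\<lambda>t. 1 / t) has_real_derivative - (1 / t\<^sup>2)) (at t)"
    using greater by (auto intro!: derivative_eq_intros simp: power2_eq_square)
  have "((\<lambda>t. poly P (1 / t)) has_real_derivative poly (pderiv P) (1 / t) * - (1 / t\<^sup>2)) (at t)"
    by (rule DERIV_chain2[OF poly_DERIV i])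
  moreover have "((\<lambda>t. exp (- (1 / t))) has_real_derivative exp (- (1 / t)) * - (- (1 / t\<^sup>2))) (at t)"
    by (rule DERIV_chain2[OF DERIV_exp DERIV_minus[OF i]])
  ultimately have "((\<lambda>t. poly P (1 / t) * exp (- (1 / t))) has_real_derivative
      (poly (pderiv P) (1 / t) * - (1 / t\<^sup>2)) * exp (- (1 / t)) + (exp (- (1 / t)) * - (- (1 / t\<^sup>2))) * poly P (1 / t)) (at t)"
    by (rule DERIV_mult)
  moreover have "(poly (pderiv P) (1 / t) * - (1 / t\<^sup>2)) * exp (- (1 / t)) + (exp (- (1 / t)) * - (- (1 / t\<^sup>2))) * poly P (1 / t)
     = flat ([:0, 0, 1:] * (P - pderiv P)) t"
    using greater by (simp add: flat_def power2_eq_square algebra_simps)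
  ultimately have "((\<lambda>t. poly P (1 / t) * exp (- (1 / t))) has_real_derivative
      flat ([:0, 0, 1:] * (P - pderiv P)) t) (at t)" by (simp only:)
  thus ?thesis
    by (rule has_field_derivative_transform_within_open[of _ _ _ "{0<..}"]) (use greater in \<open>auto simp: flat_def\<close>)
next
  case less
  have "((\<lambda>t. 0) has_real_derivative flat ([:0, 0, 1:] * (P - pderiv P)) t) (at t)"
    using less by (simp add: flat_def)
  thus ?thesis
    by (rule has_field_derivative_transform_within_open[of _ _ _ "{..<0}"]) (use less in \<open>auto simp: flat_def\<close>)
next
  case equal
  have "((\<lambda>y. (flat P y - flat P 0) / (y - 0)) \<longlongrightarrow> 0) (at 0)"
    unfolding filterlim_at_split
  proof
    have "\<forall>\<^sub>F y::real in at_left 0. (flat P y - flat P 0) / (y - 0) = 0"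
      by (auto simp: eventually_at_filter flat_def)
    thus "((\<lambda>y. (flat P y - flat P 0) / (y - 0)) \<longlongrightarrow> 0) (at_left 0)"
      by (rule tendsto_eventually)
    have "((\<lambda>y. poly (pCons 0 P) (inverse y) / exp (inverse y)) \<longlongrightarrow> (0::real)) (at_right 0)"
      by (rule filterlim_compose[OF poly_div_exp_tendsto_0 filterlim_inverse_at_top_right])
    moreover have "\<forall>\<^sub>F y in at_right 0. poly (pCons 0 P) (inverse y) / exp (inverse y) = (flat P y - flat P 0) / (y - 0)"
      by (auto simp: eventually_at_filter flat_def field_simps exp_minus)
    ultimately show "((\<lambda>y. (flat P y - flat P 0) / (y - 0)) \<longlongrightarrow> 0) (at_right 0)"
      by (rule Lim_transform_eventually)
  qed
  thus ?thesis using equal by (simp add: has_field_derivative_iff flat_def)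
qed

lemma smooth_step_coordinate: "Ck_on k (\<lambda>x::real^'n. flat 1 (s * x $ i + b)) UNIV"
proof -
  define H where "H j = flat (((\<lambda>P. [:0, 0, 1:] * (P - pderiv P)) ^^ j) 1)" for j
  have "Ck_on k (\<lambda>x::real^'n. 1 * H 0 (s * x $ i + b)) UNIV"
    by (rule Ck_on_compose_coordinate) (simp only: H_def funpow.simps o_apply flat_deriv)
  thus ?thesis by (simp add: H_def)
qed

lemma flat_one_bounds: "0 \<le> flat 1 t" "flat 1 t \<le> 1" "flat 1 t \<noteq> 0 \<longleftrightarrow> t > 0"
  by (auto simp: flat_def)

lemma flat_one_tendsto:
  assumes "s > 0"
  shows "(\<lambda>m. flat 1 (real m * s)) \<longlonglongrightarrow> 1"
proof -
  have "(\<lambda>m. exp (- ((1 / s) * (1 / real m)))) \<longlonglongrightarrow> exp (- ((1 / s) * 0))"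
    by (intro tendsto_intros lim_1_over_n)
  moreover have "\<forall>\<^sub>F m in sequentially. exp (- ((1 / s) * (1 / real m))) = flat 1 (real m * s)"
    using eventually_gt_at_top[of 0]
    by eventually_elim (use assms in \<open>auto simp: flat_def field_simps\<close>)
  ultimately show ?thesis
    using Lim_transform_eventually by fastforce
qed

text \<open>The product over the coordinates of \<open>exp(-1/(m (x\<^sub>i - a\<^sub>i)))\<close> and
  \<open>exp(-1/(m (b\<^sub>i - x\<^sub>i)))\<close> is smooth, positive exactly in the open box once \<open>m > 0\<close>, and
  increases to \<open>1\<close> there as \<open>m\<close> grows.\<close>

lemma test_functions_approx_box:
  fixes a b :: "real ^ 'n"
  assumes "cbox a b \<subseteq> \<Omega>"
  obtains \<psi> where "\<And>m::nat. \<psi> m \<in> test_functions \<Omega>" "\<And>m x. 0 \<le> \<psi> m x" "\<And>m x. \<psi> m x \<le> indicator (box a b) x"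
    "\<And>x. (\<lambda>m. \<psi> m x) \<longlonglongrightarrow> indicator (box a b) x"
proof
  define \<psi> where "\<psi> m x = (\<Prod>i\<in>UNIV. flat 1 (real m * x $ i + (- (real m * a $ i)))
      * flat 1 ((- real m) * x $ i + real m * b $ i))" for m and x :: "real ^ 'n"
  have arg: "real m * x $ i + (- (real m * a $ i)) = real m * (x $ i - a $ i)"
    "(- real m) * x $ i + real m * b $ i = real m * (b $ i - x $ i)" for m i and x :: "real ^ 'n"
    by (simp_all add: algebra_simps)
  have supp: "x \<in> box a b" if "\<psi> m x \<noteq> 0" for m x
  proof -
    have "real m * (x $ i - a $ i) > 0 \<and> real m * (b $ i - x $ i) > 0" for i
      using that unfolding \<psi>_def arg by (auto simp: flat_one_bounds)
    thus ?thesis by (auto simp: mem_box_cart zero_less_mult_iff)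
  qed
  show nn: "0 \<le> \<psi> m x" for m x
    unfolding \<psi>_def by (intro prod_nonneg mult_nonneg_nonneg ballI flat_one_bounds)
  have "\<psi> m x \<le> 1" for m x
    unfolding \<psi>_def by (intro prod_le_1 conjI mult_nonneg_nonneg mult_le_one flat_one_bounds)
  thus "\<psi> m x \<le> indicator (box a b) x" for m x
    using supp[of m x] by (cases "\<psi> m x = 0") (auto simp: indicator_def)
  show "\<psi> m \<in> test_functions \<Omega>" for m
  proof -
    have "{x. \<psi> m x \<noteq> 0} \<subseteq> cbox a b" using supp box_subset_cbox by blast
    hence sub: "closure {x. \<psi> m x \<noteq> 0} \<subseteq> cbox a b" by (intro closure_minimal) auto
    moreover have "Ck_on k (\<psi> m) UNIV" for k
      unfolding \<psi>_def by (intro Ck_on_prod Ck_on_mult smooth_step_coordinate) auto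
    moreover have "compact (closure {x. \<psi> m x \<noteq> 0})"
      using bounded_subset[OF bounded_cbox sub] by (simp add: compact_eq_bounded_closed)
    ultimately show ?thesis using assms by (auto simp: test_functions_def)
  qed
  show "(\<lambda>m. \<psi> m x) \<longlonglongrightarrow> indicator (box a b) x" for x
  proof (cases "x \<in> box a b")
    case True
    hence "(\<lambda>m. \<psi> m x) \<longlonglongrightarrow> (\<Prod>i\<in>(UNIV::'n set). 1 * 1)"
      unfolding \<psi>_def arg by (intro tendsto_intros flat_one_tendsto) (auto simp: mem_box_cart)
    thus ?thesis using True by simp
  next
    case False
    hence "\<psi> m x = 0" for m using supp by blast
    thus ?thesis using False by simp
  qed
qed

section \<open>Functions determined by their integrals over boxes\<close>

text \<open>The positive and negative parts of \<open>f\<close> are densities of two finite measures that agree on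
  boxes.  Boxes generate the Borel sets and are closed under intersection, so the measures coincide and
  hence so do their densities.\<close>

lemma AE_eq_0_if_box_integrals_eq_0_lborel:
  fixes f :: "'a::euclidean_space \<Rightarrow> real"
  assumes f: "integrable lborel f" and box: "\<And>a b. (LINT x|lborel. indicator (box a b) x * f x) = 0"
  shows "AE x in lborel. f x = 0"
proof -
  note [measurable] = borel_measurable_integrable[OF f]
  let ?P = "density lborel (\<lambda>x. ennreal (f x))" and ?N = "density lborel (\<lambda>x. ennreal (- f x))"
  have fin: "(\<integral>\<^sup>+x. ennreal (f x) * indicator A x \<partial>lborel) < \<infinity>"
      "(\<integral>\<^sup>+x. ennreal (- f x) * indicator A x \<partial>lborel) < \<infinity>" for A
  proof -
    have "(\<integral>\<^sup>+x. ennreal (f x) * indicator A x \<partial>lborel) \<le> (\<integral>\<^sup>+x. ennreal (norm (f x)) \<partial>lborel)"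
      "(\<integral>\<^sup>+x. ennreal (- f x) * indicator A x \<partial>lborel) \<le> (\<integral>\<^sup>+x. ennreal (norm (f x)) \<partial>lborel)"
      by (auto intro!: nn_integral_mono ennreal_leI simp: indicator_def)
    moreover have "(\<integral>\<^sup>+x. ennreal (norm (f x)) \<partial>lborel) < \<infinity>"
      using f by (simp add: integrable_iff_bounded)
    ultimately show "(\<integral>\<^sup>+x. ennreal (f x) * indicator A x \<partial>lborel) < \<infinity>"
      "(\<integral>\<^sup>+x. ennreal (- f x) * indicator A x \<partial>lborel) < \<infinity>" using le_less_trans by blast+
  qed
  have eq_box: "emeasure ?P (box a b) = emeasure ?N (box a b)" for a b
  proof -
    have i: "integrable lborel (\<lambda>x. indicator (box a b) x * f x)"
      using integrable_mult_indicator[OF _ f, of "box a b"] by simp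
    have "emeasure ?P (box a b) = (\<integral>\<^sup>+x. ennreal (indicator (box a b) x * f x) \<partial>lborel)"
      "emeasure ?N (box a b) = (\<integral>\<^sup>+x. ennreal (- (indicator (box a b) x * f x)) \<partial>lborel)"
      by (auto simp: emeasure_density intro!: nn_integral_cong split: split_indicator)
    moreover have "enn2real (\<integral>\<^sup>+x. ennreal (indicator (box a b) x * f x) \<partial>lborel)
       = enn2real (\<integral>\<^sup>+x. ennreal (- (indicator (box a b) x * f x)) \<partial>lborel)"
      using real_lebesgue_integral_def[OF i] box[of a b] by simp
    ultimately have eq: "enn2real (emeasure ?P (box a b)) = enn2real (emeasure ?N (box a b))"
      by simp
    have "emeasure ?P (box a b) < top" "emeasure ?N (box a b) < top"
      using fin[of "box a b"] by (simp_all add: emeasure_density)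
    note e = this[THEN ennreal_enn2real]
    show ?thesis using arg_cong[OF eq, of ennreal] unfolding e .
  qed
  have "?P = ?N"
  proof (rule measure_eqI_generator_eq)
    let ?E = "range (\<lambda>(a, b). box a b :: 'a set)"
    show "Int_stable ?E" by (auto simp: Int_stable_def box_Int_box)
    show "?E \<subseteq> Pow UNIV" "sets ?P = sigma_sets UNIV ?E" "sets ?N = sigma_sets UNIV ?E"
      by (simp_all add: borel_eq_box)
    let ?A = "\<lambda>n::nat. box (- (real n *\<^sub>R One)) (real n *\<^sub>R One) :: 'a set"
    show "range ?A \<subseteq> ?E" "(\<Union>i. ?A i) = UNIV"
      unfolding UN_box_eq_UNIV by auto
    show "emeasure ?P (?A i) \<noteq> \<infinity>" for i
      using fin(1)[of "?A i"] by (auto simp: emeasure_density)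
    show "emeasure ?P X = emeasure ?N X" if "X \<in> ?E" for X
      using that eq_box by auto
  qed
  hence "AE x in lborel. ennreal (f x) = ennreal (- f x)"
    by (subst (asm) sigma_finite_measure.density_unique_iff[OF sigma_finite_lborel]) auto
  thus ?thesis
    proof eventually_elim
    case (elim x)
    show ?case
    proof (cases "f x \<ge> 0")
      case True
      hence "ennreal (f x) = 0" using elim by (simp add: ennreal_neg)
      thus ?thesis using True by (simp add: ennreal_eq_0_iff)
    next
      case False
      hence "ennreal (- f x) = 0" using elim by (simp add: ennreal_neg)
      thus ?thesis using False by (simp add: ennreal_eq_0_iff)
    qed
  qed
qed

text \<open>Reduction to real Borel functions, by taking components and replacing each with an almost
  everywhere equal Borel function.\<close>

lemma AE_eq_0_if_box_integrals_eq_0: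
  fixes f :: "'a::euclidean_space \<Rightarrow> 'b::euclidean_space"
  assumes f: "integrable lebesgue f" and box: "\<And>a b. (LINT x|lebesgue. indicator (box a b) x *\<^sub>R f x) = 0"
  shows "AE x in lebesgue. f x = 0"
proof -
  have component: "AE x in lebesgue. f x \<bullet> e = 0" for e
  proof -
    have fe: "integrable lebesgue (\<lambda>x. f x \<bullet> e)" using f by (rule integrable_inner_left)
    obtain g where g [measurable]: "g \<in> borel_measurable lborel" and eq: "AE x in lborel. f x \<bullet> e = g x"
      using completion_ex_borel_measurable_real[OF borel_measurable_integrable[OF fe]] by blast
    have eq': "AE x in lebesgue. f x \<bullet> e = g x" using eq by (rule AE_completion)
    have m: "g \<in> borel_measurable lebesgue" using g by (rule measurable_completion)
    have "AE x in lborel. g x = 0"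
    proof (rule AE_eq_0_if_box_integrals_eq_0_lborel)
      have "integrable lebesgue g"
        using fe by (rule integrable_cong_AE_imp[OF _ m]) (use eq' in eventually_elim, simp)
      thus "integrable lborel g" using g by (simp add: integrable_completion)
      fix a b :: 'a
      have "(LINT x|lborel. indicator (box a b) x * g x) = (LINT x|lebesgue. indicator (box a b) x * g x)"
        by (rule integral_completion[symmetric]) measurable
      also have "\<dots> = (LINT x|lebesgue. (indicator (box a b) x *\<^sub>R f x) \<bullet> e)"
      proof (rule integral_cong_AE)
        have b: "box a b \<in> sets lebesgue" by simp
        show "(\<lambda>x. indicat_real (box a b) x * g x) \<in> borel_measurable lebesgue"
          "(\<lambda>x. (indicat_real (box a b) x *\<^sub>R f x) \<bullet> e) \<in> borel_measurable lebesgue"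
          using b m borel_measurable_integrable[OF f] by measurable
        show "AE x in lebesgue. indicat_real (box a b) x * g x = (indicat_real (box a b) x *\<^sub>R f x) \<bullet> e"
          using eq' by eventually_elim simp
      qed
      also have "\<dots> = (LINT x|lebesgue. indicator (box a b) x *\<^sub>R f x) \<bullet> e"
        by (intro integral_inner_left) (use integrable_mult_indicator[OF _ f] in auto)
      finally show "(LINT x|lborel. indicator (box a b) x * g x) = 0" by (simp add: box)
    qed
    from AE_completion[OF this] eq' show ?thesis by eventually_elim simp
  qed
  have "AE x in lebesgue. \<forall>e\<in>Basis. f x \<bullet> e = 0"
    using component by (intro AE_finite_allI) auto
  thus ?thesis by eventually_elim (simp add: euclidean_all_zero_iff)
qed

lemma borel_measurable_cong_AE_lebesgue_on:
  fixes f g :: "'a::euclidean_space \<Rightarrow> 'b::euclidean_space"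
  assumes S: "S \<in> sets lebesgue" and f: "f \<in> borel_measurable (lebesgue_on S)"
    and eq: "AE x in lebesgue_on S. f x = g x"
  shows "g \<in> borel_measurable (lebesgue_on S)"
proof (rule measurableI)
  fix B :: "'b set" assume "B \<in> sets borel"
  hence A: "f -` B \<inter> S \<in> sets lebesgue"
    using measurable_sets[OF f] S by (simp add: sets_restrict_space_iff)
  have "AE x in lebesgue. x \<in> S \<longrightarrow> f x = g x"
    using eq S by (simp add: AE_restrict_space_iff)
  hence "AE x in lebesgue. x \<in> f -` B \<inter> S \<longleftrightarrow> x \<in> g -` B \<inter> S"
    by eventually_elim auto
  hence "g -` B \<inter> S \<in> sets lebesgue"
    using A by (rule completion.in_sets_AE) auto
  thus "g -` B \<inter> space (lebesgue_on S) \<in> sets (lebesgue_on S)"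
    using S by (simp add: sets_restrict_space_iff)
qed simp

section \<open>Test functions\<close>

lemma test_function_differentiable:
  "\<phi> \<in> test_functions \<Omega> \<Longrightarrow> \<phi> differentiable (at x)"
  by (metis (mono_tags, lifting) Ck_on.simps(2) UNIV_I mem_Collect_eq test_functions_def)

lemma test_function_grad_continuous:
  assumes "\<phi> \<in> test_functions \<Omega>"
  shows "continuous_on UNIV (grad \<phi>)"
proof -
  have "Ck_on (Suc 0) \<phi> UNIV" using assms by (simp add: test_functions_def del: Ck_on.simps)
  hence "continuous_on UNIV (\<lambda>x. \<chi> i. grad \<phi> x $ i)"
    by (intro continuous_on_vec_lambda) simp
  thus ?thesis by simp
qed

lemma test_function_continuous:
  assumes "\<phi> \<in> test_functions \<Omega>"
  shows "continuous_on UNIV \<phi>"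
  using test_function_differentiable[OF assms]
  by (intro continuous_at_imp_continuous_on ballI) (simp add: differentiable_imp_continuous_within)

lemma grad_eq_0_outside_support:
  assumes "x \<notin> closure {x. \<phi> x \<noteq> 0}"
  shows "grad \<phi> x = 0"
proof (rule has_derivative_grad_unique)
  have "((\<lambda>_. 0) has_derivative (\<lambda>v. 0 \<bullet> v)) (at x)" by simp
  thus "(\<phi> has_derivative (\<lambda>v. 0 \<bullet> v)) (at x)"
    by (rule has_derivative_transform_within_open[of _ _ _ _ "- closure {x. \<phi> x \<noteq> 0}"])
      (use assms closure_subset[of "{x. \<phi> x \<noteq> 0}"] in auto)
qed

lemma test_function_support:
  assumes "\<phi> \<in> test_functions \<Omega>"
  obtains K where "compact K" "K \<subseteq> \<Omega>" "\<And>x. x \<notin> K \<Longrightarrow> \<phi> x = 0" "\<And>x. x \<notin> K \<Longrightarrow> grad \<phi> x = 0"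
proof
  let ?K = "closure {x. \<phi> x \<noteq> 0}"
  show "compact ?K" "?K \<subseteq> \<Omega>" using assms by (auto simp: test_functions_def)
  show "\<phi> x = 0" if "x \<notin> ?K" for x using that closure_subset[of "{x. \<phi> x \<noteq> 0}"] by auto
  show "grad \<phi> x = 0" if "x \<notin> ?K" for x using that by (rule grad_eq_0_outside_support)
qed

lemma continuous_compact_support_bounded:
  fixes f :: "'a::topological_space \<Rightarrow> 'b::real_normed_vector"
  assumes "continuous_on UNIV f" "compact K" "\<And>x. x \<notin> K \<Longrightarrow> f x = 0"
  obtains C where "C \<ge> 0" "\<And>x. norm (f x) \<le> C"
proof -
  have "bounded (f ` K)"
    using compact_continuous_image[OF continuous_on_subset[OF assms(1)] assms(2)] by (auto intro: compact_imp_bounded)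
  then obtain C where C: "C > 0" "\<And>x. x \<in> K \<Longrightarrow> norm (f x) \<le> C"
    by (metis bounded_pos imageI)
  show thesis
  proof (rule that[of C])
    show "norm (f x) \<le> C" for x using C assms(3)[of x] by (cases "x \<in> K") auto
  qed (use C in auto)
qed

lemma integrable_continuous_compact_support:
  fixes f :: "'a::euclidean_space \<Rightarrow> 'b::euclidean_space"
  assumes "continuous_on UNIV f" "compact K" "\<And>x. x \<notin> K \<Longrightarrow> f x = 0"
  shows "integrable lborel f"
proof -
  have "integrable lborel (\<lambda>x. indicator K x *\<^sub>R f x)"
    by (rule borel_integrable_compact[OF assms(2) continuous_on_subset[OF assms(1)]]) simp
  moreover have "(\<lambda>x. indicator K x *\<^sub>R f x) = f"
    using assms(3) by (auto simp: indicator_def fun_eq_iff)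
  ultimately show ?thesis by simp
qed

lemma integral_translate:
  fixes f :: "'a::euclidean_space \<Rightarrow> 'b::euclidean_space"
  assumes "f \<in> borel_measurable borel"
  shows "(LINT x|lborel. f (x + h)) = (LINT x|lborel. f x)"
proof -
  have "(LINT x|lborel. f x) = (LINT x|distr lborel borel ((+) h). f x)"
    by (simp only: lborel_distr_plus)
  also have "\<dots> = (LINT x|lborel. f (h + x))"
    using assms by (subst integral_distr) auto
  finally show ?thesis by (simp add: add.commute)
qed

text \<open>The integral of a difference quotient \<open>k (f(x + e/k) - f(x))\<close> vanishes by translation
  invariance.  The quotients are dominated, since \<open>f\<close> is Lipschitz with compact support, and they converge
  to the directional derivative.\<close>

lemma integral_grad_eq_0:
  fixes f :: "real ^ 'n \<Rightarrow> real"
  assumes diff: "\<And>x. f differentiable (at x)" and cont: "continuous_on UNIV (grad f)"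
    and K: "compact K" "\<And>x. x \<notin> K \<Longrightarrow> f x = 0" "\<And>x. x \<notin> K \<Longrightarrow> grad f x = 0"
  shows "(LINT x|lborel. grad f x) = 0"
proof -
  have cf: "continuous_on UNIV f"
    using diff by (intro continuous_at_imp_continuous_on ballI) (simp add: differentiable_imp_continuous_within)
  note int = integrable_continuous_compact_support[OF cf K(1,2)]
    integrable_continuous_compact_support[OF cont K(1,3)]
  have [measurable]: "f \<in> borel_measurable borel" "grad f \<in> borel_measurable borel"
    using borel_measurable_continuous_onI[OF cf] borel_measurable_continuous_onI[OF cont] by auto
  obtain C where C: "C \<ge> 0" "\<And>x. norm (grad f x) \<le> C"
    using continuous_compact_support_bounded[OF cont K(1,3)] by blast
  have lip: "\<bar>f y - f x\<bar> \<le> C * norm (y - x)" for x y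
  proof -
    have "norm (f y - f x) \<le> C * norm (y - x)"
    proof (rule differentiable_bound[of UNIV f "\<lambda>x v. grad f x \<bullet> v"])
      show "(f has_derivative (\<lambda>v. grad f x \<bullet> v)) (at x within UNIV)" for x
        using has_derivative_grad[OF diff] by simp
      show "onorm (\<lambda>v. grad f x \<bullet> v) \<le> C" for x
        using C by (intro onorm_le) (metis Cauchy_Schwarz_ineq2 mult_right_mono norm_ge_zero order.trans real_norm_def)
    qed auto
    thus ?thesis by simp
  qed
  have "(LINT x|lborel. grad f x \<bullet> e) = 0" for e
  proof -
    define D where "D k x = real (Suc k) * (f (x + (1 / real (Suc k)) *\<^sub>R e) - f x)" for k x
    obtain R where R: "R > 0" "\<And>x. x \<in> K \<Longrightarrow> norm x \<le> R"
      using compact_imp_bounded[OF K(1)] by (auto simp: bounded_pos)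
    let ?w = "\<lambda>x::real^'n. C * norm e * indicator (cball 0 (R + norm e)) x"
    have "(\<lambda>k. LINT x|lborel. D k x) \<longlonglongrightarrow> (LINT x|lborel. grad f x \<bullet> e)"
    proof (rule integral_dominated_convergence[where w = ?w])
      show "(\<lambda>x. grad f x \<bullet> e) \<in> borel_measurable lborel" by simp
      show "D k \<in> borel_measurable lborel" for k unfolding D_def by measurable
      show "integrable lborel ?w"
        using emeasure_bounded_finite[OF bounded_cball, of "0::real^'n" "R + norm e"]
        by (intro integrable_mult_right integrable_real_indicator) auto
      show "AE x in lborel. (\<lambda>k. D k x) \<longlonglongrightarrow> grad f x \<bullet> e"
      proof (rule AE_I2)
        fix x
        have "((\<lambda>s. x + s *\<^sub>R e) has_derivative (\<lambda>s. s *\<^sub>R e)) (at 0)"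
          by (auto intro!: derivative_eq_intros)
        moreover have "(f has_derivative (\<lambda>v. grad f x \<bullet> v)) (at (x + 0 *\<^sub>R e))"
          using has_derivative_grad[OF diff] by simp
        ultimately have "((\<lambda>s. f (x + s *\<^sub>R e)) has_derivative (\<lambda>s. grad f x \<bullet> (s *\<^sub>R e))) (at 0)"
          by (rule has_derivative_compose)
        hence "((\<lambda>s. f (x + s *\<^sub>R e)) has_real_derivative (grad f x \<bullet> e)) (at 0)"
          by (simp add: has_field_derivative_def mult.commute[of _ "grad f x \<bullet> e"])
        hence "((\<lambda>h. (f (x + h *\<^sub>R e) - f x) / h) \<longlongrightarrow> grad f x \<bullet> e) (at 0)"
          by (simp add: DERIV_def)
        moreover have "filterlim (\<lambda>k. 1 / real (Suc k)) (at 0) sequentially"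
          using LIMSEQ_inverse_real_of_nat by (auto simp: filterlim_at inverse_eq_divide)
        ultimately have "(\<lambda>k. (f (x + (1 / real (Suc k)) *\<^sub>R e) - f x) / (1 / real (Suc k))) \<longlonglongrightarrow> grad f x \<bullet> e"
          by (rule filterlim_compose)
        thus "(\<lambda>k. D k x) \<longlonglongrightarrow> grad f x \<bullet> e"
          by (simp add: D_def mult.commute)
      qed
      show "AE x in lborel. norm (D k x) \<le> ?w x" for k
      proof (rule AE_I2)
        fix x
        show "norm (D k x) \<le> ?w x"
        proof (cases "x \<in> cball 0 (R + norm e)")
          case True
          have "norm (D k x) \<le> real (Suc k) * (C * norm ((1 / real (Suc k)) *\<^sub>R e))"
            unfolding D_def using lip[of "x + (1 / real (Suc k)) *\<^sub>R e" x]
            by (simp only: real_norm_def abs_mult abs_of_nat) (intro mult_left_mono, simp_all)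
          also have "\<dots> = C * norm e" by simp
          finally show ?thesis using True by simp
        next
          case False
          have "norm ((1 / real (Suc k)) *\<^sub>R e) \<le> norm e" by (simp add: divide_le_eq mult_le_cancel_left1)
          moreover have "norm x > R + norm e" using False by simp
          ultimately have "norm (x + (1 / real (Suc k)) *\<^sub>R e) > R" "norm x > R"
            using norm_diff_ineq[of x "(1 / real (Suc k)) *\<^sub>R e"] norm_ge_zero[of e] by linarith+
          hence "f (x + (1 / real (Suc k)) *\<^sub>R e) = 0" "f x = 0"
            using R(2) by (meson K(2) linorder_not_le)+
          thus ?thesis using C(1) by (simp add: D_def)
        qed
      qed
    qed
    moreover have "(LINT x|lborel. D k x) = 0" for k
    proof -
      have i: "integrable lborel (\<lambda>x. f (x + h))" for h
        using integrable_distr[of "(+) h" lborel borel f] int(1) lborel_distr_plus[of h]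
        by (simp add: add.commute)
      show ?thesis unfolding D_def
        using int(1) i integral_translate[of f] by simp
    qed
    ultimately show ?thesis by (simp add: LIMSEQ_const_iff)
  qed
  moreover have "(LINT x|lborel. grad f x \<bullet> e) = (LINT x|lborel. grad f x) \<bullet> e" for e
    using int(2) by (intro integral_inner_left) auto
  ultimately have "(LINT x|lborel. grad f x) \<bullet> (LINT x|lborel. grad f x) = 0" by metis
  thus ?thesis by simp
qed

lemma test_function_linear_combination:
  assumes "\<phi> \<in> test_functions \<Omega>" "\<psi> \<in> test_functions \<Omega>"
  shows "(\<lambda>x. a * \<phi> x + b * \<psi> x) \<in> test_functions \<Omega>"
    and "grad (\<lambda>x. a * \<phi> x + b * \<psi> x) x = a *\<^sub>R grad \<phi> x + b *\<^sub>R grad \<psi> x"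
proof -
  let ?f = "\<lambda>x. a * \<phi> x + b * \<psi> x"
  have "Ck_on k ?f UNIV" for k
    using assms by (intro Ck_on_add Ck_on_mult Ck_on_const) (auto simp: test_functions_def)
  moreover have sub: "closure {x. ?f x \<noteq> 0} \<subseteq> closure {x. \<phi> x \<noteq> 0} \<union> closure {x. \<psi> x \<noteq> 0}"
    unfolding closure_Un[symmetric] by (intro closure_mono) auto
  moreover have "compact (closure {x. ?f x \<noteq> 0})"
  proof -
    have "compact (closure {x. \<phi> x \<noteq> 0} \<union> closure {x. \<psi> x \<noteq> 0})"
      using assms by (intro compact_Un) (simp_all add: test_functions_def)
    from bounded_subset[OF compact_imp_bounded[OF this] sub] show ?thesis
      unfolding compact_eq_bounded_closed by (intro conjI closed_closure)
  qed
  ultimately show "?f \<in> test_functions \<Omega>"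
    using assms unfolding test_functions_def by blast
  have "(?f has_derivative (\<lambda>v. a * (grad \<phi> x \<bullet> v) + b * (grad \<psi> x \<bullet> v))) (at x)"
    by (intro has_derivative_add has_derivative_mult_right has_derivative_grad test_function_differentiable[OF assms(1)]
      test_function_differentiable[OF assms(2)])
  thus "grad ?f x = a *\<^sub>R grad \<phi> x + b *\<^sub>R grad \<psi> x"
    by (intro has_derivative_grad_unique) (simp add: inner_add_left)
qed

section \<open>Weak gradients and Sobolev functions with zero boundary values\<close>

context bounded_open_domain
begin

lemma integral_M_eq_lborel:
  fixes f :: "real ^ 'n \<Rightarrow> 'b::euclidean_space"
  assumes "f \<in> borel_measurable borel" "\<And>x. x \<notin> \<Omega> \<Longrightarrow> f x = 0"
  shows "(LINT x|M. f x) = (LINT x|lborel. f x)"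
proof -
  have "(LINT x|M. f x) = (LINT x|lebesgue. indicator \<Omega> x *\<^sub>R f x)"
    by (rule integral_restrict_space) simp
  also have "(\<lambda>x. indicator \<Omega> x *\<^sub>R f x) = f"
    using assms(2) by (auto simp: indicator_def fun_eq_iff)
  also have "(LINT x|lebesgue. f x) = (LINT x|lborel. f x)"
    using assms(1) by (intro integral_completion) simp
  finally show ?thesis .
qed

lemma borel_measurable_M: "f \<in> borel_measurable borel \<Longrightarrow> f \<in> borel_measurable M"
  by (intro measurable_restrict_space1 measurable_completion) simp

lemma test_function_bounded:
  assumes "\<phi> \<in> test_functions \<Omega>"
  obtains C where "C \<ge> 0" "\<And>x. norm (\<phi> x) \<le> C" "\<And>x. norm (grad \<phi> x) \<le> C"
proof -
  obtain K where K: "compact K" "\<And>x. x \<notin> K \<Longrightarrow> \<phi> x = 0" "\<And>x. x \<notin> K \<Longrightarrow> grad \<phi> x = 0"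
    using test_function_support[OF assms] by metis
  obtain C1 where C1: "C1 \<ge> 0" "\<And>x. norm (\<phi> x) \<le> C1"
    using continuous_compact_support_bounded[OF test_function_continuous[OF assms] K(1,2)] by metis
  obtain C2 where C2: "C2 \<ge> 0" "\<And>x. norm (grad \<phi> x) \<le> C2"
    using continuous_compact_support_bounded[OF test_function_grad_continuous[OF assms] K(1,3)] by metis
  show thesis
    by (rule that[of "max C1 C2"]) (use C1 C2 in \<open>simp_all add: le_max_iff_disj\<close>)
qed

lemma test_function_measurable:
  assumes "\<phi> \<in> test_functions \<Omega>"
  shows "\<phi> \<in> borel_measurable borel" "grad \<phi> \<in> borel_measurable borel"
  using test_function_continuous[OF assms] test_function_grad_continuous[OF assms]
  by (auto intro: borel_measurable_continuous_onI)

lemma Lp_bounded: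
  assumes "f \<in> borel_measurable M" "\<And>x. norm (f x) \<le> C"
  shows "f \<in> Lp p \<Omega>"
proof (rule LpI_bound[OF assms(1) integrable_const_M])
  show "norm (f x) powr p \<le> C powr p" if "x \<in> \<Omega>" for x
    by (rule powr_mono2[OF _ _ assms(2)]) (use p in auto)
qed

lemma test_function_Lp:
  assumes "\<phi> \<in> test_functions \<Omega>"
  shows "\<phi> \<in> Lp p \<Omega>" "grad \<phi> \<in> Lp p \<Omega>"
proof -
  obtain C where "\<And>x. norm (\<phi> x) \<le> C" "\<And>x. norm (grad \<phi> x) \<le> C"
    using test_function_bounded[OF assms] by metis
  thus "\<phi> \<in> Lp p \<Omega>" "grad \<phi> \<in> Lp p \<Omega>"
    by (auto intro!: Lp_bounded borel_measurable_M test_function_measurable[OF assms])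
qed

text \<open>The bound gives integrability of products of an integrable function with a test function or its
  gradient.\<close>

lemma integrable_norm_le:
  fixes f :: "real ^ 'n \<Rightarrow> 'b::euclidean_space" and h :: "real ^ 'n \<Rightarrow> 'c::euclidean_space"
  assumes "integrable M f" "h \<in> borel_measurable M" "\<And>x. norm (h x) \<le> C * norm (f x)"
  shows "integrable M h"
proof (rule Bochner_Integration.integrable_bound)
  show "integrable M (\<lambda>x. C * norm (f x))" using assms(1) by simp
  show "AE x in M. norm (h x) \<le> norm (C * norm (f x))"
    using order.trans[OF assms(3) abs_ge_self] by (intro AE_I2) simp
qed (rule assms(2))

lemma integrable_scaleR_bounded:
  fixes f :: "real ^ 'n \<Rightarrow> 'b::euclidean_space" and g :: "real ^ 'n \<Rightarrow> real"
  assumes "integrable M f" "g \<in> borel_measurable M" "\<And>x. norm (g x) \<le> C"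
  shows "integrable M (\<lambda>x. g x *\<^sub>R f x)"
  using assms(1,2) mult_right_mono[OF assms(3) norm_ge_zero]
  by (intro integrable_norm_le[OF assms(1), of _ C]) auto

lemma integrable_scaleR_bounded':
  fixes f :: "real ^ 'n \<Rightarrow> real" and g :: "real ^ 'n \<Rightarrow> 'b::euclidean_space"
  assumes "integrable M f" "g \<in> borel_measurable M" "\<And>x. norm (g x) \<le> C"
  shows "integrable M (\<lambda>x. f x *\<^sub>R g x)"
  using assms(1,2) mult_right_mono[OF assms(3) norm_ge_zero[of "f _"]]
  by (intro integrable_norm_le[OF assms(1), of _ C]) (auto simp: mult.commute[of "\<bar>f _\<bar>"])

lemma test_function_integration_by_parts:
  assumes "\<phi> \<in> test_functions \<Omega>" "\<psi> \<in> test_functions \<Omega>"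
  shows "(LINT x|M. \<phi> x *\<^sub>R grad \<psi> x) = - (LINT x|M. \<psi> x *\<^sub>R grad \<phi> x)"
proof -
  obtain K where K: "compact K" "K \<subseteq> \<Omega>" "\<And>x. x \<notin> K \<Longrightarrow> \<phi> x = 0" "\<And>x. x \<notin> K \<Longrightarrow> grad \<phi> x = 0"
    using test_function_support[OF assms(1)] by metis
  let ?f = "\<lambda>x. \<phi> x * \<psi> x"
  have d: "(?f has_derivative (\<lambda>v. (\<phi> x *\<^sub>R grad \<psi> x + \<psi> x *\<^sub>R grad \<phi> x) \<bullet> v)) (at x)" for x
    using has_derivative_mult[OF has_derivative_grad[OF test_function_differentiable[OF assms(1)], of x]
        has_derivative_grad[OF test_function_differentiable[OF assms(2)], of x]]
    by (simp add: inner_add_left mult.commute)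
  have g: "grad ?f = (\<lambda>x. \<phi> x *\<^sub>R grad \<psi> x + \<psi> x *\<^sub>R grad \<phi> x)"
    by (rule ext) (rule has_derivative_grad_unique[OF d])
  have cont: "continuous_on UNIV (grad ?f)"
    unfolding g using assms by (intro continuous_intros test_function_continuous test_function_grad_continuous)
  have "(LINT x|M. grad ?f x) = (LINT x|lborel. grad ?f x)"
  proof (rule integral_M_eq_lborel)
    show "grad ?f \<in> borel_measurable borel" using cont by (rule borel_measurable_continuous_onI)
    show "grad ?f x = 0" if "x \<notin> \<Omega>" for x
    proof -
      have "x \<notin> K" using that K(2) by blast
      thus ?thesis using K(3,4) by (simp add: g)
    qed
  qed
  also have "\<dots> = 0"
    using d cont K by (intro integral_grad_eq_0[of _ K]) (auto simp: g intro: differentiableI)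
  finally have "(LINT x|M. \<phi> x *\<^sub>R grad \<psi> x + \<psi> x *\<^sub>R grad \<phi> x) = 0" by (simp add: g)
  moreover have "integrable M (\<lambda>x. \<phi> x *\<^sub>R grad \<psi> x)" "integrable M (\<lambda>x. \<psi> x *\<^sub>R grad \<phi> x)"
  proof -
    obtain C where C: "\<And>x. norm (\<phi> x) \<le> C" using test_function_bounded[OF assms(1)] by metis
    obtain C' where C': "\<And>x. norm (\<psi> x) \<le> C'" using test_function_bounded[OF assms(2)] by metis
    show "integrable M (\<lambda>x. \<phi> x *\<^sub>R grad \<psi> x)" "integrable M (\<lambda>x. \<psi> x *\<^sub>R grad \<phi> x)"
      by (rule integrable_scaleR_bounded[OF _ _ C] integrable_scaleR_bounded[OF _ _ C'];
        intro Lp_imp_integrable test_function_Lp borel_measurable_M test_function_measurable assms)+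
  qed
  ultimately show ?thesis by (simp add: eq_neg_iff_add_eq_0)
qed

lemma Lp_absolutely_integrable_on:
  assumes "f \<in> Lp p \<Omega>" "compact K" "K \<subseteq> \<Omega>"
  shows "f absolutely_integrable_on K"
proof -
  have "set_integrable lebesgue \<Omega> f"
    using Lp_imp_integrable[OF assms(1)] by (simp add: set_integrable_def integrable_restrict_space)
  thus ?thesis
    by (rule set_integrable_subset) (use assms in \<open>auto intro: lmeasurable_compact fmeasurableD\<close>)
qed

lemma integral_tendsto_of_modular:
  fixes f :: "nat \<Rightarrow> real ^ 'n \<Rightarrow> 'b::euclidean_space" and G :: "real ^ 'n \<Rightarrow> 'c::euclidean_space"
  assumes f: "\<And>k. f k \<in> Lp p \<Omega>" and lim: "(\<lambda>k. modular (f k)) \<longlonglongrightarrow> 0"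
    and int: "\<And>k. integrable M (H k)" "integrable M G"
    and le: "\<And>k x. norm (G x - H k x) \<le> C * norm (f k x)"
  shows "(\<lambda>k. LINT x|M. H k x) \<longlonglongrightarrow> (LINT x|M. G x)"
proof -
  have "(\<lambda>k. (LINT x|M. G x) - (LINT x|M. H k x)) \<longlonglongrightarrow> 0"
  proof (rule Lim_null_comparison)
    show "(\<lambda>k. C * (LINT x|M. norm (f k x))) \<longlonglongrightarrow> 0"
      by (rule tendsto_mult_right_zero[OF L1_tendsto_zero[OF f lim]])
    show "\<forall>\<^sub>F k in sequentially. norm ((LINT x|M. G x) - (LINT x|M. H k x)) \<le> C * (LINT x|M. norm (f k x))"
    proof (rule always_eventually, rule allI)
      fix k
      have "norm ((LINT x|M. G x) - (LINT x|M. H k x)) = norm (LINT x|M. G x - H k x)"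
        using int by simp
      also have "\<dots> \<le> (LINT x|M. norm (G x - H k x))" by (rule integral_norm_bound)
      also have "\<dots> \<le> (LINT x|M. C * norm (f k x))"
        using le int Lp_imp_integrable[OF f[of k]] by (intro integral_mono) auto
      also have "\<dots> = C * (LINT x|M. norm (f k x))" by simp
      finally show "norm ((LINT x|M. G x) - (LINT x|M. H k x)) \<le> C * (LINT x|M. norm (f k x))" .
    qed
  qed
  hence "(\<lambda>k. (LINT x|M. G x) - ((LINT x|M. G x) - (LINT x|M. H k x))) \<longlonglongrightarrow> (LINT x|M. G x) - 0"
    by (intro tendsto_intros)
  thus ?thesis by simp
qed

text \<open>The closure of the pairs \<open>(\<phi>, \<nabla>\<phi>)\<close> of test functions and their gradients in \<open>L\<^sup>p \<times> L\<^sup>p\<close>.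
  Its elements are exactly the functions of \<open>W\<^sub>0\<^sup>1\<^sup>,\<^sup>p(\<Omega>)\<close> paired with a weak gradient, but linearity and
  closedness are visible without reference to a chosen representative of the gradient.\<close>

definition W0_pair :: "(real ^ 'n \<Rightarrow> real) \<Rightarrow> (real ^ 'n \<Rightarrow> real ^ 'n) \<Rightarrow> bool" where
  "W0_pair u g \<longleftrightarrow> u \<in> Lp p \<Omega> \<and> g \<in> Lp p \<Omega> \<and>
    (\<exists>\<phi>. (\<forall>k::nat. \<phi> k \<in> test_functions \<Omega>) \<and> (\<lambda>k. modular (\<lambda>x. u x - \<phi> k x)) \<longlonglongrightarrow> 0 \<and>
      (\<lambda>k. modular (\<lambda>x. g x - grad (\<phi> k) x)) \<longlonglongrightarrow> 0)"

lemma W0_pair_Lp: "W0_pair u g \<Longrightarrow> u \<in> Lp p \<Omega>" "W0_pair u g \<Longrightarrow> g \<in> Lp p \<Omega>"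
  by (simp_all add: W0_pair_def)

lemma W0_pair_has_weak_gradient:
  assumes "W0_pair u g"
  shows "has_weak_gradient u g \<Omega>"
  unfolding has_weak_gradient_def
proof (intro conjI allI impI ballI)
  note uL = W0_pair_Lp[OF assms]
  show "u absolutely_integrable_on K" "g absolutely_integrable_on K" if "compact K \<and> K \<subseteq> \<Omega>" for K
    using that by (auto intro: Lp_absolutely_integrable_on uL)
  obtain \<phi> where \<phi>: "\<And>k::nat. \<phi> k \<in> test_functions \<Omega>" "(\<lambda>k. modular (\<lambda>x. u x - \<phi> k x)) \<longlonglongrightarrow> 0"
      "(\<lambda>k. modular (\<lambda>x. g x - grad (\<phi> k) x)) \<longlonglongrightarrow> 0"
    using assms by (auto simp: W0_pair_def)
  fix \<psi> assume \<psi>: "\<psi> \<in> test_functions \<Omega>"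
  obtain C where C: "\<And>x. norm (\<psi> x) \<le> C" "\<And>x. norm (grad \<psi> x) \<le> C"
    using test_function_bounded[OF \<psi>] by metis
  note m = test_function_measurable[OF \<psi>, THEN borel_measurable_M]
  have 1: "(\<lambda>k. LINT x|M. \<phi> k x *\<^sub>R grad \<psi> x) \<longlonglongrightarrow> (LINT x|M. u x *\<^sub>R grad \<psi> x)"
  proof (rule integral_tendsto_of_modular[OF _ \<phi>(2)])
    show "(\<lambda>x. u x - \<phi> k x) \<in> Lp p \<Omega>" for k by (intro Lp_diff uL test_function_Lp \<phi>)
    show "integrable M (\<lambda>x. \<phi> k x *\<^sub>R grad \<psi> x)" "integrable M (\<lambda>x. u x *\<^sub>R grad \<psi> x)" for k
      by (rule integrable_scaleR_bounded'[OF _ m(2) C(2)]; intro Lp_imp_integrable uL test_function_Lp \<phi>)+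
    show "norm (u x *\<^sub>R grad \<psi> x - \<phi> k x *\<^sub>R grad \<psi> x) \<le> C * norm (u x - \<phi> k x)" for k x
      using mult_right_mono[OF C(2)[of x] norm_ge_zero[of "u x - \<phi> k x"]]
      by (simp add: scaleR_diff_left[symmetric] mult.commute)
  qed
  have 2: "(\<lambda>k. LINT x|M. \<psi> x *\<^sub>R grad (\<phi> k) x) \<longlonglongrightarrow> (LINT x|M. \<psi> x *\<^sub>R g x)"
  proof (rule integral_tendsto_of_modular[OF _ \<phi>(3)])
    show "(\<lambda>x. g x - grad (\<phi> k) x) \<in> Lp p \<Omega>" for k by (intro Lp_diff uL test_function_Lp \<phi>)
    show "integrable M (\<lambda>x. \<psi> x *\<^sub>R grad (\<phi> k) x)" "integrable M (\<lambda>x. \<psi> x *\<^sub>R g x)" for k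
      by (rule integrable_scaleR_bounded[OF _ m(1) C(1)]; intro Lp_imp_integrable uL test_function_Lp \<phi>)+
    show "norm (\<psi> x *\<^sub>R g x - \<psi> x *\<^sub>R grad (\<phi> k) x) \<le> C * norm (g x - grad (\<phi> k) x)" for k x
      using mult_right_mono[OF C(1)[of x] norm_ge_zero[of "g x - grad (\<phi> k) x"]]
      by (simp add: scaleR_diff_right[symmetric])
  qed
  have "(\<lambda>k. LINT x|M. \<phi> k x *\<^sub>R grad \<psi> x) \<longlonglongrightarrow> - (LINT x|M. \<psi> x *\<^sub>R g x)"
    using tendsto_minus[OF 2] by (simp add: test_function_integration_by_parts[OF \<phi>(1) \<psi>])
  from LIMSEQ_unique[OF 1 this]
  show "(LINT x|M. u x *\<^sub>R grad \<psi> x) = - (LINT x|M. \<psi> x *\<^sub>R g x)" .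
qed

text \<open>The difference \<open>d\<close> of two weak gradients is orthogonal to all test functions.  On a closed box inside
  \<open>\<Omega>\<close> it is integrable, and approximating indicators of smaller open boxes by test functions shows that its
  integrals over boxes vanish.  Countably many closed boxes exhaust \<open>\<Omega>\<close>.\<close>

lemma weak_gradient_unique:
  assumes "has_weak_gradient u g \<Omega>" "has_weak_gradient u g' \<Omega>"
  shows "AE x in M. g x = g' x"
proof -
  obtain \<D> where \<D>: "countable \<D>" "\<D> \<subseteq> Pow \<Omega>" "\<And>X. X \<in> \<D> \<Longrightarrow> \<exists>a b. X = cbox a b" "\<Union>\<D> = \<Omega>"
    using open_countable_Union_open_cbox[OF domain_open] by metis
  have "AE x in lebesgue. x \<in> cbox a b \<longrightarrow> g x = g' x" if sub: "cbox a b \<subseteq> \<Omega>" for a b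
  proof -
    define d where "d x = g x - g' x" for x
    have "d absolutely_integrable_on cbox a b"
      unfolding d_def using assms sub by (intro set_integral_diff) (auto simp: has_weak_gradient_def)
    hence d: "integrable lebesgue (\<lambda>x. indicator (cbox a b) x *\<^sub>R d x)"
      by (simp add: set_integrable_def)
    have gi: "integrable M (\<lambda>x. indicator (cbox a b) x *\<^sub>R h x)" if "has_weak_gradient u h \<Omega>" for h
    proof -
      have "h absolutely_integrable_on cbox a b" using that sub by (auto simp: has_weak_gradient_def)
      moreover have "(\<lambda>x. indicat_real \<Omega> x *\<^sub>R indicat_real (cbox a b) x *\<^sub>R h x) = (\<lambda>x. indicat_real (cbox a b) x *\<^sub>R h x)"
        using sub by (auto simp: indicator_def fun_eq_iff)
      ultimately show ?thesis by (simp add: integrable_restrict_space set_integrable_def)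
    qed
    \<comment> \<open>The outer indicator reduces integrals of \<open>?f\<close> over arbitrary boxes to boxes inside \<open>cbox a b\<close>.\<close>
    let ?f = "\<lambda>x. indicator (box a b) x *\<^sub>R (indicator (cbox a b) x *\<^sub>R d x)"
    have "AE x in lebesgue. ?f x = 0"
    proof (rule AE_eq_0_if_box_integrals_eq_0)
      show "integrable lebesgue ?f" by (rule integrable_mult_indicator[OF _ d]) simp
      fix r s :: "real ^ 'n"
      obtain r' s' where rs: "box r s \<inter> box a b = box r' s'" using box_Int_box[of r s a b] by blast
      have eq: "indicator (box r s) x *\<^sub>R ?f x = indicator (box r' s') x *\<^sub>R (indicator (cbox a b) x *\<^sub>R d x)" for x
        unfolding rs[symmetric] by (simp add: indicator_def)
      show "(LINT x|lebesgue. indicator (box r s) x *\<^sub>R ?f x) = 0"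
      proof (cases "box r' s' = {}")
        case True
        thus ?thesis unfolding eq by simp
      next
        case False
        have "cbox r' s' = closure (box r' s')" using closure_box[OF False] by simp
        also have "\<dots> \<subseteq> cbox a b" using rs box_subset_cbox by (intro closure_minimal) blast+
        finally have sub': "cbox r' s' \<subseteq> cbox a b" .
        hence "cbox r' s' \<subseteq> \<Omega>" using sub by blast
        then obtain \<psi> where \<psi>: "\<And>m::nat. \<psi> m \<in> test_functions \<Omega>" "\<And>m x. 0 \<le> \<psi> m x"
          "\<And>m x. \<psi> m x \<le> indicator (box r' s') x" "\<And>x. (\<lambda>m. \<psi> m x) \<longlonglongrightarrow> indicator (box r' s') x"
          using test_functions_approx_box by metis
        have 01: "norm (\<psi> m x) \<le> 1" for m x
          using \<psi>(2)[of m x] order.trans[OF \<psi>(3) indicator_le_1] by simp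
        have supp: "\<psi> m x *\<^sub>R h x = \<psi> m x *\<^sub>R (indicator (cbox a b) x *\<^sub>R h x)" for m x and h :: "real ^ 'n \<Rightarrow> real ^ 'n"
        proof (cases "x \<in> box r' s'")
          case True
          hence "x \<in> cbox a b" using sub' box_subset_cbox[of r' s'] by blast
          thus ?thesis by simp
        next
          case False
          hence "\<psi> m x = 0" using \<psi>(2)[of m x] \<psi>(3)[of m x] by simp
          thus ?thesis by simp
        qed
        have int: "integrable M (\<lambda>x. \<psi> m x *\<^sub>R h x)" if "has_weak_gradient u h \<Omega>" for m h
          unfolding supp[of m _ h] 
          by (rule integrable_scaleR_bounded[OF gi[OF that] _ 01]) (intro borel_measurable_M test_function_measurable \<psi>)
        have zero: "(LINT x|M. \<psi> m x *\<^sub>R (indicator (cbox a b) x *\<^sub>R d x)) = 0" for m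
        proof -
          have "(LINT x|M. \<psi> m x *\<^sub>R (indicator (cbox a b) x *\<^sub>R d x)) = (LINT x|M. \<psi> m x *\<^sub>R g x - \<psi> m x *\<^sub>R g' x)"
            by (simp only: supp[symmetric]) (simp add: d_def scaleR_diff_right)
          also have "\<dots> = (LINT x|M. \<psi> m x *\<^sub>R g x) - (LINT x|M. \<psi> m x *\<^sub>R g' x)"
            using int assms by simp
          also have "\<dots> = 0"
          proof -
            have "(LINT x|M. u x *\<^sub>R grad (\<psi> m) x) = - (LINT x|M. \<psi> m x *\<^sub>R g x)"
              using assms(1) \<psi>(1)[of m] unfolding has_weak_gradient_def by blast
            moreover have "(LINT x|M. u x *\<^sub>R grad (\<psi> m) x) = - (LINT x|M. \<psi> m x *\<^sub>R g' x)"
              using assms(2) \<psi>(1)[of m] unfolding has_weak_gradient_def by blast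
            ultimately show ?thesis by simp
          qed
          finally show ?thesis .
        qed
        have dM: "integrable M (\<lambda>x. indicator (cbox a b) x *\<^sub>R d x)"
          using Bochner_Integration.integrable_diff[OF gi[OF assms(1)] gi[OF assms(2)]]
          by (simp add: d_def scaleR_diff_right)
        have "(\<lambda>m. LINT x|M. \<psi> m x *\<^sub>R (indicator (cbox a b) x *\<^sub>R d x))
          \<longlonglongrightarrow> (LINT x|M. indicator (box r' s') x *\<^sub>R (indicator (cbox a b) x *\<^sub>R d x))"
        proof (rule integral_dominated_convergence)
          show "integrable M (\<lambda>x. norm (indicator (cbox a b) x *\<^sub>R d x))" using dM by (rule integrable_norm)
          note dm = borel_measurable_integrable[OF dM]
          have "(indicator (box r' s') :: _ \<Rightarrow> real) \<in> borel_measurable M"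
            by (intro borel_measurable_M) simp
          thus "(\<lambda>x. indicat_real (box r' s') x *\<^sub>R indicat_real (cbox a b) x *\<^sub>R d x) \<in> borel_measurable M"
            using dm by (rule borel_measurable_scaleR)
          show "(\<lambda>x. \<psi> m x *\<^sub>R indicat_real (cbox a b) x *\<^sub>R d x) \<in> borel_measurable M" for m
            by (rule borel_measurable_scaleR[OF _ dm]) (intro borel_measurable_M test_function_measurable \<psi>)
          show "AE x in M. (\<lambda>m. \<psi> m x *\<^sub>R indicat_real (cbox a b) x *\<^sub>R d x)
              \<longlonglongrightarrow> indicat_real (box r' s') x *\<^sub>R indicat_real (cbox a b) x *\<^sub>R d x"
            by (intro AE_I2 tendsto_scaleR \<psi>(4) tendsto_const)
          show "AE x in M. norm (\<psi> m x *\<^sub>R indicat_real (cbox a b) x *\<^sub>R d x) \<le> norm (indicat_real (cbox a b) x *\<^sub>R d x)" for m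
            using mult_right_mono[OF 01 norm_ge_zero[of "indicat_real (cbox a b) _ *\<^sub>R d _"]]
            by (intro AE_I2) (simp only: norm_scaleR mult_1 real_norm_def)
        qed
        hence "(LINT x|M. indicator (box r' s') x *\<^sub>R (indicator (cbox a b) x *\<^sub>R d x)) = 0"
          unfolding zero by (simp add: LIMSEQ_const_iff)
        moreover have "(LINT x|M. indicator (box r' s') x *\<^sub>R (indicator (cbox a b) x *\<^sub>R d x)) =
            (LINT x|lebesgue. indicator \<Omega> x *\<^sub>R (indicator (box r' s') x *\<^sub>R (indicator (cbox a b) x *\<^sub>R d x)))"
          by (rule integral_restrict_space) simp
        moreover have "indicator \<Omega> x *\<^sub>R (indicator (box r' s') x *\<^sub>R (indicator (cbox a b) x *\<^sub>R d x))
            = indicator (box r s) x *\<^sub>R ?f x" for x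
          unfolding eq using sub by (auto simp: indicator_def)
        ultimately show ?thesis by (simp only:)
      qed
    qed
    moreover have "AE x in lebesgue. x \<notin> cbox a b - box a b"
    proof -
      have "negligible (cbox a b - box a b)" by (rule negligible_frontier_interval)
      thus ?thesis unfolding negligible_iff_null_sets by (rule AE_not_in)
    qed
    ultimately show ?thesis
      by eventually_elim (auto simp: indicator_def d_def split: if_splits)
  qed
  hence "AE x in lebesgue. x \<in> X \<longrightarrow> g x = g' x" if "X \<in> \<D>" for X
    using \<D>(2,3) that by blast
  hence "AE x in lebesgue. \<forall>X\<in>\<D>. x \<in> X \<longrightarrow> g x = g' x"
    unfolding AE_ball_countable[OF \<D>(1)] by blast
  hence "AE x in lebesgue. x \<in> \<Omega> \<longrightarrow> g x = g' x"
    by eventually_elim (use \<D>(4) in blast)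
  thus ?thesis by (simp add: AE_restrict_space_iff)
qed

lemma weak_grad_AE_eq:
  assumes "has_weak_gradient u g \<Omega>"
  shows "AE x in M. weak_grad \<Omega> u x = g x"
proof (rule weak_gradient_unique[OF _ assms])
  show "has_weak_gradient u (weak_grad \<Omega> u) \<Omega>"
    unfolding weak_grad_def using someI[of "\<lambda>g. has_weak_gradient u g \<Omega>", OF assms] .
qed

text \<open>A representative that is merely almost everywhere equal to an \<open>L\<^sup>p\<close> function is itself
  measurable because Lebesgue measure is complete.\<close>

lemma weak_grad_Lp:
  assumes "has_weak_gradient u g \<Omega>" "g \<in> Lp p \<Omega>"
  shows "weak_grad \<Omega> u \<in> Lp p \<Omega>"
proof -
  have eq: "AE x in M. g x = weak_grad \<Omega> u x"
    using weak_grad_AE_eq[OF assms(1)] by eventually_elim simp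
  have m: "weak_grad \<Omega> u \<in> borel_measurable M"
    by (rule borel_measurable_cong_AE_lebesgue_on[OF _ Lp_measurable[OF assms(2)] eq]) simp
  have "integrable M (\<lambda>x. norm (weak_grad \<Omega> u x) powr p)"
    by (rule integrable_cong_AE_imp[OF Lp_integrable[OF assms(2)]]) (use m eq in auto)
  thus ?thesis using m by (simp add: Lp_def)
qed

lemma has_weak_gradient_diff:
  assumes "has_weak_gradient u g \<Omega>" "u \<in> Lp p \<Omega>" "g \<in> Lp p \<Omega>"
    and "has_weak_gradient v h \<Omega>" "v \<in> Lp p \<Omega>" "h \<in> Lp p \<Omega>"
  shows "has_weak_gradient (\<lambda>x. u x - v x) (\<lambda>x. g x - h x) \<Omega>"
  unfolding has_weak_gradient_def
proof (intro conjI allI impI ballI)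
  show "(\<lambda>x. u x - v x) absolutely_integrable_on K" "(\<lambda>x. g x - h x) absolutely_integrable_on K"
    if "compact K \<and> K \<subseteq> \<Omega>" for K
    using that assms by (auto intro!: Lp_absolutely_integrable_on Lp_diff)
  fix \<psi> assume \<psi>: "\<psi> \<in> test_functions \<Omega>"
  obtain C where C: "\<And>x. norm (\<psi> x) \<le> C" "\<And>x. norm (grad \<psi> x) \<le> C"
    using test_function_bounded[OF \<psi>] by metis
  note m = test_function_measurable[OF \<psi>, THEN borel_measurable_M]
  have "integrable M (\<lambda>x. u x *\<^sub>R grad \<psi> x)" "integrable M (\<lambda>x. v x *\<^sub>R grad \<psi> x)"
    by (rule integrable_scaleR_bounded'[OF _ m(2) C(2)]; intro Lp_imp_integrable assms)+
  moreover have "integrable M (\<lambda>x. \<psi> x *\<^sub>R g x)" "integrable M (\<lambda>x. \<psi> x *\<^sub>R h x)"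
    by (rule integrable_scaleR_bounded[OF _ m(1) C(1)]; intro Lp_imp_integrable assms)+
  ultimately show "(LINT x|M. (u x - v x) *\<^sub>R grad \<psi> x) = - (LINT x|M. \<psi> x *\<^sub>R (g x - h x))"
    using assms(1,4) \<psi> by (simp add: has_weak_gradient_def scaleR_diff_left scaleR_diff_right)
qed

lemma W0_pair_test_function: "\<phi> \<in> test_functions \<Omega> \<Longrightarrow> W0_pair \<phi> (grad \<phi>)"
  unfolding W0_pair_def using p
  by (auto simp: test_function_Lp modular_def intro!: exI[of _ "\<lambda>_. \<phi>"])

lemma modular_diff_tendsto_linear_combination:
  fixes f g :: "real ^ 'n \<Rightarrow> 'b::euclidean_space"
  assumes "f \<in> Lp p \<Omega>" "g \<in> Lp p \<Omega>" "\<And>k. f' k \<in> Lp p \<Omega>" "\<And>k. g' k \<in> Lp p \<Omega>"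
    and "(\<lambda>k. modular (\<lambda>x. f x - f' k x)) \<longlonglongrightarrow> 0" "(\<lambda>k. modular (\<lambda>x. g x - g' k x)) \<longlonglongrightarrow> 0"
  shows "(\<lambda>k::nat. modular (\<lambda>x. (a *\<^sub>R f x + b *\<^sub>R g x) - (a *\<^sub>R f' k x + b *\<^sub>R g' k x))) \<longlonglongrightarrow> 0"
proof (rule tendsto_sandwich[OF _ _ tendsto_const])
  have "modular (\<lambda>x. (a *\<^sub>R f x + b *\<^sub>R g x) - (a *\<^sub>R f' k x + b *\<^sub>R g' k x)) \<le>
      2 powr p * (\<bar>a\<bar> powr p * modular (\<lambda>x. f x - f' k x) + \<bar>b\<bar> powr p * modular (\<lambda>x. g x - g' k x))" for k
  proof -
    have "(\<lambda>x. (a *\<^sub>R f x + b *\<^sub>R g x) - (a *\<^sub>R f' k x + b *\<^sub>R g' k x)) =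
        (\<lambda>x. a *\<^sub>R (f x - f' k x) + b *\<^sub>R (g x - g' k x))"
      by (simp add: algebra_simps)
    thus ?thesis
      using modular_add_le[OF Lp_scaleR[OF Lp_diff[OF assms(1,3)]] Lp_scaleR[OF Lp_diff[OF assms(2,4)]], of a k b k]
      by (simp only: modular_scaleR)
  qed
  thus "\<forall>\<^sub>F k in sequentially. modular (\<lambda>x. (a *\<^sub>R f x + b *\<^sub>R g x) - (a *\<^sub>R f' k x + b *\<^sub>R g' k x)) \<le>
      2 powr p * (\<bar>a\<bar> powr p * modular (\<lambda>x. f x - f' k x) + \<bar>b\<bar> powr p * modular (\<lambda>x. g x - g' k x))"
    by simp
  have "(\<lambda>k. 2 powr p * (\<bar>a\<bar> powr p * modular (\<lambda>x. f x - f' k x) + \<bar>b\<bar> powr p * modular (\<lambda>x. g x - g' k x)))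
    \<longlonglongrightarrow> 2 powr p * (\<bar>a\<bar> powr p * 0 + \<bar>b\<bar> powr p * 0)"
    by (intro tendsto_intros assms)
  thus "(\<lambda>k. 2 powr p * (\<bar>a\<bar> powr p * modular (\<lambda>x. f x - f' k x) + \<bar>b\<bar> powr p * modular (\<lambda>x. g x - g' k x)))
    \<longlonglongrightarrow> 0" by simp
qed (simp add: modular_nonneg)

lemma W0_pair_linear_combination:
  assumes "W0_pair u g" "W0_pair v h"
  shows "W0_pair (\<lambda>x. a * u x + b * v x) (\<lambda>x. a *\<^sub>R g x + b *\<^sub>R h x)"
proof -
  obtain \<phi> where \<phi>: "\<And>k::nat. \<phi> k \<in> test_functions \<Omega>" "(\<lambda>k. modular (\<lambda>x. u x - \<phi> k x)) \<longlonglongrightarrow> 0"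
      "(\<lambda>k. modular (\<lambda>x. g x - grad (\<phi> k) x)) \<longlonglongrightarrow> 0"
    using assms(1) by (auto simp: W0_pair_def)
  obtain \<psi> where \<psi>: "\<And>k::nat. \<psi> k \<in> test_functions \<Omega>" "(\<lambda>k. modular (\<lambda>x. v x - \<psi> k x)) \<longlonglongrightarrow> 0"
      "(\<lambda>k. modular (\<lambda>x. h x - grad (\<psi> k) x)) \<longlonglongrightarrow> 0"
    using assms(2) by (auto simp: W0_pair_def)
  note L = W0_pair_Lp[OF assms(1)] W0_pair_Lp[OF assms(2)]
  have "(\<lambda>x. a *\<^sub>R u x + b *\<^sub>R v x) \<in> Lp p \<Omega>" "(\<lambda>x. a *\<^sub>R g x + b *\<^sub>R h x) \<in> Lp p \<Omega>"
    by (intro Lp_add Lp_scaleR L)+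
  moreover have "(\<lambda>k. modular (\<lambda>x. (a *\<^sub>R u x + b *\<^sub>R v x) - (a *\<^sub>R \<phi> k x + b *\<^sub>R \<psi> k x))) \<longlonglongrightarrow> 0"
    "(\<lambda>k. modular (\<lambda>x. (a *\<^sub>R g x + b *\<^sub>R h x) - (a *\<^sub>R grad (\<phi> k) x + b *\<^sub>R grad (\<psi> k) x))) \<longlonglongrightarrow> 0"
    by (intro modular_diff_tendsto_linear_combination L test_function_Lp \<phi> \<psi>)+
  ultimately show ?thesis
    unfolding W0_pair_def using test_function_linear_combination[OF \<phi>(1) \<psi>(1)]
    by (intro conjI exI[of _ "\<lambda>k x. a * \<phi> k x + b * \<psi> k x"]) simp_all
qed

lemma W0_pair_approx:
  assumes "W0_pair u g" "e > 0"
  obtains \<phi> where "\<phi> \<in> test_functions \<Omega>" "modular (\<lambda>x. u x - \<phi> x) < e" "modular (\<lambda>x. g x - grad \<phi> x) < e"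
proof -
  obtain \<phi> where \<phi>: "\<And>k::nat. \<phi> k \<in> test_functions \<Omega>" "(\<lambda>k. modular (\<lambda>x. u x - \<phi> k x)) \<longlonglongrightarrow> 0"
      "(\<lambda>k. modular (\<lambda>x. g x - grad (\<phi> k) x)) \<longlonglongrightarrow> 0"
    using assms(1) by (auto simp: W0_pair_def)
  have "\<forall>\<^sub>F k in sequentially. modular (\<lambda>x. u x - \<phi> k x) < e \<and> modular (\<lambda>x. g x - grad (\<phi> k) x) < e"
    using order_tendstoD(2)[OF \<phi>(2) assms(2)] order_tendstoD(2)[OF \<phi>(3) assms(2)] by (rule eventually_conj)
  then obtain k where "modular (\<lambda>x. u x - \<phi> k x) < e \<and> modular (\<lambda>x. g x - grad (\<phi> k) x) < e"
    by (auto simp: eventually_sequentially)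
  thus thesis using that[OF \<phi>(1)] by blast
qed

lemma modular_tendsto_trans:
  fixes f :: "real ^ 'n \<Rightarrow> 'b::euclidean_space"
  assumes L: "f \<in> Lp p \<Omega>" "\<And>k. f' k \<in> Lp p \<Omega>" "\<And>k. f'' k \<in> Lp p \<Omega>"
    and lim: "(\<lambda>k::nat. modular (\<lambda>x. f' k x - f x)) \<longlonglongrightarrow> 0" "(\<lambda>k. modular (\<lambda>x. f' k x - f'' k x)) \<longlonglongrightarrow> 0"
  shows "(\<lambda>k. modular (\<lambda>x. f x - f'' k x)) \<longlonglongrightarrow> 0"
proof (rule tendsto_sandwich[OF _ _ tendsto_const])
  show "\<forall>\<^sub>F k in sequentially. modular (\<lambda>x. f x - f'' k x) \<le>
      2 powr p * (modular (\<lambda>x. f' k x - f x) + modular (\<lambda>x. f' k x - f'' k x))"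
    using modular_triangle[OF L] by (simp add: modular_minus_commute[of f])
  show "(\<lambda>k. 2 powr p * (modular (\<lambda>x. f' k x - f x) + modular (\<lambda>x. f' k x - f'' k x))) \<longlonglongrightarrow> 0"
    using tendsto_mult[OF tendsto_const[of "2 powr p"] tendsto_add[OF lim]] by simp
qed (simp add: modular_nonneg)

lemma W0_pair_approx_sequence:
  assumes W: "\<And>k::nat. W0_pair (u k) (g k)"
  shows "\<exists>\<phi>. \<forall>k. \<phi> k \<in> test_functions \<Omega> \<and> modular (\<lambda>x. u k x - \<phi> k x) < inverse (real (Suc k)) \<and>
    modular (\<lambda>x. g k x - grad (\<phi> k) x) < inverse (real (Suc k))"
proof (rule choice, rule allI)
  fix k
  show "\<exists>\<phi>. \<phi> \<in> test_functions \<Omega> \<and> modular (\<lambda>x. u k x - \<phi> x) < inverse (real (Suc k)) \<and>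
    modular (\<lambda>x. g k x - grad \<phi> x) < inverse (real (Suc k))"
    by (rule W0_pair_approx[OF W[of k], of "inverse (real (Suc k))"]) auto
qed

lemma tendsto_0_of_less_inverse:
  fixes a :: "nat \<Rightarrow> real"
  assumes "\<And>k. 0 \<le> a k" "\<And>k. a k < inverse (real (Suc k))"
  shows "a \<longlonglongrightarrow> 0"
  by (rule tendsto_sandwich[OF _ _ tendsto_const LIMSEQ_inverse_real_of_nat])
    (use assms in \<open>auto intro!: always_eventually less_imp_le\<close>)

text \<open>A diagonal argument: approximate the \<open>k\<close>-th pair by a test function up to \<open>1/(k+1)\<close>.\<close>

lemma W0_pair_closed:
  assumes W: "\<And>k::nat. W0_pair (u k) (g k)" and L: "v \<in> Lp p \<Omega>" "h \<in> Lp p \<Omega>"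
    and lim: "(\<lambda>k. modular (\<lambda>x. u k x - v x)) \<longlonglongrightarrow> 0" "(\<lambda>k. modular (\<lambda>x. g k x - h x)) \<longlonglongrightarrow> 0"
  shows "W0_pair v h"
proof -
  obtain \<phi> where \<phi>: "\<And>k. \<phi> k \<in> test_functions \<Omega>"
    "\<And>k. modular (\<lambda>x. u k x - \<phi> k x) < inverse (real (Suc k))"
    "\<And>k. modular (\<lambda>x. g k x - grad (\<phi> k) x) < inverse (real (Suc k))"
    using W0_pair_approx_sequence[of u g, OF W] by blast
  have "(\<lambda>k. modular (\<lambda>x. u k x - \<phi> k x)) \<longlonglongrightarrow> 0" "(\<lambda>k. modular (\<lambda>x. g k x - grad (\<phi> k) x)) \<longlonglongrightarrow> 0"
    by (rule tendsto_0_of_less_inverse[OF modular_nonneg \<phi>(2)] tendsto_0_of_less_inverse[OF modular_nonneg \<phi>(3)])+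
  hence "(\<lambda>k. modular (\<lambda>x. v x - \<phi> k x)) \<longlonglongrightarrow> 0" "(\<lambda>k. modular (\<lambda>x. h x - grad (\<phi> k) x)) \<longlonglongrightarrow> 0"
    using lim by (auto intro!: modular_tendsto_trans[of _ u] modular_tendsto_trans[of _ g]
        L W0_pair_Lp[OF W] test_function_Lp \<phi>)
  thus ?thesis using L \<phi>(1) unfolding W0_pair_def by blast
qed

lemma Lp_norm_eq_modular: "Lp_norm p \<Omega> f = modular f powr (1 / p)"
  by (simp add: Lp_norm_def modular_def)

text \<open>The weak gradient of \<open>u - \<phi>\<^sub>k\<close> that enters the Sobolev norm is chosen separately for each
  difference; by uniqueness it may be replaced by \<open>g - \<nabla>\<phi>\<^sub>k\<close>.\<close>

lemma W1p_norm_tendsto_0_iff: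
  assumes u: "u \<in> Lp p \<Omega>" "g \<in> Lp p \<Omega>" "has_weak_gradient u g \<Omega>" and \<phi>: "\<And>k. \<phi> k \<in> test_functions \<Omega>"
  shows "(\<lambda>k. W1p_norm p \<Omega> (\<lambda>x. u x - \<phi> k x)) \<longlonglongrightarrow> 0 \<longleftrightarrow>
    (\<lambda>k. modular (\<lambda>x. u x - \<phi> k x)) \<longlonglongrightarrow> 0 \<and> (\<lambda>k. modular (\<lambda>x. g x - grad (\<phi> k) x)) \<longlonglongrightarrow> 0"
proof -
  have eq: "W1p_norm p \<Omega> (\<lambda>x. u x - \<phi> k x) =
      modular (\<lambda>x. u x - \<phi> k x) powr (1 / p) + modular (\<lambda>x. g x - grad (\<phi> k) x) powr (1 / p)" for k
  proof -
    have w: "has_weak_gradient (\<lambda>x. u x - \<phi> k x) (\<lambda>x. g x - grad (\<phi> k) x) \<Omega>"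
      by (intro has_weak_gradient_diff u test_function_Lp \<phi> W0_pair_has_weak_gradient W0_pair_test_function)
    have L: "(\<lambda>x. g x - grad (\<phi> k) x) \<in> Lp p \<Omega>" by (intro Lp_diff u test_function_Lp \<phi>)
    show ?thesis
      unfolding W1p_norm_def Lp_norm_eq_modular
      using modular_cong_AE[OF Lp_measurable[OF weak_grad_Lp[OF w L]] Lp_measurable[OF L] weak_grad_AE_eq[OF w]]
      by simp
  qed
  show ?thesis (is "?L \<longleftrightarrow> ?R")
  proof
    assume ?R
    hence "(\<lambda>k. modular (\<lambda>x. u x - \<phi> k x) powr (1 / p) + modular (\<lambda>x. g x - grad (\<phi> k) x) powr (1 / p)) \<longlonglongrightarrow>
        0 powr (1 / p) + 0 powr (1 / p)"
      using p by (intro tendsto_add tendsto_powr' tendsto_const) (auto simp: modular_nonneg)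
    thus ?L by (simp add: eq)
  next
    assume ?L
    hence "(\<lambda>k. W1p_norm p \<Omega> (\<lambda>x. u x - \<phi> k x) powr p) \<longlonglongrightarrow> 0 powr p"
      using p by (intro tendsto_powr' tendsto_const) (auto simp: eq)
    hence lim: "(\<lambda>k. W1p_norm p \<Omega> (\<lambda>x. u x - \<phi> k x) powr p) \<longlonglongrightarrow> 0" using p by simp
    have root: "m \<le> (m powr (1 / p) + m' powr (1 / p)) powr p" if "m \<ge> 0" "m' \<ge> 0" for m m' :: real
    proof -
      have "m = (m powr (1 / p)) powr p" using that p by (simp add: powr_powr)
      also have "\<dots> \<le> (m powr (1 / p) + m' powr (1 / p)) powr p" using p by (intro powr_mono2) auto
      finally show ?thesis .
    qed
    have "modular (\<lambda>x. u x - \<phi> k x) \<le> W1p_norm p \<Omega> (\<lambda>x. u x - \<phi> k x) powr p" for k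
      unfolding eq by (rule root[OF modular_nonneg modular_nonneg])
    moreover have "modular (\<lambda>x. g x - grad (\<phi> k) x) \<le> W1p_norm p \<Omega> (\<lambda>x. u x - \<phi> k x) powr p" for k
      unfolding eq by (subst add.commute) (rule root[OF modular_nonneg modular_nonneg])
    ultimately show ?R
      by (intro conjI; intro tendsto_sandwich[OF _ _ tendsto_const lim] always_eventually allI modular_nonneg) auto
  qed
qed

lemma W0_pair_imp_W01p:
  assumes "W0_pair u g"
  shows "u \<in> W01p p \<Omega>" "AE x in M. weak_grad \<Omega> u x = g x"
proof -
  note w = W0_pair_has_weak_gradient[OF assms] and L = W0_pair_Lp[OF assms]
  show "AE x in M. weak_grad \<Omega> u x = g x" by (rule weak_grad_AE_eq[OF w])
  show "u \<in> W01p p \<Omega>"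
    using assms w L W1p_norm_tendsto_0_iff[OF L w] unfolding W01p_def W1p_def W0_pair_def by blast
qed

lemma W01p_imp_W0_pair:
  assumes "u \<in> W01p p \<Omega>"
  shows "W0_pair u (weak_grad \<Omega> u)"
proof -
  obtain g where g: "u \<in> Lp p \<Omega>" "has_weak_gradient u g \<Omega>" "g \<in> Lp p \<Omega>"
    using assms by (auto simp: W01p_def W1p_def)
  have w: "has_weak_gradient u (weak_grad \<Omega> u) \<Omega>"
    unfolding weak_grad_def using someI[of "\<lambda>g. has_weak_gradient u g \<Omega>", OF g(2)] .
  have L: "weak_grad \<Omega> u \<in> Lp p \<Omega>" using g by (intro weak_grad_Lp)
  show ?thesis
    using assms g(1) L W1p_norm_tendsto_0_iff[OF g(1) L w] unfolding W01p_def W0_pair_def by blast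
qed

end

section \<open>Averages over the cells of a cubic grid\<close>

lemma powr_tangent:
  fixes a s p :: real
  assumes "1 \<le> p" "0 < a" "0 \<le> s"
  shows "a powr p + p * a powr (p - 1) * (s - a) \<le> s powr p"
proof (cases "s = 0")
  case True
  have "a powr p = a powr (p - 1) * a"
    using assms powr_mult_base[of a "p - 1"] by (simp add: mult.commute)
  hence "a powr p + p * a powr (p - 1) * (s - a) = (1 - p) * a powr p"
    using True by (simp add: algebra_simps)
  also have "\<dots> \<le> 0" using assms by (intro mult_nonpos_nonneg) auto
  finally show ?thesis using True by simp
next
  case False
  have "s powr p - a powr p \<ge> (p * a powr (p - 1)) * (s - a)"
  proof (rule convex_on_imp_above_tangent)
    show "convex_on {0<..} (\<lambda>x. x powr p)" using assms(1) by (rule powr_convex)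
    show "((\<lambda>x. x powr p) has_real_derivative p * a powr (p - 1)) (at a within {0<..})"
      using has_real_derivative_powr[OF assms(2)] by (rule has_field_derivative_at_within)
  qed (use assms False in \<open>auto simp: interior_open\<close>)
  thus ?thesis by simp
qed

text \<open>Jensen's inequality for \<open>s\<^sup>p\<close> and a measure that need not have total mass \<open>1\<close>, obtained by
  integrating the inequality for the tangent at the mean of \<open>g\<close>.\<close>

lemma integral_powr_le:
  fixes g :: "'a \<Rightarrow> real"
  assumes "finite_measure N" "0 < measure N (space N)" "1 \<le> p" "\<And>x. 0 \<le> g x"
    and g: "integrable N g" "integrable N (\<lambda>x. g x powr p)"
  shows "(LINT x|N. g x) powr p \<le> measure N (space N) powr (p - 1) * (LINT x|N. g x powr p)"
proof -
  interpret finite_measure N by fact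
  define m where "m = measure N (space N)"
  define a where "a = (LINT x|N. g x) / m"
  have "m > 0" using assms(2) by (simp add: m_def)
  have "a \<ge> 0" unfolding a_def using assms(4) \<open>m > 0\<close> by simp
  have I: "(LINT x|N. g x) = m * a" using \<open>m > 0\<close> by (simp add: a_def)
  show ?thesis
  proof (cases "a = 0")
    case True
    have "0 \<le> (LINT x|N. g x powr p)" by simp
    thus ?thesis using I True assms(3) by simp
  next
    case False
    hence "a > 0" using \<open>a \<ge> 0\<close> by simp
    have "m * a powr p = (LINT x|N. a powr p + p * a powr (p - 1) * (g x - a))"
      using g(1) I by (simp add: m_def[symmetric] algebra_simps)
    also have "\<dots> \<le> (LINT x|N. g x powr p)"
      using g assms(3,4) \<open>a > 0\<close> by (intro integral_mono powr_tangent) auto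
    finally have le: "m * a powr p \<le> (LINT x|N. g x powr p)" .
    have "(LINT x|N. g x) powr p = m powr p * a powr p"
      using I \<open>m > 0\<close> \<open>a > 0\<close> by (simp add: powr_mult)
    also have "\<dots> = m powr (p - 1) * (m * a powr p)"
      using \<open>m > 0\<close> powr_mult_base[of m "p - 1"] by (simp add: mult_ac)
    also have "\<dots> \<le> m powr (p - 1) * (LINT x|N. g x powr p)"
      using le by (intro mult_left_mono) auto
    finally show ?thesis by (simp add: m_def)
  qed
qed

lemma set_integral_powr_le:
  fixes g :: "'a::euclidean_space \<Rightarrow> real"
  assumes S: "S \<in> sets borel" "emeasure lborel S < \<infinity>" "0 < measure lborel S" and p: "1 \<le> p"
    and g: "\<And>x. 0 \<le> g x" "\<And>x. x \<in> S \<Longrightarrow> g x \<le> C" "g \<in> borel_measurable borel"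
  shows "integrable lborel (\<lambda>x. indicator S x * g x)"
    "(LINT x|lborel. indicator S x * g x) powr p \<le>
      measure lborel S powr (p - 1) * (LINT x|lborel. indicator S x * g x powr p)"
    "ennreal (LINT x|lborel. indicator S x * g x powr p) = (\<integral>\<^sup>+x. ennreal (g x powr p) * indicator S x \<partial>lborel)"
proof -
  let ?N = "restrict_space lborel S"
  have "emeasure ?N (space ?N) = emeasure lborel S"
    using S(1) by (simp add: emeasure_restrict_space space_restrict_space)
  hence fin: "finite_measure ?N"
    using S(2) by (intro finite_measureI) (simp only: infinity_ennreal_def less_top)
  have [measurable]: "g \<in> borel_measurable borel" "S \<in> sets borel" using g S by auto
  have int: "integrable ?N h" if "h \<in> borel_measurable borel" "\<And>x. x \<in> S \<Longrightarrow> norm (h x) \<le> D"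
    for h :: "'a \<Rightarrow> real" and D
  proof (rule finite_measure.integrable_const_bound[OF fin])
    show "AE x in ?N. norm (h x) \<le> D"
      using that(2) by (intro AE_I2) (simp add: space_restrict_space)
    show "h \<in> borel_measurable ?N"
      using that(1) by (intro measurable_restrict_space1) simp
  qed
  have i: "integrable ?N g" by (rule int[OF g(3), of C]) (simp add: g(1,2))
  have ip: "integrable ?N (\<lambda>x. g x powr p)"
  proof (rule int)
    show "norm (g x powr p) \<le> C powr p" if "x \<in> S" for x
      using powr_mono2[OF _ g(1) g(2)[OF that], of p] p by simp
  qed measurable
  have ip': "integrable lborel (\<lambda>x. indicator S x * g x powr p)"
    using ip S by (simp add: integrable_restrict_space)
  show "integrable lborel (\<lambda>x. indicator S x * g x)"
    using i S by (simp add: integrable_restrict_space)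
  have "measure ?N (space ?N) = measure lborel S"
    using S by (simp add: measure_restrict_space space_restrict_space)
  thus "(LINT x|lborel. indicator S x * g x) powr p \<le>
      measure lborel S powr (p - 1) * (LINT x|lborel. indicator S x * g x powr p)"
    using integral_powr_le[OF fin _ p g(1) i ip] S by (simp add: integral_restrict_space)
  have "ennreal (LINT x|lborel. indicator S x * g x powr p) = (\<integral>\<^sup>+x. ennreal (indicator S x * g x powr p) \<partial>lborel)"
    using ip' by (intro nn_integral_eq_integral[symmetric]) auto
  also have "\<dots> = (\<integral>\<^sup>+x. ennreal (g x powr p) * indicator S x \<partial>lborel)"
    by (intro nn_integral_cong) (auto simp: indicator_def)
  finally show "ennreal (LINT x|lborel. indicator S x * g x powr p) = (\<integral>\<^sup>+x. ennreal (g x powr p) * indicator S x \<partial>lborel)" .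
qed

lemma nn_integral_translate:
  fixes f :: "'a::euclidean_space \<Rightarrow> ennreal"
  assumes "f \<in> borel_measurable borel"
  shows "(\<integral>\<^sup>+x. f (x + h) \<partial>lborel) = (\<integral>\<^sup>+x. f x \<partial>lborel)"
proof -
  have "(\<integral>\<^sup>+x. f x \<partial>lborel) = (\<integral>\<^sup>+x. f x \<partial>distr lborel borel ((+) h))"
    by (simp only: lborel_distr_plus)
  also have "\<dots> = (\<integral>\<^sup>+x. f (h + x) \<partial>lborel)"
    using assms by (subst nn_integral_distr) auto
  finally show ?thesis by (simp add: add.commute)
qed

text \<open>The fundamental theorem of calculus along the segment from \<open>x\<close> to \<open>x + h\<close>, followed by
  Jensen's inequality.\<close>

lemma translation_estimate_pointwise:
  fixes f :: "real ^ 'n \<Rightarrow> real"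
  assumes p: "1 \<le> p" and diff: "\<And>x. f differentiable (at x)" and cont: "continuous_on UNIV (grad f)"
  shows "ennreal (\<bar>f (x + h) - f x\<bar> powr p) \<le>
    ennreal (norm h powr p) * (\<integral>\<^sup>+t. ennreal (norm (grad f (x + t *\<^sub>R h)) powr p) * indicator {0..1} t \<partial>lborel)"
proof -
  let ?g = "\<lambda>t::real. norm (grad f (x + t *\<^sub>R h))"
  let ?G = "\<lambda>t::real. grad f (x + t *\<^sub>R h) \<bullet> h"
  have cg: "continuous_on UNIV (\<lambda>t::real. grad f (x + t *\<^sub>R h))"
    by (intro continuous_on_compose2[OF cont] continuous_intros) auto
  have [measurable]: "(\<lambda>t::real. grad f (x + t *\<^sub>R h)) \<in> borel_measurable borel"
    using cg by (rule borel_measurable_continuous_onI)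
  have "compact (?g ` {0..1})"
    by (intro compact_continuous_image continuous_on_norm continuous_on_subset[OF cg]) auto
  hence "bounded (?g ` {0..1})" by (rule compact_imp_bounded)
  then obtain C where C0: "\<forall>y\<in>?g ` {0..1}. norm y \<le> C" unfolding bounded_iff by blast
  have C: "?g t \<le> C" if "t \<in> {0..1}" for t
    using bspec[OF C0 imageI[OF that]] by simp
  have "(LINT t|lborel. indicator {0..1} t *\<^sub>R ?G t) = f (x + 1 *\<^sub>R h) - f (x + 0 *\<^sub>R h)"
  proof (rule integral_FTC_Icc[where F = "\<lambda>t. f (x + t *\<^sub>R h)"])
    fix t :: real
    have "((\<lambda>t. x + t *\<^sub>R h) has_derivative (\<lambda>s. s *\<^sub>R h)) (at t)"
      by (auto intro!: derivative_eq_intros)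
    from has_derivative_compose[OF this has_derivative_grad[OF diff]]
    have "((\<lambda>t. f (x + t *\<^sub>R h)) has_real_derivative ?G t) (at t)"
      by (simp add: has_field_derivative_def mult.commute[of _ "?G t"])
    thus "((\<lambda>t. f (x + t *\<^sub>R h)) has_vector_derivative ?G t) (at t within {0..1})"
      by (simp add: has_real_derivative_iff_has_vector_derivative has_vector_derivative_at_within)
    show "continuous_on {0..1} ?G"
      by (intro continuous_on_inner continuous_on_const continuous_on_subset[OF cg]) auto
  qed simp
  hence "f (x + h) - f x = (LINT t|lborel. indicator {0..1} t *\<^sub>R ?G t)" by simp
  also have "\<bar>\<dots>\<bar> \<le> (LINT t|lborel. norm h * (indicator {0..1} t * ?g t))"
  proof (rule order.trans[OF integral_abs_bound], rule integral_mono_AE')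
    show "integrable lborel (\<lambda>t. norm h * (indicator {0..1} t * ?g t))"
      by (rule integrable_mult_right, rule set_integral_powr_le(1)[OF _ _ _ p _ C]) auto
    show "AE t in lborel. \<bar>indicator {0..1} t *\<^sub>R ?G t\<bar> \<le> norm h * (indicator {0..1} t * ?g t)"
      using Cauchy_Schwarz_ineq2[of "grad f (x + _ *\<^sub>R h)" h]
      by (intro AE_I2) (auto simp: indicator_def mult.commute)
  qed auto
  also have "\<dots> = norm h * (LINT t|lborel. indicator {0..1} t * ?g t)" by simp
  finally have "\<bar>f (x + h) - f x\<bar> powr p \<le> (norm h * (LINT t|lborel. indicator {0..1} t * ?g t)) powr p"
    using p by (intro powr_mono2) auto
  also have "\<dots> = norm h powr p * (LINT t|lborel. indicator {0..1} t * ?g t) powr p"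
    by (intro powr_mult) 
  also have "\<dots> \<le> norm h powr p * (LINT t|lborel. indicator {0..1} t * ?g t powr p)"
    using set_integral_powr_le(2)[of "{0..1::real}" p ?g C] C p by (intro mult_left_mono) auto
  finally have "ennreal (\<bar>f (x + h) - f x\<bar> powr p) \<le>
      ennreal (norm h powr p) * ennreal (LINT t|lborel. indicator {0..1} t * ?g t powr p)"
    by (simp add: ennreal_mult'[symmetric] ennreal_leI)
  also have "ennreal (LINT t|lborel. indicator {0..1} t * ?g t powr p) =
      (\<integral>\<^sup>+t. ennreal (?g t powr p) * indicator {0..1} t \<partial>lborel)"
    by (rule set_integral_powr_le(3)[OF _ _ _ p _ C]) auto
  finally show ?thesis .
qed

text \<open>After exchanging the integrals, translation invariance removes the dependence on \<open>t\<close>.\<close>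

lemma translation_estimate:
  fixes f :: "real ^ 'n \<Rightarrow> real"
  assumes p: "1 \<le> p" and diff: "\<And>x. f differentiable (at x)" and cont: "continuous_on UNIV (grad f)"
  shows "(\<integral>\<^sup>+x. ennreal (\<bar>f (x + h) - f x\<bar> powr p) \<partial>lborel) \<le>
    ennreal (norm h powr p) * (\<integral>\<^sup>+x. ennreal (norm (grad f x) powr p) \<partial>lborel)"
proof -
  have [measurable]: "grad f \<in> borel_measurable borel"
    using cont by (rule borel_measurable_continuous_onI)
  let ?G = "\<lambda>x. ennreal (norm (grad f x) powr p)"
  have "(\<integral>\<^sup>+x. ennreal (\<bar>f (x + h) - f x\<bar> powr p) \<partial>lborel) \<le>
      (\<integral>\<^sup>+x. ennreal (norm h powr p) * (\<integral>\<^sup>+t. ?G (x + t *\<^sub>R h) * indicator {0..1} t \<partial>lborel) \<partial>lborel)"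
    by (intro nn_integral_mono translation_estimate_pointwise assms)
  also have "\<dots> = ennreal (norm h powr p) * (\<integral>\<^sup>+x. (\<integral>\<^sup>+t. ?G (x + t *\<^sub>R h) * indicator {0..1::real} t \<partial>lborel) \<partial>lborel)"
    by (rule nn_integral_cmult) measurable
  also have "(\<integral>\<^sup>+x. (\<integral>\<^sup>+t. ?G (x + t *\<^sub>R h) * indicator {0..1::real} t \<partial>lborel) \<partial>lborel) =
      (\<integral>\<^sup>+t. (\<integral>\<^sup>+x. ?G (x + t *\<^sub>R h) * indicator {0..1::real} t \<partial>lborel) \<partial>lborel)"
    by (rule lborel_pair.Fubini') measurable
  also have "\<dots> = (\<integral>\<^sup>+t. (\<integral>\<^sup>+x. ?G x \<partial>lborel) * indicator {0..1::real} t \<partial>lborel)"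
    by (intro nn_integral_cong) (simp add: nn_integral_multc nn_integral_translate[of ?G])
  also have "\<dots> = (\<integral>\<^sup>+x. ?G x \<partial>lborel)"
    by (simp add: nn_integral_cmult)
  finally show ?thesis .
qed

text \<open>The half-open cubes of side \<open>d\<close>, indexed by integer vectors; they partition the space.\<close>

definition cell :: "real \<Rightarrow> ('n \<Rightarrow> int) \<Rightarrow> (real ^ 'n) set" where
  "cell d z = {y. \<forall>i. \<lfloor>y $ i / d\<rfloor> = z i}"

definition cell_of :: "real \<Rightarrow> real ^ 'n \<Rightarrow> 'n \<Rightarrow> int" where
  "cell_of d x = (\<lambda>i. \<lfloor>x $ i / d\<rfloor>)"

definition cell_average :: "real \<Rightarrow> (real ^ 'n \<Rightarrow> real) \<Rightarrow> real ^ 'n \<Rightarrow> real" where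
  "cell_average d f x = (LINT y|lborel. indicator (cell d (cell_of d x)) y * f y) / measure lborel (cell d (cell_of d x))"

lemma cell_sets [measurable, simp]: "cell d z \<in> sets (borel :: (real ^ 'n) measure)"
proof -
  have "cell d z = (\<Inter>i\<in>UNIV. (\<lambda>y::real^'n. y $ i / d) -` {of_int (z i)..<of_int (z i) + 1})"
    by (auto simp: cell_def floor_eq_iff)
  also have "\<dots> \<in> sets borel"
  proof (intro sets.finite_INT)
    fix i
    have "(\<lambda>y::real^'n. y $ i) \<in> borel_measurable borel"
      by (intro borel_measurable_continuous_onI continuous_intros)
    hence "(\<lambda>y::real^'n. y $ i / d) \<in> borel_measurable borel" by simp
    thus "(\<lambda>y::real^'n. y $ i / d) -` {of_int (z i)..<of_int (z i) + 1} \<in> sets borel"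
      by (rule measurable_sets_borel) simp
  qed auto
  finally show ?thesis .
qed

lemma mem_cell_of: "x \<in> cell d (cell_of d x)"
  by (simp add: cell_def cell_of_def)

lemma mem_cell_iff:
  assumes "d > 0"
  shows "y \<in> cell d z \<longleftrightarrow> (\<forall>i. d * of_int (z i) \<le> y $ i \<and> y $ i < d * (of_int (z i) + 1))"
  using assms by (auto simp: cell_def floor_eq_iff pos_le_divide_eq pos_divide_less_eq mult.commute)

lemma cell_measure:
  fixes z :: "'n::finite \<Rightarrow> int"
  assumes "d > 0"
  shows "emeasure lborel (cell d z :: (real ^ 'n) set) < \<infinity>" "d ^ CARD('n) \<le> measure lborel (cell d z :: (real ^ 'n) set)"
proof -
  define l u where "l = (\<chi> i. d * of_int (z i) :: real ^ 'n)" and "u = (\<chi> i. d * (of_int (z i) + 1) :: real ^ 'n)"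
  have sub: "box l u \<subseteq> cell d z" "cell d z \<subseteq> cbox l u"
    using assms by (auto simp: mem_cell_iff mem_box_cart l_def u_def less_imp_le)
  show fin: "emeasure lborel (cell d z :: (real ^ 'n) set) < \<infinity>"
    using emeasure_mono[OF sub(2), of lborel] emeasure_bounded_finite[OF bounded_cbox, of l u] by (auto intro: le_less_trans)
  have "(u - l) \<bullet> b = d" if "b \<in> Basis" for b
  proof -
    obtain i where "b = axis i 1" using \<open>b \<in> Basis\<close> by (auto simp: Basis_vec_def)
    thus ?thesis by (simp add: inner_axis l_def u_def algebra_simps)
  qed
  moreover have "l \<bullet> b \<le> u \<bullet> b" if "b \<in> Basis" for b
    using calculation[OF that] assms by (simp add: inner_diff_left)
  ultimately have "measure lborel (box l u) = d ^ CARD('n)"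
    by (simp add: measure_lborel_box_eq)
  moreover have "measure lborel (box l u) \<le> measure lborel (cell d z)"
    using sub(1) fin by (intro measure_mono_fmeasurable) (auto simp: fmeasurable_def)
  ultimately show "d ^ CARD('n) \<le> measure lborel (cell d z :: (real ^ 'n) set)" by simp
qed

lemma cell_diff_in_box:
  fixes x y :: "real ^ 'n"
  assumes "d > 0" "y \<in> cell d (cell_of d x)"
  shows "y - x \<in> box (\<chi> i. - d) (\<chi> i. d)"
proof -
  have "x \<in> cell d (cell_of d x)" by (rule mem_cell_of)
  hence "d * of_int (cell_of d x i) \<le> x $ i \<and> x $ i < d * (of_int (cell_of d x i) + 1)"
    "d * of_int (cell_of d x i) \<le> y $ i \<and> y $ i < d * (of_int (cell_of d x i) + 1)" for i
    using assms by (simp_all add: mem_cell_iff)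
  moreover have "d * (of_int (cell_of d x i) + 1) = d * of_int (cell_of d x i) + d" for i
    by (simp add: distrib_left)
  ultimately have "- d < y $ i - x $ i \<and> y $ i - x $ i < d" for i
    by (smt (verit))
  thus ?thesis by (simp add: mem_box_cart)
qed

text \<open>Jensen's inequality bounds the left-hand side by the mean of \<open>\<bar>f x - f y\<bar>\<^sup>p\<close> over the cell of \<open>x\<close>.
  Replacing the cell by the cube of points \<open>x + h\<close> with all \<open>\<bar>h\<^sub>i\<bar> < d\<close> removes the
  dependence of the domain on \<open>x\<close>, so that the result can be integrated by Tonelli's theorem.\<close>

lemma cell_average_pointwise:
  fixes f :: "real ^ 'n \<Rightarrow> real"
  assumes p: "1 \<le> p" and d: "d > 0" and f: "f \<in> borel_measurable borel" "\<And>x. \<bar>f x\<bar> \<le> C"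
  shows "ennreal (\<bar>f x - cell_average d f x\<bar> powr p) \<le>
    ennreal (1 / d ^ CARD('n)) * (\<integral>\<^sup>+h. ennreal (\<bar>f (x + h) - f x\<bar> powr p) * indicator (box (\<chi> i. - d) (\<chi> i. d)) h \<partial>lborel)"
proof -
  define Q where "Q = cell d (cell_of d x)"
  define V where "V = measure lborel Q"
  have Q: "Q \<in> sets borel" "emeasure lborel Q < \<infinity>" "d ^ CARD('n) \<le> V"
    using cell_measure[OF d, of "cell_of d x"] by (simp_all add: Q_def V_def)
  have V: "V > 0" using Q(3) d by (smt (verit) zero_less_power)
  have [measurable]: "f \<in> borel_measurable borel" "Q \<in> sets borel" using f Q by auto
  let ?g = "\<lambda>y. \<bar>f x - f y\<bar>"
  have gC: "?g y \<le> 2 * C" for y using f(2)[of x] f(2)[of y] by linarith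
  have gm: "?g \<in> borel_measurable borel" by measurable
  note Qg = set_integral_powr_le[OF Q(1,2) V[unfolded V_def] p abs_ge_zero gC gm]
  have iQ: "integrable lborel (indicator Q :: _ \<Rightarrow> real)" using Q by (intro integrable_real_indicator) auto
  have if': "integrable lborel (\<lambda>y. indicator Q y * f y)"
  proof (rule Bochner_Integration.integrable_bound[OF integrable_mult_left[OF iQ, of C]])
    show "AE y in lborel. norm (indicator Q y * f y) \<le> norm (indicator Q y * C)"
      using f(2) by (intro AE_I2) (auto simp: indicator_def intro: order.trans[OF f(2) abs_ge_self])
  qed measurable
  have "f x - cell_average d f x = (LINT y|lborel. indicator Q y * (f x - f y)) / V"
  proof -
    have "(LINT y|lborel. indicator Q y * (f x - f y)) = (LINT y|lborel. indicator Q y * f x - indicator Q y * f y)"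
      by (simp add: right_diff_distrib)
    also have "\<dots> = V * f x - (LINT y|lborel. indicator Q y * f y)"
      using iQ if' by (subst Bochner_Integration.integral_diff) (auto simp: V_def)
    finally show ?thesis using V by (simp add: cell_average_def Q_def[symmetric] V_def[symmetric] field_simps)
  qed
  hence "\<bar>f x - cell_average d f x\<bar> = \<bar>LINT y|lborel. indicator Q y * (f x - f y)\<bar> / V"
    using V by simp
  also have "\<dots> \<le> (LINT y|lborel. indicator Q y * ?g y) / V"
    using V integral_abs_bound[of lborel "\<lambda>y. indicator Q y * (f x - f y)"]
    by (intro divide_right_mono) (auto simp: abs_mult)
  finally have "\<bar>f x - cell_average d f x\<bar> powr p \<le> ((LINT y|lborel. indicator Q y * ?g y) / V) powr p"
    using p by (intro powr_mono2) auto
  also have "\<dots> = (LINT y|lborel. indicator Q y * ?g y) powr p / V powr p"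
    using V by (simp add: powr_divide)
  also have "\<dots> \<le> (V powr (p - 1) * (LINT y|lborel. indicator Q y * ?g y powr p)) / V powr p"
    using Qg(2) by (intro divide_right_mono) (auto simp: V_def)
  also have "\<dots> = (1 / V) * (LINT y|lborel. indicator Q y * ?g y powr p)"
    using V by (simp add: powr_diff field_simps)
  also have "\<dots> \<le> (1 / d ^ CARD('n)) * (LINT y|lborel. indicator Q y * ?g y powr p)"
    using Q(3) d V by (intro mult_right_mono divide_left_mono) auto
  finally have "ennreal (\<bar>f x - cell_average d f x\<bar> powr p) \<le>
      ennreal (1 / d ^ CARD('n)) * ennreal (LINT y|lborel. indicator Q y * ?g y powr p)"
    using d by (simp add: ennreal_mult'[symmetric] ennreal_leI)
  also have "ennreal (LINT y|lborel. indicator Q y * ?g y powr p) = (\<integral>\<^sup>+y. ennreal (?g y powr p) * indicator Q y \<partial>lborel)"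
    by (rule Qg(3))
  also have "\<dots> = (\<integral>\<^sup>+h. ennreal (?g (h + x) powr p) * indicator Q (h + x) \<partial>lborel)"
    by (rule nn_integral_translate[symmetric]) measurable
  also have "\<dots> \<le> (\<integral>\<^sup>+h. ennreal (\<bar>f (x + h) - f x\<bar> powr p) * indicator (box (\<chi> i. - d) (\<chi> i. d)) h \<partial>lborel)"
  proof (intro nn_integral_mono mult_mono)
    fix h :: "real ^ 'n"
    show "ennreal (?g (h + x) powr p) \<le> ennreal (\<bar>f (x + h) - f x\<bar> powr p)"
      by (simp add: abs_minus_commute add.commute)
    show "indicator Q (h + x) \<le> (indicator (box (\<chi> i. - d) (\<chi> i. d)) h :: ennreal)"
      using cell_diff_in_box[OF d, of "h + x" x] by (auto simp: indicator_def Q_def)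
  qed auto
  finally show ?thesis by (simp add: mult_left_mono)
qed

text \<open>A Poincare inequality at scale \<open>d\<close>.  In the constant, \<open>2\<^sup>n\<close> is the ratio of the volumes of the
  cube of all \<open>h\<close> and of a cell, and \<open>n d\<close> bounds the norm of \<open>h\<close>.\<close>

lemma cell_average_estimate:
  fixes f :: "real ^ 'n \<Rightarrow> real" and d p :: real
  assumes p: "1 \<le> p" and d: "d > 0" and diff: "\<And>x. f differentiable (at x)"
    and cont: "continuous_on UNIV (grad f)" and f: "\<And>x. \<bar>f x\<bar> \<le> C"
  shows "(\<integral>\<^sup>+x. ennreal (\<bar>f x - cell_average d f x\<bar> powr p) \<partial>lborel) \<le>
    ennreal (2 ^ CARD('n) * (real CARD('n) * d) powr p) * (\<integral>\<^sup>+x. ennreal (norm (grad f x) powr p) \<partial>lborel)"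
proof -
  have "continuous_on UNIV f"
    using diff by (intro continuous_at_imp_continuous_on ballI) (simp add: differentiable_imp_continuous_within)
  hence fm [measurable]: "f \<in> borel_measurable borel" by (rule borel_measurable_continuous_onI)
  let ?B = "box (\<chi> i. - d) (\<chi> i. d) :: (real ^ 'n) set"
  let ?c = "ennreal (1 / d ^ CARD('n))"
  let ?G = "\<integral>\<^sup>+x. ennreal (norm (grad f x) powr p) \<partial>lborel"
  have B: "emeasure lborel ?B = ennreal ((2 * d) ^ CARD('n))"
  proof -
    have "((\<chi> i. d) - (\<chi> i. - d) :: real ^ 'n) \<bullet> b = 2 * d \<and> ((\<chi> i. - d) :: real ^ 'n) \<bullet> b \<le> (\<chi> i. d) \<bullet> b" if "b \<in> Basis" for b
    proof -
      obtain i where "b = axis i 1" using \<open>b \<in> Basis\<close> by (auto simp: Basis_vec_def)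
      thus ?thesis using d by (simp add: inner_axis)
    qed
    thus ?thesis by (simp add: emeasure_lborel_box_eq)
  qed
  have "(\<integral>\<^sup>+x. ennreal (\<bar>f x - cell_average d f x\<bar> powr p) \<partial>lborel) \<le>
      (\<integral>\<^sup>+x. ?c * (\<integral>\<^sup>+h. ennreal (\<bar>f (x + h) - f x\<bar> powr p) * indicator ?B h \<partial>lborel) \<partial>lborel)"
    by (intro nn_integral_mono cell_average_pointwise[OF p d fm f])
  also have "\<dots> = ?c * (\<integral>\<^sup>+x. (\<integral>\<^sup>+h. ennreal (\<bar>f (x + h) - f x\<bar> powr p) * indicator ?B h \<partial>lborel) \<partial>lborel)"
    by (rule nn_integral_cmult) measurable
  also have "(\<integral>\<^sup>+x. (\<integral>\<^sup>+h. ennreal (\<bar>f (x + h) - f x\<bar> powr p) * indicator ?B h \<partial>lborel) \<partial>lborel) =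
      (\<integral>\<^sup>+h. (\<integral>\<^sup>+x. ennreal (\<bar>f (x + h) - f x\<bar> powr p) * indicator ?B h \<partial>lborel) \<partial>lborel)"
    by (rule lborel_pair.Fubini') measurable
  also have "\<dots> \<le> (\<integral>\<^sup>+h. (ennreal ((real CARD('n) * d) powr p) * ?G) * indicator ?B h \<partial>lborel)"
  proof (rule nn_integral_mono)
    fix h :: "real ^ 'n"
    have "(\<integral>\<^sup>+x. ennreal (\<bar>f (x + h) - f x\<bar> powr p) * indicator ?B h \<partial>lborel) =
        (\<integral>\<^sup>+x. ennreal (\<bar>f (x + h) - f x\<bar> powr p) \<partial>lborel) * indicator ?B h"
      by (rule nn_integral_multc) measurable
    also have "\<dots> \<le> (ennreal ((real CARD('n) * d) powr p) * ?G) * indicator ?B h"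
    proof (cases "h \<in> ?B")
      case True
      hence "\<forall>i. - d < h $ i \<and> h $ i < d" by (simp add: mem_box_cart)
      hence "\<bar>h $ i\<bar> \<le> d" for i by (smt (verit))
      hence "norm h \<le> real CARD('n) * d"
        using norm_le_l1_cart[of h] sum_bounded_above[of UNIV "\<lambda>i. \<bar>h $ i\<bar>" d] by auto
      hence "norm h powr p \<le> (real CARD('n) * d) powr p" using p by (intro powr_mono2) auto
      hence "ennreal (norm h powr p) * ?G \<le> ennreal ((real CARD('n) * d) powr p) * ?G"
        by (intro mult_right_mono ennreal_leI) auto
      thus ?thesis using translation_estimate[OF p diff cont, of h] True by simp
    qed simp
    finally show "(\<integral>\<^sup>+x. ennreal (\<bar>f (x + h) - f x\<bar> powr p) * indicator ?B h \<partial>lborel) \<le>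
        (ennreal ((real CARD('n) * d) powr p) * ?G) * indicator ?B h" .
  qed
  also have "\<dots> = (ennreal ((real CARD('n) * d) powr p) * ?G) * ennreal ((2 * d) ^ CARD('n))"
    by (subst nn_integral_cmult_indicator) (simp_all add: B)
  also have "?c * \<dots> = ennreal (1 / d ^ CARD('n) * ((real CARD('n) * d) powr p * (2 * d) ^ CARD('n))) * ?G"
  proof -
    have "ennreal (1 / d ^ CARD('n) * ((real CARD('n) * d) powr p * (2 * d) ^ CARD('n))) =
        ?c * ennreal ((real CARD('n) * d) powr p * (2 * d) ^ CARD('n))"
      using d by (intro ennreal_mult) auto
    also have "ennreal ((real CARD('n) * d) powr p * (2 * d) ^ CARD('n)) =
        ennreal ((real CARD('n) * d) powr p) * ennreal ((2 * d) ^ CARD('n))"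
      using d by (intro ennreal_mult) auto
    finally show ?thesis by (simp only: mult_ac)
  qed
  also have "1 / d ^ CARD('n) * ((real CARD('n) * d) powr p * (2 * d) ^ CARD('n)) = 2 ^ CARD('n) * (real CARD('n) * d) powr p"
    using d by (simp add: power_mult_distrib)
  finally show ?thesis by (simp add: mult_left_mono)
qed

text \<open>The average depends on \<open>x\<close> only through the index of its cell, which ranges over a countable set.\<close>

lemma cell_average_measurable: "cell_average d f \<in> borel_measurable (borel :: (real ^ 'n) measure)"
proof -
  define c where "c z = (LINT y|lborel. indicator (cell d z) y * f y) / measure lborel (cell d z)" for z
  have "cell_of d -` {z} = cell d z" for z :: "'n \<Rightarrow> int"
    by (auto simp: cell_of_def cell_def fun_eq_iff)
  hence "cell_of d \<in> borel \<rightarrow>\<^sub>M count_space (UNIV :: ('n \<Rightarrow> int) set)"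
    by (simp add: measurable_count_space_eq2_countable)
  from measurable_compose[OF this, of c borel] show ?thesis
    by (simp add: cell_average_def[abs_def] c_def)
qed

lemma integrable_cell:
  fixes f :: "real ^ 'n \<Rightarrow> real"
  assumes "integrable lborel f"
  shows "integrable lborel (\<lambda>y. indicator (cell d z) y * f y)"
  using integrable_mult_indicator[OF _ assms, of "cell d z"] by simp

lemma cell_integral_bound:
  fixes f :: "real ^ 'n \<Rightarrow> real"
  assumes "integrable lborel f"
  shows "\<bar>LINT y|lborel. indicator (cell d z) y * f y\<bar> \<le> (LINT y|lborel. \<bar>f y\<bar>)"
proof -
  have "\<bar>LINT y|lborel. indicator (cell d z) y * f y\<bar> \<le> (LINT y|lborel. \<bar>indicator (cell d z) y * f y\<bar>)"
    by (rule integral_abs_bound)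
  also have "\<dots> \<le> (LINT y|lborel. \<bar>f y\<bar>)"
    using integrable_cell[OF assms, of d z] assms by (intro integral_mono) (auto simp: indicator_def)
  finally show ?thesis .
qed

lemma cell_average_bound:
  fixes f :: "real ^ 'n \<Rightarrow> real"
  assumes f: "integrable lborel f" and d: "d > 0"
  shows "\<bar>cell_average d f x\<bar> \<le> (LINT y|lborel. \<bar>f y\<bar>) / d ^ CARD('n)"
proof -
  have "0 < d ^ CARD('n)" using d by simp
  thus ?thesis
    unfolding cell_average_def using cell_integral_bound[OF f, of d "cell_of d x"] cell_measure(2)[OF d, of "cell_of d x"]
    by (simp only: abs_divide) (rule frac_le, auto)
qed

lemma cell_average_diff:
  fixes f g :: "real ^ 'n \<Rightarrow> real"
  assumes "integrable lborel f" "integrable lborel g"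
  shows "cell_average d (\<lambda>x. f x - g x) x = cell_average d f x - cell_average d g x"
  using integrable_cell[OF assms(1), of d "cell_of d x"] integrable_cell[OF assms(2), of d "cell_of d x"]
  by (simp add: cell_average_def right_diff_distrib diff_divide_distrib)

section \<open>The compactness theorem of Rellich\<close>

context bounded_open_domain
begin

lemma test_function_diff:
  assumes "\<phi> \<in> test_functions \<Omega>" "\<psi> \<in> test_functions \<Omega>"
  shows "(\<lambda>x. \<phi> x - \<psi> x) \<in> test_functions \<Omega>" "grad (\<lambda>x. \<phi> x - \<psi> x) = (\<lambda>x. grad \<phi> x - grad \<psi> x)"
  using test_function_linear_combination[OF assms, of 1 "- 1"] by (auto simp: fun_eq_iff)

lemma test_function_integrable_lborel:
  assumes "\<phi> \<in> test_functions \<Omega>"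
  shows "integrable lborel \<phi>"
  using test_function_support[OF assms] integrable_continuous_compact_support[OF test_function_continuous[OF assms]]
  by metis

lemma test_function_L1_bound:
  assumes "\<phi> \<in> test_functions \<Omega>"
  shows "(LINT x|lborel. \<bar>\<phi> x\<bar>) \<le> measure lebesgue \<Omega> + modular \<phi>"
proof -
  obtain K where K: "K \<subseteq> \<Omega>" "\<And>x. x \<notin> K \<Longrightarrow> \<phi> x = 0"
    using test_function_support[OF assms] by metis
  have "(LINT x|M. \<bar>\<phi> x\<bar>) = (LINT x|lborel. \<bar>\<phi> x\<bar>)"
    using K test_function_measurable(1)[OF assms] by (intro integral_M_eq_lborel) auto
  thus ?thesis using L1_le_modular[OF test_function_Lp(1)[OF assms], of 1] by simp
qed

lemma nn_integral_lborel_eq_modular: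
  fixes f :: "real ^ 'n \<Rightarrow> 'b::euclidean_space"
  assumes f: "continuous_on UNIV f" and K: "compact K" "K \<subseteq> \<Omega>" "\<And>x. x \<notin> K \<Longrightarrow> f x = 0"
  shows "(\<integral>\<^sup>+x. ennreal (norm (f x) powr p) \<partial>lborel) = ennreal (modular f)"
proof -
  have cont: "continuous_on UNIV (\<lambda>x. norm (f x) powr p)"
    using p by (intro continuous_on_powr' continuous_intros f) auto
  have zero: "norm (f x) powr p = 0" if "x \<notin> K" for x using K(3)[OF that] by simp
  have "integrable lborel (\<lambda>x. norm (f x) powr p)"
    by (rule integrable_continuous_compact_support[OF cont K(1) zero])
  hence "(\<integral>\<^sup>+x. ennreal (norm (f x) powr p) \<partial>lborel) = ennreal (LINT x|lborel. norm (f x) powr p)"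
    by (intro nn_integral_eq_integral) auto
  also have "(LINT x|lborel. norm (f x) powr p) = modular f"
    unfolding modular_def
  proof (rule integral_M_eq_lborel[symmetric])
    show "(\<lambda>x. norm (f x) powr p) \<in> borel_measurable borel"
      using cont by (rule borel_measurable_continuous_onI)
    show "norm (f x) powr p = 0" if "x \<notin> \<Omega>" for x using that K(2) by (intro zero) blast
  qed
  finally show ?thesis .
qed

lemma cell_average_Lp:
  assumes "\<phi> \<in> test_functions \<Omega>" "d > 0"
  shows "cell_average d \<phi> \<in> Lp p \<Omega>"
  using cell_average_bound[OF test_function_integrable_lborel[OF assms(1)] assms(2)]
  by (intro Lp_bounded borel_measurable_M cell_average_measurable) simp

lemma modular_cell_average_estimate:
  assumes \<phi>: "\<phi> \<in> test_functions \<Omega>" and d: "d > 0"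
  shows "modular (\<lambda>x. \<phi> x - cell_average d \<phi> x) \<le>
    2 ^ CARD('n) * (real CARD('n) * d) powr p * modular (grad \<phi>)"
proof -
  let ?f = "\<lambda>x. \<phi> x - cell_average d \<phi> x"
  let ?C = "2 ^ CARD('n) * (real CARD('n) * d) powr p"
  have f: "?f \<in> Lp p \<Omega>" by (intro Lp_diff test_function_Lp cell_average_Lp assms)
  obtain C where C: "\<And>x. \<bar>\<phi> x\<bar> \<le> C" using test_function_bounded[OF \<phi>] by (metis real_norm_def)
  obtain K where K: "compact K" "K \<subseteq> \<Omega>" "\<And>x. x \<notin> K \<Longrightarrow> grad \<phi> x = 0"
    using test_function_support[OF \<phi>] by metis
  have "ennreal (modular ?f) = (\<integral>\<^sup>+x. ennreal (\<bar>?f x\<bar> powr p) \<partial>M)"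
    unfolding modular_def using Lp_integrable[OF f] by (subst nn_integral_eq_integral) auto
  also have "\<dots> = (\<integral>\<^sup>+x. ennreal (\<bar>?f x\<bar> powr p) * indicator \<Omega> x \<partial>lborel)"
    by (simp add: nn_integral_restrict_space nn_integral_completion)
  also have "\<dots> \<le> (\<integral>\<^sup>+x. ennreal (\<bar>?f x\<bar> powr p) \<partial>lborel)"
    by (intro nn_integral_mono) (auto simp: indicator_def)
  also have "\<dots> \<le> ennreal ?C * (\<integral>\<^sup>+x. ennreal (norm (grad \<phi> x) powr p) \<partial>lborel)"
    by (rule cell_average_estimate[OF _ d test_function_differentiable[OF \<phi>] test_function_grad_continuous[OF \<phi>] C])
      (use p in simp)
  also have "(\<integral>\<^sup>+x. ennreal (norm (grad \<phi> x) powr p) \<partial>lborel) = ennreal (modular (grad \<phi>))"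
    by (rule nn_integral_lborel_eq_modular[OF test_function_grad_continuous[OF \<phi>] K])
  also have "ennreal ?C * ennreal (modular (grad \<phi>)) = ennreal (?C * modular (grad \<phi>))"
    by (rule ennreal_mult[symmetric]) (auto simp: modular_nonneg)
  finally show ?thesis
    by (subst (asm) ennreal_le_iff) (auto simp: modular_nonneg)
qed

lemma modular_tendsto_0_bounded_pointwise:
  fixes f :: "nat \<Rightarrow> real ^ 'n \<Rightarrow> real"
  assumes m: "\<And>k. f k \<in> borel_measurable M" and b: "\<And>k x. \<bar>f k x\<bar> \<le> C" and lim: "\<And>x. (\<lambda>k. f k x) \<longlonglongrightarrow> g x"
  shows "g \<in> Lp p \<Omega>" "(\<lambda>k. modular (\<lambda>x. f k x - g x)) \<longlonglongrightarrow> 0"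
proof -
  have gm: "g \<in> borel_measurable M" by (rule borel_measurable_LIMSEQ_real[OF lim m])
  have gb: "\<bar>g x\<bar> \<le> C" for x
    by (rule tendsto_upperbound[OF tendsto_rabs[OF lim]]) (use b in auto)
  show "g \<in> Lp p \<Omega>" using gm gb by (intro Lp_bounded) auto
  have "(\<lambda>k. LINT x|M. norm (f k x - g x) powr p) \<longlonglongrightarrow> (LINT x|M. 0)"
  proof (rule integral_dominated_convergence)
    show "integrable M (\<lambda>_. (2 * C) powr p)" by simp
    show "(\<lambda>x. norm (f k x - g x) powr p) \<in> borel_measurable M" for k using m gm by simp
    show "AE x in M. (\<lambda>k. norm (f k x - g x) powr p) \<longlonglongrightarrow> 0"
    proof (rule AE_I2)
      fix x
      have "(\<lambda>k. norm (f k x - g x) powr p) \<longlonglongrightarrow> norm (g x - g x) powr p"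
        using p by (intro tendsto_powr' tendsto_intros lim) auto
      thus "(\<lambda>k. norm (f k x - g x) powr p) \<longlonglongrightarrow> 0" by simp
    qed
    show "AE x in M. norm (norm (f k x - g x) powr p) \<le> (2 * C) powr p" for k
    proof (rule AE_I2)
      fix x
      have "\<bar>f k x - g x\<bar> \<le> 2 * C" using b[of k x] gb[of x] by linarith
      thus "norm (norm (f k x - g x) powr p) \<le> (2 * C) powr p" using p by (simp add: powr_mono2)
    qed
  qed simp
  thus "(\<lambda>k. modular (\<lambda>x. f k x - g x)) \<longlonglongrightarrow> 0" by (simp add: modular_def)
qed

lemma Cauchy_Lp_close:
  fixes f g :: "nat \<Rightarrow> real ^ 'n \<Rightarrow> 'b::euclidean_space"
  assumes "\<And>k. f k \<in> Lp p \<Omega>" "\<And>k. g k \<in> Lp p \<Omega>" "Cauchy_Lp f"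
    and "(\<lambda>k. modular (\<lambda>x. f k x - g k x)) \<longlonglongrightarrow> 0"
  shows "Cauchy_Lp g"
proof -
  obtain h where h: "h \<in> Lp p \<Omega>" "(\<lambda>k. modular (\<lambda>x. f k x - h x)) \<longlonglongrightarrow> 0"
    using Lp_complete[OF assms(1,3)] by blast
  have "(\<lambda>k. modular (\<lambda>x. h x - g k x)) \<longlonglongrightarrow> 0"
    by (rule modular_tendsto_trans[OF h(1) assms(1,2) h(2) assms(4)])
  thus ?thesis using h(1) assms(2) by (intro Cauchy_Lp_convergent) (auto simp: modular_minus_commute[of _ h])
qed

text \<open>The integrals of the \<open>\<phi>\<^sub>k\<close> over the cells of all grids of side \<open>1/(j+1)\<close> form a countable family of
  bounded sequences, so a subsequence makes all of them converge.  For a fixed grid the averages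
  then converge pointwise and boundedly, hence in \<open>L\<^sup>p\<close>, while the distance of \<open>\<phi>\<^sub>k\<close> from its
  averages is small uniformly in \<open>k\<close> when the grid is fine.\<close>

lemma rellich_test_functions:
  assumes \<phi>: "\<And>k::nat. \<phi> k \<in> test_functions \<Omega>"
    and bounded: "\<And>k. modular (\<phi> k) \<le> P" "\<And>k. modular (grad (\<phi> k)) \<le> L"
  obtains r :: "nat \<Rightarrow> nat" where "strict_mono r" "Cauchy_Lp (\<lambda>k. \<phi> (r k))"
proof -
  define B where "B = measure lebesgue \<Omega> + P"
  define I where "I k = (\<lambda>(j::nat, z). LINT y|lborel. indicator (cell (1 / real (Suc j)) z) y * \<phi> k y)" for k
  have L1: "(LINT y|lborel. \<bar>\<phi> k y\<bar>) \<le> B" for k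
    using test_function_L1_bound[OF \<phi>, of k] bounded(1)[of k] by (simp add: B_def)
  have bnd: "norm (I k jz) \<le> B" for k jz
    using order.trans[OF cell_integral_bound[OF test_function_integrable_lborel[OF \<phi>]] L1]
    by (auto simp: I_def split: prod.split)
  obtain r where r: "strict_mono (r :: nat \<Rightarrow> nat)" "\<And>jz. jz \<in> UNIV \<Longrightarrow> \<exists>l. (\<lambda>k. I (r k) jz) \<longlonglongrightarrow> l"
    using function_convergent_subsequence[OF countableI_type[of UNIV], of I B, OF bnd] by blast
  have "Cauchy_Lp (\<lambda>k. \<phi> (r k))"
    unfolding Cauchy_Lp_def
  proof (intro allI impI)
    fix e :: real assume "e > 0"
    define e' where "e' = e / (2 * 2 powr p)"
    have e': "e' > 0" "2 powr p * (e' + e') = e" using \<open>e > 0\<close> by (simp_all add: e'_def)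
    have "(\<lambda>j. 2 ^ CARD('n) * (real CARD('n) * (1 / real (Suc j))) powr p * (2 powr p * (L + L))) \<longlonglongrightarrow>
        2 ^ CARD('n) * (real CARD('n) * 0) powr p * (2 powr p * (L + L))"
      using p LIMSEQ_inverse_real_of_nat
      by (intro tendsto_mult tendsto_const tendsto_powr') (auto simp: inverse_eq_divide)
    hence "(\<lambda>j. 2 ^ CARD('n) * (real CARD('n) * (1 / real (Suc j))) powr p * (2 powr p * (L + L))) \<longlonglongrightarrow> 0"
      using p by simp
    from order_tendstoD(2)[OF this e'(1)] obtain j where
      j: "2 ^ CARD('n) * (real CARD('n) * (1 / real (Suc j))) powr p * (2 powr p * (L + L)) < e'"
      by (auto simp: eventually_sequentially)
    define d where "d = 1 / real (Suc j)"
    have "d > 0" by (simp add: d_def)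
    let ?T = "\<lambda>k. cell_average d (\<phi> (r k))"
    have conv: "\<exists>l. (\<lambda>k. ?T k x) \<longlonglongrightarrow> l" for x
    proof -
      obtain l where "(\<lambda>k. I (r k) (j, cell_of d x)) \<longlonglongrightarrow> l" using r(2)[OF UNIV_I] by blast
      moreover have "0 < d ^ CARD('n)" using \<open>d > 0\<close> by simp
      hence "measure lborel (cell d (cell_of d x)) \<noteq> 0"
        using cell_measure(2)[OF \<open>d > 0\<close>, of "cell_of d x"] by linarith
      ultimately have "(\<lambda>k. I (r k) (j, cell_of d x) / measure lborel (cell d (cell_of d x))) \<longlonglongrightarrow>
          l / measure lborel (cell d (cell_of d x))"
        by (intro tendsto_divide tendsto_const)
      moreover have "I (r k) (j, cell_of d x) / measure lborel (cell d (cell_of d x)) = ?T k x" for k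
        by (simp only: I_def prod.case cell_average_def d_def)
      ultimately have "(\<lambda>k. ?T k x) \<longlonglongrightarrow> l / measure lborel (cell d (cell_of d x))" by (simp only:)
      thus ?thesis by blast
    qed
    define \<tau> where "\<tau> x = lim (\<lambda>k. ?T k x)" for x
    have \<tau>: "(\<lambda>k. ?T k x) \<longlonglongrightarrow> \<tau> x" for x
      using conv[of x] unfolding \<tau>_def by (simp add: convergent_def[symmetric] convergent_LIMSEQ_iff[symmetric])
    have Tm: "?T k \<in> borel_measurable M" for k by (intro borel_measurable_M cell_average_measurable)
    have Tb: "\<bar>?T k x\<bar> \<le> B / d ^ CARD('n)" for k x
      using cell_average_bound[OF test_function_integrable_lborel[OF \<phi>] \<open>d > 0\<close>, of "r k" x]
        divide_right_mono[OF L1[of "r k"], of "d ^ CARD('n)"] \<open>d > 0\<close> by simp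
    have TLp: "?T k \<in> Lp p \<Omega>" for k by (rule cell_average_Lp[OF \<phi> \<open>d > 0\<close>])
    have "Cauchy_Lp ?T"
      using modular_tendsto_0_bounded_pointwise[OF Tm Tb \<tau>] TLp by (intro Cauchy_Lp_convergent)
    then obtain N where N: "\<forall>i\<ge>N. \<forall>k\<ge>N. modular (\<lambda>x. ?T i x - ?T k x) < e'"
      using Cauchy_LpD e'(1) by blast
    show "\<exists>N. \<forall>i\<ge>N. \<forall>k\<ge>N. modular (\<lambda>x. \<phi> (r i) x - \<phi> (r k) x) < e"
    proof (intro exI allI impI)
      fix i k assume ik: "N \<le> i" "N \<le> k"
      let ?f = "\<lambda>x. \<phi> (r i) x - \<phi> (r k) x"
      note f = test_function_diff[OF \<phi>[of "r i"] \<phi>[of "r k"]]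
      have T: "cell_average d ?f = (\<lambda>x. ?T i x - ?T k x)"
        by (rule ext) (intro cell_average_diff test_function_integrable_lborel \<phi>)
      have "modular (grad ?f) \<le> 2 powr p * (modular (grad (\<phi> (r i))) + modular (grad (\<phi> (r k))))"
        unfolding f(2) by (intro modular_diff_le test_function_Lp \<phi>)
      also have "\<dots> \<le> 2 powr p * (L + L)"
        using bounded(2) by (intro mult_left_mono add_mono) auto
      finally have G: "modular (grad ?f) \<le> 2 powr p * (L + L)" .
      have "modular (\<lambda>x. ?f x - cell_average d ?f x) \<le> 2 ^ CARD('n) * (real CARD('n) * d) powr p * modular (grad ?f)"
        by (rule modular_cell_average_estimate[OF f(1) \<open>d > 0\<close>])
      also have "\<dots> \<le> 2 ^ CARD('n) * (real CARD('n) * d) powr p * (2 powr p * (L + L))"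
        using G by (intro mult_left_mono) auto
      also have "\<dots> < e'" using j by (simp only: d_def)
      finally have 1: "modular (\<lambda>x. ?f x - cell_average d ?f x) < e'" .
      have 2: "modular (cell_average d ?f) < e'" unfolding T using N ik by blast
      have "modular ?f = modular (\<lambda>x. (?f x - cell_average d ?f x) + cell_average d ?f x)" by simp
      also have "\<dots> \<le> 2 powr p * (modular (\<lambda>x. ?f x - cell_average d ?f x) + modular (cell_average d ?f))"
        by (intro modular_add_le Lp_diff[OF test_function_Lp(1)[OF f(1)]] cell_average_Lp f(1) \<open>d > 0\<close>)
      also have "\<dots> < 2 powr p * (e' + e')"
        using 1 2 by (intro mult_strict_left_mono add_strict_mono) auto
      finally show "modular ?f < e" using e'(2) by simp
    qed
  qed
  thus thesis using r(1) that by blast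
qed

text \<open>Approximating each \<open>u k\<close> by a test function, with errors that tend to zero, reduces the claim to test
  functions.\<close>

lemma rellich:
  assumes W: "\<And>k::nat. W0_pair (u k) (g k)"
    and bounded: "\<And>k. modular (u k) \<le> P" "\<And>k. modular (g k) \<le> L"
  obtains r :: "nat \<Rightarrow> nat" where "strict_mono r" "Cauchy_Lp (\<lambda>k. u (r k))"
proof -
  obtain \<phi> where \<phi>: "\<And>k. \<phi> k \<in> test_functions \<Omega>"
    "\<And>k. modular (\<lambda>x. u k x - \<phi> k x) < inverse (real (Suc k))"
    "\<And>k. modular (\<lambda>x. g k x - grad (\<phi> k) x) < inverse (real (Suc k))"
    using W0_pair_approx_sequence[of u g, OF W] by blast
  have bd: "modular \<psi> \<le> 2 powr p * (B + 1)"
    if "f \<in> Lp p \<Omega>" "\<psi> \<in> Lp p \<Omega>" "modular f \<le> B" "modular (\<lambda>x. f x - \<psi> x) < inverse (real (Suc k))"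
    for f \<psi> :: "real ^ 'n \<Rightarrow> 'b::euclidean_space" and B k
  proof -
    have "modular (\<lambda>x. f x - (f x - \<psi> x)) \<le> 2 powr p * (modular f + modular (\<lambda>x. f x - \<psi> x))"
      by (intro modular_diff_le Lp_diff[OF that(1,2)] that(1))
    also have "\<dots> \<le> 2 powr p * (B + 1)"
    proof (intro mult_left_mono add_mono that(3))
      have "inverse (real (Suc k)) \<le> 1" by (simp add: inverse_le_1_iff)
      thus "modular (\<lambda>x. f x - \<psi> x) \<le> 1" using that(4) by linarith
    qed auto
    finally show ?thesis by simp
  qed
  obtain r where r: "strict_mono (r :: nat \<Rightarrow> nat)" "Cauchy_Lp (\<lambda>k. \<phi> (r k))"
  proof (rule rellich_test_functions[of \<phi>, OF \<phi>(1)])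
    show "modular (\<phi> k) \<le> 2 powr p * (P + 1)" for k
      by (rule bd[OF W0_pair_Lp(1)[OF W] test_function_Lp(1)[OF \<phi>(1)] bounded(1) \<phi>(2)])
    show "modular (grad (\<phi> k)) \<le> 2 powr p * (L + 1)" for k
      by (rule bd[OF W0_pair_Lp(2)[OF W] test_function_Lp(2)[OF \<phi>(1)] bounded(2) \<phi>(3)])
  qed blast
  have "(\<lambda>k. modular (\<lambda>x. u k x - \<phi> k x)) \<longlonglongrightarrow> 0"
    by (rule tendsto_0_of_less_inverse[OF modular_nonneg \<phi>(2)])
  hence "(\<lambda>k. modular (\<lambda>x. \<phi> (r k) x - u (r k) x)) \<longlonglongrightarrow> 0"
    using LIMSEQ_subseq_LIMSEQ[OF _ r(1)] by (simp add: o_def modular_minus_commute[of "\<phi> _"])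
  moreover have "\<phi> (r k) \<in> Lp p \<Omega>" "u (r k) \<in> Lp p \<Omega>" for k
    by (rule test_function_Lp(1)[OF \<phi>(1)], rule W0_pair_Lp(1)[OF W])
  ultimately have "Cauchy_Lp (\<lambda>k. u (r k))"
    using r(2) by (intro Cauchy_Lp_close[where f = "\<lambda>k. \<phi> (r k)" and g = "\<lambda>k. u (r k)"])
  thus thesis using r(1) that by blast
qed

end

section \<open>Homogeneous nonlinearities in integrals\<close>

context bounded_open_domain
begin

lemma integrable_inner_homogeneous:
  fixes A :: "'b::euclidean_space \<Rightarrow> 'b"
  assumes A: "pos_homogeneous (p - 1) A" "continuous_on UNIV A" and f: "f \<in> Lp p \<Omega>" "g \<in> Lp p \<Omega>"
  shows "integrable M (\<lambda>x. A (f x) \<bullet> g x)"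
proof -
  have "continuous_on UNIV (\<lambda>w::'b \<times> 'b. A (fst w) \<bullet> snd w)"
    by (intro continuous_intros continuous_on_compose2[OF A(2)]) auto
  moreover have "pos_homogeneous p (\<lambda>w::'b \<times> 'b. A (fst w) \<bullet> snd w)"
    by (intro pos_homogeneous_inner pos_homogeneous_compose_linear[OF A(1)]) (auto intro: linearI)
  ultimately have "integrable M (\<lambda>x. (\<lambda>w. A (fst w) \<bullet> snd w) (f x, g x))"
    by (intro homogeneous_integrable Lp_Pair(1) f)
  thus ?thesis by simp
qed

text \<open>The comparison principle for \<open>h = \<bar>\<langle>A x - A y, z\<rangle>\<bar>\<close> and \<open>D = \<bar>x - y\<bar>\<^sup>p\<close>, in place of a
  dominated convergence argument along almost everywhere convergent subsequences.\<close>

lemma integral_inner_homogeneous_tendsto: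
  fixes A :: "'b::euclidean_space \<Rightarrow> 'b"
  assumes A: "pos_homogeneous (p - 1) A" "continuous_on UNIV A"
    and f: "\<And>k. f k \<in> Lp p \<Omega>" "f' \<in> Lp p \<Omega>" "g \<in> Lp p \<Omega>"
    and lim: "(\<lambda>k. modular (\<lambda>x. f k x - f' x)) \<longlonglongrightarrow> 0"
  shows "(\<lambda>k. LINT x|M. A (f k x) \<bullet> g x) \<longlonglongrightarrow> (LINT x|M. A (f' x) \<bullet> g x)"
proof (rule LIMSEQ_I)
  fix e :: real assume "e > 0"
  define h where "h w = \<bar>(A (fst (fst w)) - A (snd (fst w))) \<bullet> snd w\<bar>" for w :: "('b \<times> 'b) \<times> 'b"
  define D where "D w = norm (fst (fst w) - snd (fst w)) powr p" for w :: "('b \<times> 'b) \<times> 'b"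
  have hom: "pos_homogeneous p h" "pos_homogeneous p D"
    unfolding h_def D_def
    by (intro pos_homogeneous_abs pos_homogeneous_inner pos_homogeneous_diff pos_homogeneous_norm_powr
        pos_homogeneous_compose_linear[OF A(1)] linearI; simp add: algebra_simps)+
  have cont: "continuous_on UNIV h" "continuous_on UNIV D"
    unfolding h_def D_def using p
    by (intro continuous_intros continuous_on_compose2[OF A(2)] continuous_on_powr'; auto)+
  have zero: "h w = 0" if "D w = 0" for w using that by (simp add: h_def D_def)
  obtain S where S: "\<And>k. modular (\<lambda>x. f k x - f' x) \<le> S"
    using convergent_imp_Bseq[OF convergentI[OF lim]] unfolding Bseq_def by (auto simp: modular_nonneg)
  define R where "R = 2 powr p * (2 powr p * (2 powr p * (S + modular f') + modular f') + modular g)"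
  have F: "(\<lambda>x. ((f k x, f' x), g x)) \<in> Lp p \<Omega> \<and> modular (\<lambda>x. ((f k x, f' x), g x)) \<le> R" for k
  proof -
    have "modular (\<lambda>x. (f k x - f' x) + f' x) \<le> 2 powr p * (modular (\<lambda>x. f k x - f' x) + modular f')"
      by (intro modular_add_le Lp_diff[OF f(1,2)] f(2))
    also have "\<dots> \<le> 2 powr p * (S + modular f')"
      by (intro mult_left_mono add_right_mono S) simp
    finally have 1: "modular (f k) \<le> 2 powr p * (S + modular f')" by simp
    have 2: "modular (\<lambda>x. (f k x, f' x)) \<le> 2 powr p * (2 powr p * (S + modular f') + modular f')"
      by (rule order.trans[OF Lp_Pair(2)[OF f(1,2)]]) (use 1 in \<open>auto intro!: mult_left_mono\<close>)
    have "modular (\<lambda>x. ((f k x, f' x), g x)) \<le> R"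
      unfolding R_def
      by (rule order.trans[OF Lp_Pair(2)[OF Lp_Pair(1)[OF f(1,2)] f(3)]]) (use 2 in \<open>auto intro!: mult_left_mono\<close>)
    thus ?thesis using Lp_Pair(1)[OF Lp_Pair(1)[OF f(1,2)] f(3)] by blast
  qed
  obtain d where d: "d > 0" "\<And>w. w \<in> Lp p \<Omega> \<Longrightarrow> modular w \<le> R \<Longrightarrow> (LINT x|M. D (w x)) < d \<Longrightarrow> (LINT x|M. h (w x)) < e"
    by (rule homogeneous_comparison_integral[OF hom cont _ zero \<open>e > 0\<close>, of R]) (auto simp: D_def)
  obtain N where N: "\<And>k. k \<ge> N \<Longrightarrow> modular (\<lambda>x. f k x - f' x) < d"
    using order_tendstoD(2)[OF lim d(1)] by (auto simp: eventually_sequentially)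
  show "\<exists>N. \<forall>k\<ge>N. norm ((LINT x|M. A (f k x) \<bullet> g x) - (LINT x|M. A (f' x) \<bullet> g x)) < e"
  proof (intro exI allI impI)
    fix k assume "k \<ge> N"
    have i: "integrable M (\<lambda>x. A (f k x) \<bullet> g x)" "integrable M (\<lambda>x. A (f' x) \<bullet> g x)"
      by (intro integrable_inner_homogeneous A f)+
    have "norm ((LINT x|M. A (f k x) \<bullet> g x) - (LINT x|M. A (f' x) \<bullet> g x)) =
        \<bar>LINT x|M. A (f k x) \<bullet> g x - A (f' x) \<bullet> g x\<bar>"
      using i by simp
    also have "\<dots> \<le> (LINT x|M. \<bar>A (f k x) \<bullet> g x - A (f' x) \<bullet> g x\<bar>)" by (rule integral_abs_bound)
    also have "\<dots> = (LINT x|M. h ((f k x, f' x), g x))" by (simp add: h_def inner_diff_left)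
    also have "\<dots> < e"
      using F[of k] N[OF \<open>k \<ge> N\<close>] by (intro d(2)) (auto simp: D_def modular_def)
    finally show "norm ((LINT x|M. A (f k x) \<bullet> g x) - (LINT x|M. A (f' x) \<bullet> g x)) < e" .
  qed
qed

text \<open>The comparison principle for \<open>h = \<bar>\<langle>A x, z\<rangle>\<bar>\<close> and \<open>D = \<bar>z\<bar>\<^sup>p\<close>; it plays the role of Hoelder's inequality.\<close>

lemma integral_abs_inner_homogeneous_small:
  fixes A :: "'b::euclidean_space \<Rightarrow> 'b"
  assumes A: "pos_homogeneous (p - 1) A" "continuous_on UNIV A" and "e > 0"
  obtains d where "d > 0" "\<And>f g. f \<in> Lp p \<Omega> \<Longrightarrow> g \<in> Lp p \<Omega> \<Longrightarrow> modular f \<le> R \<Longrightarrow> modular g < d \<Longrightarrow>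
    \<bar>LINT x|M. A (f x) \<bullet> g x\<bar> < e"
proof -
  define h where "h w = \<bar>A (fst w) \<bullet> snd w\<bar>" for w :: "'b \<times> 'b"
  define D where "D w = norm (snd w) powr p" for w :: "'b \<times> 'b"
  have hom: "pos_homogeneous p h" "pos_homogeneous p D"
    unfolding h_def D_def
    by (intro pos_homogeneous_abs pos_homogeneous_inner pos_homogeneous_norm_powr
        pos_homogeneous_compose_linear[OF A(1)] linearI; simp add: algebra_simps)+
  have cont: "continuous_on UNIV h" "continuous_on UNIV D"
    unfolding h_def D_def using p
    by (intro continuous_intros continuous_on_compose2[OF A(2)] continuous_on_powr'; auto)+
  have zero: "h w = 0" if "D w = 0" for w using that by (simp add: h_def D_def)
  obtain d where d: "d > 0" "\<And>w. w \<in> Lp p \<Omega> \<Longrightarrow> modular w \<le> 2 powr p * (R + 1) \<Longrightarrow>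
      (LINT x|M. D (w x)) < d \<Longrightarrow> (LINT x|M. h (w x)) < e"
    by (rule homogeneous_comparison_integral[OF hom cont _ zero \<open>e > 0\<close>, of "2 powr p * (R + 1)"]) (auto simp: D_def)
  show thesis
  proof (rule that[of "min d 1"])
    fix f g :: "real ^ 'n \<Rightarrow> 'b"
    assume f: "f \<in> Lp p \<Omega>" "g \<in> Lp p \<Omega>" "modular f \<le> R" "modular g < min d 1"
    have "\<bar>LINT x|M. A (f x) \<bullet> g x\<bar> \<le> (LINT x|M. \<bar>A (f x) \<bullet> g x\<bar>)" by (rule integral_abs_bound)
    also have "\<dots> = (LINT x|M. h (f x, g x))" by (simp add: h_def)
    also have "\<dots> < e"
    proof (rule d(2)[OF Lp_Pair(1)[OF f(1,2)]])
      show "modular (\<lambda>x. (f x, g x)) \<le> 2 powr p * (R + 1)"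
        by (rule order.trans[OF Lp_Pair(2)[OF f(1,2)]]) (use f(3,4) in \<open>auto intro!: mult_left_mono\<close>)
      show "(LINT x|M. D (f x, g x)) < d" using f(4) by (simp add: D_def modular_def)
    qed
    finally show "\<bar>LINT x|M. A (f x) \<bullet> g x\<bar> < e" .
  qed (use d(1) in simp)
qed

end

section \<open>The flux of an anisotropic norm\<close>

locale admissible_norm =
  fixes F :: "real ^ 'n \<Rightarrow> real" and p a :: real
  assumes p: "1 < p"
    and F_nonneg: "\<And>\<xi>. 0 \<le> F \<xi>"
    and F_scale: "\<And>t \<xi>. F (t *\<^sub>R \<xi>) = \<bar>t\<bar> * F \<xi>"
    and a: "a > 0" and F_ge: "\<And>\<xi>. a * norm \<xi> \<le> F \<xi>"
    and F_C2: "Ck_on 2 F (- {0})"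
    and hessian_pos: "\<And>\<xi>. \<xi> \<noteq> 0 \<Longrightarrow> positive_definite (hessian (\<lambda>\<eta>. F \<eta> powr p) \<xi>)"
begin

abbreviation "A \<equiv> flux F p"

lemma F_pos: "\<xi> \<noteq> 0 \<Longrightarrow> F \<xi> > 0"
  using F_ge[of \<xi>] a by (smt (verit) mult_pos_pos zero_less_norm_iff)

lemma F_differentiable: "\<xi> \<noteq> 0 \<Longrightarrow> F differentiable (at \<xi>)"
  using F_C2 by (simp add: numeral_2_eq_2)

lemma grad_F_differentiable: "\<xi> \<noteq> 0 \<Longrightarrow> grad F differentiable (at \<xi>)"
  using F_C2 unfolding differentiable_componentwise_within[of "grad F"] by (auto simp: numeral_2_eq_2 Basis_vec_def inner_axis)

lemma F_derivative: "\<xi> \<noteq> 0 \<Longrightarrow> (F has_derivative (\<lambda>v. grad F \<xi> \<bullet> v)) (at \<xi>)"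
  by (intro has_derivative_grad F_differentiable)

text \<open>The two ways of differentiating \<open>F(t \<eta>) = t F(\<eta>)\<close> in \<open>\<eta>\<close>.\<close>

lemma grad_F_scale:
  assumes "t > 0" "\<xi> \<noteq> 0"
  shows "grad F (t *\<^sub>R \<xi>) = grad F \<xi>"
proof -
  have "((\<lambda>\<eta>. F (t *\<^sub>R \<eta>)) has_derivative (\<lambda>v. grad F (t *\<^sub>R \<xi>) \<bullet> (t *\<^sub>R v))) (at \<xi>)"
    using assms by (intro has_derivative_compose[OF _ F_derivative, of "\<lambda>\<eta>. t *\<^sub>R \<eta>"] has_derivative_scaleR_right has_derivative_ident) auto
  moreover have "((\<lambda>\<eta>. F (t *\<^sub>R \<eta>)) has_derivative (\<lambda>v. t * (grad F \<xi> \<bullet> v))) (at \<xi>)"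
    unfolding F_scale using assms by (auto intro!: derivative_eq_intros F_derivative)
  ultimately have "(\<lambda>v. grad F (t *\<^sub>R \<xi>) \<bullet> (t *\<^sub>R v)) = (\<lambda>v. t * (grad F \<xi> \<bullet> v))"
    by (rule has_derivative_unique)
  hence "grad F (t *\<^sub>R \<xi>) \<bullet> v = grad F \<xi> \<bullet> v" for v
    using assms(1) by (auto simp: fun_eq_iff)
  thus ?thesis using vector_eq_rdot by blast
qed

text \<open>Euler's identity: differentiate \<open>F(t \<xi>) = t F(\<xi>)\<close> in \<open>t\<close> at \<open>1\<close>.\<close>

lemma euler_F:
  assumes "\<xi> \<noteq> 0"
  shows "grad F \<xi> \<bullet> \<xi> = F \<xi>"
proof -
  have "((\<lambda>t. F (t *\<^sub>R \<xi>)) has_derivative (\<lambda>s. grad F (1 *\<^sub>R \<xi>) \<bullet> (s *\<^sub>R \<xi>))) (at 1)"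
    using assms by (intro has_derivative_compose[OF _ F_derivative, of "\<lambda>t. t *\<^sub>R \<xi>"] has_derivative_scaleR_left has_derivative_ident) auto
  moreover have "((\<lambda>t. F (t *\<^sub>R \<xi>)) has_derivative (\<lambda>s. s * F \<xi>)) (at 1)"
  proof -
    have "((\<lambda>t::real. t * F \<xi>) has_derivative (\<lambda>s. s * F \<xi>)) (at 1)"
      by (auto intro!: derivative_eq_intros)
    thus ?thesis
      by (rule has_derivative_transform_within_open[of _ _ _ _ "{0<..}"]) (auto simp: F_scale)
  qed
  ultimately have "(\<lambda>s. grad F (1 *\<^sub>R \<xi>) \<bullet> (s *\<^sub>R \<xi>)) = (\<lambda>s. s * F \<xi>)"
    by (rule has_derivative_unique)
  from fun_cong[OF this, of 1] show ?thesis by simp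
qed

lemma flux_homogeneous: "pos_homogeneous (p - 1) A"
  unfolding pos_homogeneous_def
proof (intro allI impI)
  fix t :: real and \<xi> :: "real ^ 'n"
  assume "t > 0"
  thus "A (t *\<^sub>R \<xi>) = t powr (p - 1) *\<^sub>R A \<xi>"
    using F_nonneg[of \<xi>] by (auto simp: flux_def grad_F_scale F_scale powr_mult)
qed

lemma flux_continuous: "continuous_on UNIV A"
proof (rule pos_homogeneous_continuous[OF flux_homogeneous])
  have "continuous_on (- {0}) (\<lambda>\<xi>. F \<xi> powr (p - 1) *\<^sub>R grad F \<xi>)"
  proof (intro continuous_intros ballI)
    show "continuous_on (- {0}) F" "continuous_on (- {0}) (grad F)"
      by (auto intro!: continuous_at_imp_continuous_on differentiable_imp_continuous_within
          F_differentiable grad_F_differentiable)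
    show "F x \<noteq> 0" if "x \<in> - {0}" for x using F_pos[of x] that by auto
  qed
  thus "continuous_on (- {0}) A"
    by (rule continuous_on_eq) (auto simp: flux_def)
qed (use p in simp)

lemma flux_inner_self: "A \<xi> \<bullet> \<xi> = F \<xi> powr p"
proof (cases "\<xi> = 0")
  case True
  thus ?thesis using F_scale[of 0 \<xi>] p by (simp add: flux_def)
next
  case False
  hence "A \<xi> \<bullet> \<xi> = F \<xi> powr (p - 1) * F \<xi>" by (simp add: flux_def euler_F)
  also have "\<dots> = F \<xi> powr p" using F_pos[OF False] powr_mult_base[of "F \<xi>" "p - 1"] by (simp add: mult.commute)
  finally show ?thesis .
qed

lemma grad_F_powr:
  assumes "\<xi> \<noteq> 0"
  shows "grad (\<lambda>\<eta>. F \<eta> powr p) \<xi> = p *\<^sub>R A \<xi>"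
proof -
  have "((\<lambda>t. t powr p) has_real_derivative p * F \<xi> powr (p - 1)) (at (F \<xi>))"
    using F_pos[OF assms] by (rule has_real_derivative_powr)
  from DERIV_compose_FDERIV[OF this F_derivative[OF assms]]
  have "((\<lambda>\<eta>. F \<eta> powr p) has_derivative (\<lambda>v. (p *\<^sub>R A \<xi>) \<bullet> v)) (at \<xi>)"
    using assms by (simp add: flux_def mult_ac)
  thus ?thesis by (rule has_derivative_grad_unique)
qed

lemma flux_derivative:
  assumes "\<xi> \<noteq> 0"
  shows "((\<lambda>\<eta>. p *\<^sub>R A \<eta>) has_derivative (\<lambda>v. hessian (\<lambda>\<eta>. F \<eta> powr p) \<xi> *v v)) (at \<xi>)"
proof -
  have "(\<lambda>\<eta>. p *\<^sub>R (F \<eta> powr (p - 1) *\<^sub>R grad F \<eta>)) differentiable (at \<xi>)"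
  proof -
    have "((\<lambda>t. t powr (p - 1)) has_real_derivative (p - 1) * F \<xi> powr (p - 1 - 1)) (at (F \<xi>))"
      using F_pos[OF assms] by (rule has_real_derivative_powr)
    from DERIV_compose_FDERIV[OF this F_derivative[OF assms]]
    have "(\<lambda>\<eta>. F \<eta> powr (p - 1)) differentiable (at \<xi>)" by (rule differentiableI)
    thus ?thesis using assms by (intro differentiable_scaleR differentiable_const grad_F_differentiable)
  qed
  then obtain D where "((\<lambda>\<eta>. p *\<^sub>R (F \<eta> powr (p - 1) *\<^sub>R grad F \<eta>)) has_derivative D) (at \<xi>)"
    unfolding differentiable_def by blast
  hence "(grad (\<lambda>\<eta>. F \<eta> powr p) has_derivative D) (at \<xi>)"
    by (rule has_derivative_transform_within_open[of _ _ _ _ "- {0}"])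
      (use assms in \<open>auto simp: grad_F_powr flux_def\<close>)
  hence "grad (\<lambda>\<eta>. F \<eta> powr p) differentiable (at \<xi>)" by (rule differentiableI)
  hence "(grad (\<lambda>\<eta>. F \<eta> powr p) has_derivative (\<lambda>v. hessian (\<lambda>\<eta>. F \<eta> powr p) \<xi> *v v)) (at \<xi>)"
    unfolding hessian_def using jacobian_works by blast
  thus ?thesis
    by (rule has_derivative_transform_within_open[of _ _ _ _ "- {0}"])
      (use assms in \<open>auto simp: grad_F_powr\<close>)
qed

text \<open>If the segment from \<open>\<eta>\<close> to \<open>\<xi>\<close> avoids the origin, the Hessian condition makes
  \<open>\<langle>p A, \<xi> - \<eta>\<rangle>\<close> strictly increasing along it.  Otherwise \<open>\<xi>\<close> and \<open>\<eta>\<close> lie on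
  opposite rays of a line through the origin (one of them may be \<open>0\<close>), where Euler's identity
  \<open>\<langle>A(\<zeta>), \<zeta>\<rangle> = F(\<zeta>)\<^sup>p > 0\<close> determines the signs.\<close>

lemma flux_strictly_monotone:
  assumes "\<xi> \<noteq> \<eta>"
  shows "(A \<xi> - A \<eta>) \<bullet> (\<xi> - \<eta>) > 0"
proof -
  define v where "v = \<xi> - \<eta>"
  have "v \<noteq> 0" using assms by (simp add: v_def)
  show ?thesis
  proof (cases "\<exists>t\<in>{0..1}. \<eta> + t *\<^sub>R v = 0")
    case True
    then obtain t where t: "0 \<le> t" "t \<le> 1" "\<eta> + t *\<^sub>R v = 0" by auto
    have \<eta>: "\<eta> = (- t) *\<^sub>R v" using t(3) by (simp add: eq_neg_iff_add_eq_0)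
    have \<xi>: "\<xi> = (1 - t) *\<^sub>R v" using \<eta> by (simp add: v_def algebra_simps)
    have sgn: "A (s *\<^sub>R v) \<bullet> v * s > 0" if "s \<noteq> 0" for s
    proof -
      have "A (s *\<^sub>R v) \<bullet> v * s = A (s *\<^sub>R v) \<bullet> (s *\<^sub>R v)" by simp
      also have "\<dots> > 0" unfolding flux_inner_self using F_pos[of "s *\<^sub>R v"] \<open>v \<noteq> 0\<close> that by simp
      finally show ?thesis .
    qed
    have "0 \<le> A \<xi> \<bullet> v \<and> (t = 1 \<or> 0 < A \<xi> \<bullet> v)"
    proof (cases "t = 1")
      case False
      hence "0 < A ((1 - t) *\<^sub>R v) \<bullet> v * (1 - t)" by (intro sgn) simp
      thus ?thesis using t False unfolding \<xi> by (simp add: zero_less_mult_iff)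
    qed (use \<xi> in \<open>simp add: flux_def\<close>)
    moreover have "A \<eta> \<bullet> v \<le> 0 \<and> (t = 0 \<or> A \<eta> \<bullet> v < 0)"
    proof (cases "t = 0")
      case False
      hence "0 < A ((- t) *\<^sub>R v) \<bullet> v * (- t)" by (intro sgn) simp
      thus ?thesis using t False unfolding \<eta> by (auto simp: zero_less_mult_iff mult_less_0_iff)
    qed (use \<eta> in \<open>simp add: flux_def\<close>)
    ultimately have "A \<xi> \<bullet> v - A \<eta> \<bullet> v > 0" by linarith
    thus ?thesis by (simp add: inner_diff_left v_def)
  next
    case False
    define h where "h t = p *\<^sub>R A (\<eta> + t *\<^sub>R v) \<bullet> v" for t
    have "h 0 < h 1"
    proof (rule DERIV_pos_imp_increasing[where f = h])
      fix t :: real assume t: "0 \<le> t" "t \<le> 1"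
      let ?x = "\<eta> + t *\<^sub>R v"
      let ?H = "hessian (\<lambda>\<eta>. F \<eta> powr p) ?x"
      have "?x \<noteq> 0" using False t by auto
      have "((\<lambda>t. \<eta> + t *\<^sub>R v) has_derivative (\<lambda>s. s *\<^sub>R v)) (at t)"
        by (auto intro!: derivative_eq_intros)
      from has_derivative_compose[OF this flux_derivative[OF \<open>?x \<noteq> 0\<close>]]
      have "(h has_derivative (\<lambda>s. (?H *v (s *\<^sub>R v)) \<bullet> v)) (at t)"
        unfolding h_def by (rule has_derivative_inner_left)
      hence "(h has_real_derivative (?H *v v) \<bullet> v) (at t)"
        by (simp add: has_field_derivative_def matrix_vector_mult_scaleR mult.commute[of _ "(?H *v v) \<bullet> v"])
      moreover have "(?H *v v) \<bullet> v > 0"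
        using hessian_pos[OF \<open>?x \<noteq> 0\<close>] \<open>v \<noteq> 0\<close> by (auto simp: positive_definite_def inner_commute)
      ultimately show "\<exists>y. (h has_real_derivative y) (at t) \<and> 0 < y" by blast
    qed simp
    thus ?thesis using p by (simp add: h_def v_def inner_diff_left)
  qed
qed

end

section \<open>Eigenpairs and their limits\<close>

locale anisotropic_eigenvalue_problem = bounded_open_domain \<Omega> p + admissible_norm F p a
  for \<Omega> :: "(real ^ 'n) set" and F :: "real ^ 'n \<Rightarrow> real" and p a :: real
begin

abbreviation "B \<equiv> signed_power p"

text \<open>The weak equation for a pair \<open>(u, g)\<close>, free of the chosen representative of the gradient and,
  unlike the notion of eigenfunction, including \<open>u = 0\<close>; the nontriviality of \<open>u\<close> is tracked by its modular.\<close>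

definition weak_eigenpair :: "real \<Rightarrow> (real ^ 'n \<Rightarrow> real) \<Rightarrow> (real ^ 'n \<Rightarrow> real ^ 'n) \<Rightarrow> bool" where
  "weak_eigenpair \<mu> u g \<longleftrightarrow> W0_pair u g \<and>
    (\<forall>v h. W0_pair v h \<longrightarrow> (LINT x|M. A (g x) \<bullet> h x) = \<mu> * (LINT x|M. B (u x) \<bullet> v x))"

lemma weak_eigenpairD:
  assumes "weak_eigenpair \<mu> u g"
  shows "W0_pair u g" "W0_pair v h \<Longrightarrow> (LINT x|M. A (g x) \<bullet> h x) = \<mu> * (LINT x|M. B (u x) \<bullet> v x)"
  using assms by (auto simp: weak_eigenpair_def)

lemmas B_regular = signed_power_homogeneous[of p] signed_power_continuous[OF p]
lemmas A_regular = flux_homogeneous flux_continuous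

lemma modular_eq_0_iff:
  assumes "u \<in> Lp p \<Omega>"
  shows "modular u = 0 \<longleftrightarrow> (AE x in M. u x = 0)"
  unfolding modular_def using integral_nonneg_eq_0_iff_AE[OF Lp_integrable[OF assms]] by simp

lemma integral_flux_cong:
  assumes "g \<in> Lp p \<Omega>" "g' \<in> Lp p \<Omega>" "h \<in> Lp p \<Omega>" "h' \<in> Lp p \<Omega>"
    and "AE x in M. g x = g' x" "AE x in M. h x = h' x"
  shows "(LINT x|M. A (g x) \<bullet> h x) = (LINT x|M. A (g' x) \<bullet> h' x)"
proof (rule integral_cong_AE)
  show "(\<lambda>x. A (g x) \<bullet> h x) \<in> borel_measurable M" "(\<lambda>x. A (g' x) \<bullet> h' x) \<in> borel_measurable M"
    by (intro borel_measurable_integrable integrable_inner_homogeneous A_regular assms)+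
  show "AE x in M. A (g x) \<bullet> h x = A (g' x) \<bullet> h' x"
    using assms(5,6) by eventually_elim simp
qed

lemma eigenfunction_imp_weak_eigenpair:
  assumes "is_eigenfunction F p \<Omega> \<mu> u"
  shows "weak_eigenpair \<mu> u (weak_grad \<Omega> u)" "modular u > 0"
proof -
  have W: "W0_pair u (weak_grad \<Omega> u)" using assms by (auto simp: is_eigenfunction_def intro: W01p_imp_W0_pair)
  have "(LINT x|M. A (weak_grad \<Omega> u x) \<bullet> h x) = \<mu> * (LINT x|M. B (u x) \<bullet> v x)" if V: "W0_pair v h" for v h
  proof -
    note v = W0_pair_imp_W01p[OF V]
    have "(LINT x|M. A (weak_grad \<Omega> u x) \<bullet> h x) = (LINT x|M. A (weak_grad \<Omega> u x) \<bullet> weak_grad \<Omega> v x)"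
      using v(2) by (intro integral_flux_cong W0_pair_Lp(2)[OF W] W0_pair_Lp(2)[OF V]
        W0_pair_Lp(2)[OF W01p_imp_W0_pair[OF v(1)]]) auto
    also have "\<dots> = \<mu> * (LINT x|M. B (u x) \<bullet> v x)"
      using assms v(1) by (simp add: is_eigenfunction_def signed_power_def)
    finally show ?thesis .
  qed
  thus "weak_eigenpair \<mu> u (weak_grad \<Omega> u)" using W by (simp add: weak_eigenpair_def)
  have "\<not> (AE x in M. u x = 0)" using assms by (simp add: is_eigenfunction_def)
  hence "modular u \<noteq> 0" using modular_eq_0_iff[OF W0_pair_Lp(1)[OF W]] by simp
  thus "modular u > 0" using modular_nonneg[of u] by simp
qed

lemma weak_eigenpair_imp_eigenfunction:
  assumes "weak_eigenpair \<mu> u g" "modular u \<noteq> 0"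
  shows "is_eigenfunction F p \<Omega> \<mu> u"
  unfolding is_eigenfunction_def
proof (intro conjI ballI)
  note W = weak_eigenpairD(1)[OF assms(1)]
  note u = W0_pair_imp_W01p[OF W]
  show "u \<in> W01p p \<Omega>" by (rule u(1))
  show "\<not> (AE x in M. u x = 0)" using assms(2) modular_eq_0_iff[OF W0_pair_Lp(1)[OF W]] by simp
  fix v assume "v \<in> W01p p \<Omega>"
  hence V: "W0_pair v (weak_grad \<Omega> v)" by (rule W01p_imp_W0_pair)
  have "(LINT x|M. A (weak_grad \<Omega> u x) \<bullet> weak_grad \<Omega> v x) = (LINT x|M. A (g x) \<bullet> weak_grad \<Omega> v x)"
    using u(2) by (intro integral_flux_cong W0_pair_Lp(2)[OF W] W0_pair_Lp(2)[OF V]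
        W0_pair_Lp(2)[OF W01p_imp_W0_pair[OF u(1)]]) auto
  also have "\<dots> = \<mu> * (LINT x|M. B (u x) \<bullet> v x)" by (rule weak_eigenpairD(2)[OF assms(1) V])
  finally show "(LINT x|M. A (weak_grad \<Omega> u x) \<bullet> weak_grad \<Omega> v x) =
      \<mu> * (LINT x|M. \<bar>u x\<bar> powr (p - 2) * u x * v x)"
    by (simp add: signed_power_def)
qed

lemma weak_eigenpair_scale:
  assumes "weak_eigenpair \<mu> u g" "c > 0"
  shows "weak_eigenpair \<mu> (\<lambda>x. c * u x) (\<lambda>x. c *\<^sub>R g x)"
  unfolding weak_eigenpair_def
proof (intro conjI allI impI)
  note W = weak_eigenpairD(1)[OF assms(1)]
  show "W0_pair (\<lambda>x. c * u x) (\<lambda>x. c *\<^sub>R g x)"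
    using W0_pair_linear_combination[OF W W, of c 0] by simp
  fix v h assume V: "W0_pair v h"
  have B: "B (c * s) = c powr (p - 1) * B s" for s
    using pos_homogeneousD[OF B_regular(1) assms(2), of s] by simp
  have "(LINT x|M. A (c *\<^sub>R g x) \<bullet> h x) = (LINT x|M. c powr (p - 1) * (A (g x) \<bullet> h x))"
    by (simp add: pos_homogeneousD[OF A_regular(1) assms(2)])
  also have "\<dots> = c powr (p - 1) * (LINT x|M. A (g x) \<bullet> h x)" by (rule integral_mult_right_zero)
  also have "\<dots> = \<mu> * (c powr (p - 1) * (LINT x|M. B (u x) \<bullet> v x))"
    by (simp add: weak_eigenpairD(2)[OF assms(1) V])
  also have "c powr (p - 1) * (LINT x|M. B (u x) \<bullet> v x) = (LINT x|M. c powr (p - 1) * (B (u x) \<bullet> v x))"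
    by (rule integral_mult_right_zero[symmetric])
  also have "\<dots> = (LINT x|M. B (c * u x) \<bullet> v x)" by (simp add: B mult.assoc)
  finally show "(LINT x|M. A (c *\<^sub>R g x) \<bullet> h x) = \<mu> * (LINT x|M. B (c * u x) \<bullet> v x)" .
qed

lemma weak_eigenpair_normalized:
  assumes "\<mu> \<in> spectrum F p \<Omega>"
  obtains u g where "weak_eigenpair \<mu> u g" "modular u = 1"
proof -
  obtain u where u: "is_eigenfunction F p \<Omega> \<mu> u" using assms by (auto simp: spectrum_def)
  note e = eigenfunction_imp_weak_eigenpair[OF u]
  \<comment> \<open>The factor that makes the modular of \<open>c u\<close> equal to \<open>1\<close>.\<close>
  define c where "c = modular u powr (- 1 / p)"
  have "c > 0" using e(2) by (simp add: c_def)
  have "c powr p = modular u powr (- 1 / p * p)" unfolding c_def by (rule powr_powr)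
  also have "\<dots> = inverse (modular u)" using e(2) p powr_minus[of "modular u" 1] by simp
  finally have "c powr p = inverse (modular u)" .
  hence "modular (\<lambda>x. c *\<^sub>R u x) = 1"
    using e(2) \<open>c > 0\<close> by (simp only: modular_scaleR) simp
  thus thesis using that[OF weak_eigenpair_scale[OF e(1) \<open>c > 0\<close>]] by simp
qed

text \<open>The equation tested with \<open>u\<close> itself, together with \<open>\<langle>A(\<xi>), \<xi>\<rangle> = F(\<xi>)\<^sup>p \<ge> a\<^sup>p \<bar>\<xi>\<bar>\<^sup>p\<close>.\<close>

lemma weak_eigenpair_gradient_bound:
  assumes "weak_eigenpair \<mu> u g" "modular u = 1"
  shows "a powr p * modular g \<le> \<mu>"
proof -
  note W = weak_eigenpairD(1)[OF assms(1)] and L = W0_pair_Lp(2)[OF weak_eigenpairD(1)[OF assms(1)]]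
  have "a powr p * modular g = (LINT x|M. a powr p * norm (g x) powr p)" by (simp add: modular_def)
  also have "\<dots> \<le> (LINT x|M. A (g x) \<bullet> g x)"
  proof (rule integral_mono)
    show "integrable M (\<lambda>x. a powr p * norm (g x) powr p)" using Lp_integrable[OF L] by simp
    show "integrable M (\<lambda>x. A (g x) \<bullet> g x)" by (intro integrable_inner_homogeneous A_regular L)
    show "a powr p * norm (g x) powr p \<le> A (g x) \<bullet> g x" for x
      using powr_mono2[OF _ _ F_ge, of p "g x"] a p by (simp add: flux_inner_self powr_mult)
  qed
  also have "\<dots> = \<mu> * (LINT x|M. B (u x) \<bullet> u x)" by (rule weak_eigenpairD(2)[OF assms(1) W])
  also have "(LINT x|M. B (u x) \<bullet> u x) = modular u"
    using p by (simp add: signed_power_mult_self modular_def)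
  finally show ?thesis using assms(2) by simp
qed

text \<open>The comparison principle for \<open>h = \<bar>\<xi> - \<eta>\<bar>\<^sup>p\<close> and \<open>D = \<langle>A \<xi> - A \<eta>, \<xi> - \<eta>\<rangle>\<close>.  The compactness
  behind that principle turns strict monotonicity into an estimate, for the degenerate case
  \<open>p > 2\<close> and the singular case \<open>p < 2\<close> alike.\<close>

lemma flux_monotone_control:
  assumes "e > 0"
  obtains d where "d > 0" "\<And>g h. g \<in> Lp p \<Omega> \<Longrightarrow> h \<in> Lp p \<Omega> \<Longrightarrow> modular g \<le> L \<Longrightarrow> modular h \<le> L \<Longrightarrow>
    (LINT x|M. (A (g x) - A (h x)) \<bullet> (g x - h x)) < d \<Longrightarrow> modular (\<lambda>x. g x - h x) < e"
proof -
  define H where "H w = norm (fst w - snd w) powr p" for w :: "(real ^ 'n) \<times> (real ^ 'n)"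
  define D where "D w = (A (fst w) - A (snd w)) \<bullet> (fst w - snd w)" for w :: "(real ^ 'n) \<times> (real ^ 'n)"
  have hom: "pos_homogeneous p H" "pos_homogeneous p D"
    unfolding H_def D_def
    by (intro pos_homogeneous_inner pos_homogeneous_diff pos_homogeneous_norm_powr
        pos_homogeneous_compose_linear[OF A_regular(1)] linearI; simp add: algebra_simps)+
  have cont: "continuous_on UNIV H" "continuous_on UNIV D"
    unfolding H_def D_def using p
    by (intro continuous_intros continuous_on_compose2[OF A_regular(2)] continuous_on_powr'; auto)+
  have D_pos: "D w > 0" if "fst w \<noteq> snd w" for w
    using flux_strictly_monotone[OF that] by (simp add: D_def)
  have nonneg: "D w \<ge> 0" for w using D_pos[of w] by (cases "fst w = snd w") (auto simp: D_def)
  have zero: "H w = 0" if "D w = 0" for w using D_pos[of w] that p by (cases "fst w = snd w") (auto simp: H_def)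
  obtain d where d: "d > 0" "\<And>w. w \<in> Lp p \<Omega> \<Longrightarrow> modular w \<le> 2 powr p * (L + L) \<Longrightarrow>
      (LINT x|M. D (w x)) < d \<Longrightarrow> (LINT x|M. H (w x)) < e"
    by (rule homogeneous_comparison_integral[OF hom cont nonneg zero \<open>e > 0\<close>, of "2 powr p * (L + L)"]) auto
  show thesis
  proof (rule that[OF d(1)])
    fix g h :: "real ^ 'n \<Rightarrow> real ^ 'n"
    assume g: "g \<in> Lp p \<Omega>" "h \<in> Lp p \<Omega>" "modular g \<le> L" "modular h \<le> L"
      and lt: "(LINT x|M. (A (g x) - A (h x)) \<bullet> (g x - h x)) < d"
    have "(LINT x|M. H (g x, h x)) < e"
    proof (rule d(2)[OF Lp_Pair(1)[OF g(1,2)]])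
      show "modular (\<lambda>x. (g x, h x)) \<le> 2 powr p * (L + L)"
        by (rule order.trans[OF Lp_Pair(2)[OF g(1,2)]]) (use g(3,4) in \<open>auto intro!: mult_left_mono\<close>)
      show "(LINT x|M. D (g x, h x)) < d" using lt by (simp add: D_def)
    qed
    thus "modular (\<lambda>x. g x - h x) < e" by (simp add: H_def modular_def)
  qed
qed

text \<open>Subtract the equations of the \<open>i\<close>-th and the \<open>j\<close>-th pair, both tested with \<open>u i - u j\<close>: the
  monotone expression in the gradients is bounded by integrals that are small because \<open>u i - u j\<close> is.\<close>

lemma Cauchy_Lp_gradients:
  assumes E: "\<And>k::nat. weak_eigenpair (\<mu> k) (u k) (g k)"
    and bounds: "\<And>k. modular (u k) \<le> 1" "\<And>k. modular (g k) \<le> L" "\<And>k. \<bar>\<mu> k\<bar> \<le> \<Lambda>"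
    and cauchy: "Cauchy_Lp u"
  shows "Cauchy_Lp g"
  unfolding Cauchy_Lp_def
proof (intro allI impI)
  fix e :: real assume "e > 0"
  note W = weak_eigenpairD(1)[OF E]
  note uL = W0_pair_Lp(1)[OF W] and gL = W0_pair_Lp(2)[OF W]
  obtain d where d: "d > 0" "\<And>g h. g \<in> Lp p \<Omega> \<Longrightarrow> h \<in> Lp p \<Omega> \<Longrightarrow> modular g \<le> L \<Longrightarrow> modular h \<le> L \<Longrightarrow>
    (LINT x|M. (A (g x) - A (h x)) \<bullet> (g x - h x)) < d \<Longrightarrow> modular (\<lambda>x. g x - h x) < e"
    using flux_monotone_control[OF \<open>e > 0\<close>, of L] by blast
  have \<Lambda>: "\<Lambda> \<ge> 0" using bounds(3)[of 0] by linarith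
  \<comment> \<open>Two terms, each with a factor at most \<open>\<Lambda>\<close>, must add up to less than \<open>d\<close>.\<close>
  define e' where "e' = d / (2 * (\<Lambda> + 1))"
  have "e' * (2 * (\<Lambda> + 1)) = d" using \<Lambda> by (simp add: e'_def)
  moreover have "e' > 0" unfolding e'_def using d(1) \<Lambda> by (intro divide_pos_pos) auto
  ultimately have e': "e' > 0" "\<Lambda> * e' + \<Lambda> * e' < d" by (simp_all add: algebra_simps)
  obtain d' where d': "d' > 0" "\<And>f g. f \<in> Lp p \<Omega> \<Longrightarrow> g \<in> Lp p \<Omega> \<Longrightarrow> modular f \<le> 1 \<Longrightarrow> modular g < d' \<Longrightarrow>
    \<bar>LINT x|M. B (f x) \<bullet> g x\<bar> < e'"
    using integral_abs_inner_homogeneous_small[OF B_regular e'(1), of 1] by blast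
  obtain N where N: "\<forall>i\<ge>N. \<forall>j\<ge>N. modular (\<lambda>x. u i x - u j x) < d'"
    using Cauchy_LpD[OF cauchy d'(1)] by blast
  show "\<exists>N. \<forall>i\<ge>N. \<forall>j\<ge>N. modular (\<lambda>x. g i x - g j x) < e"
  proof (intro exI allI impI)
    fix i j assume ij: "N \<le> i" "N \<le> j"
    let ?w = "\<lambda>x. u i x - u j x" and ?h = "\<lambda>x. g i x - g j x"
    have wh: "W0_pair ?w ?h" using W0_pair_linear_combination[OF W[of i] W[of j], of 1 "- 1"] by simp
    have wL: "?w \<in> Lp p \<Omega>" "?h \<in> Lp p \<Omega>" by (intro Lp_diff uL gL)+
    have small: "\<bar>\<mu> k * (LINT x|M. B (u k x) \<bullet> ?w x)\<bar> \<le> \<Lambda> * e'" for k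
    proof -
      have "\<bar>LINT x|M. B (u k x) \<bullet> ?w x\<bar> \<le> e'"
        using d'(2)[OF uL wL(1) bounds(1)] N ij by (auto intro: less_imp_le)
      thus ?thesis unfolding abs_mult using bounds(3) \<Lambda> by (intro mult_mono) auto
    qed
    have "(LINT x|M. (A (g i x) - A (g j x)) \<bullet> ?h x) = (LINT x|M. A (g i x) \<bullet> ?h x - A (g j x) \<bullet> ?h x)"
      by (simp add: inner_diff_left)
    also have "\<dots> = (LINT x|M. A (g i x) \<bullet> ?h x) - (LINT x|M. A (g j x) \<bullet> ?h x)"
      by (intro Bochner_Integration.integral_diff integrable_inner_homogeneous A_regular gL wL)
    also have "\<dots> = \<mu> i * (LINT x|M. B (u i x) \<bullet> ?w x) - \<mu> j * (LINT x|M. B (u j x) \<bullet> ?w x)"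
      by (simp only: weak_eigenpairD(2)[OF E wh])
    also have "\<dots> \<le> \<Lambda> * e' + \<Lambda> * e'" using small[of i] small[of j] by linarith
    also have "\<dots> < d" by (rule e'(2))
    finally show "modular ?h < e" by (intro d(2) gL bounds)
  qed
qed

lemma weak_eigenpair_limit:
  assumes E: "\<And>k::nat. weak_eigenpair (\<mu> k) (u k) (g k)"
    and L: "v \<in> Lp p \<Omega>" "h \<in> Lp p \<Omega>" and \<mu>: "\<mu> \<longlonglongrightarrow> \<nu>"
    and lim: "(\<lambda>k. modular (\<lambda>x. u k x - v x)) \<longlonglongrightarrow> 0" "(\<lambda>k. modular (\<lambda>x. g k x - h x)) \<longlonglongrightarrow> 0"
  shows "weak_eigenpair \<nu> v h"
  unfolding weak_eigenpair_def
proof (intro conjI allI impI)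
  note W = weak_eigenpairD(1)[OF E]
  show "W0_pair v h" by (rule W0_pair_closed[OF W L lim])
  fix w k assume V: "W0_pair w k"
  have "(\<lambda>i. LINT x|M. A (g i x) \<bullet> k x) \<longlonglongrightarrow> (LINT x|M. A (h x) \<bullet> k x)"
    by (rule integral_inner_homogeneous_tendsto[OF A_regular W0_pair_Lp(2)[OF W] L(2) W0_pair_Lp(2)[OF V] lim(2)])
  moreover have "(\<lambda>i. \<mu> i * (LINT x|M. B (u i x) \<bullet> w x)) \<longlonglongrightarrow> \<nu> * (LINT x|M. B (v x) \<bullet> w x)"
    by (intro tendsto_mult \<mu> integral_inner_homogeneous_tendsto[OF B_regular W0_pair_Lp(1)[OF W] L(1) W0_pair_Lp(1)[OF V] lim(1)])
  ultimately show "(LINT x|M. A (h x) \<bullet> k x) = \<nu> * (LINT x|M. B (v x) \<bullet> w x)"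
    by (simp add: weak_eigenpairD(2)[OF E V] LIMSEQ_unique)
qed

text \<open>The limit is not zero because all \<open>u\<^sub>k\<close> have modular \<open>1\<close> and converge strongly.\<close>

lemma spectrum_closed: "closed (spectrum F p \<Omega>)"
  unfolding closed_sequential_limits
proof (intro allI impI)
  fix \<mu> :: "nat \<Rightarrow> real" and \<nu>
  assume "(\<forall>k. \<mu> k \<in> spectrum F p \<Omega>) \<and> \<mu> \<longlonglongrightarrow> \<nu>"
  hence \<mu>: "\<And>k. \<mu> k \<in> spectrum F p \<Omega>" "\<mu> \<longlonglongrightarrow> \<nu>" by auto
  have "\<exists>w. weak_eigenpair (\<mu> k) (fst w) (snd w) \<and> modular (fst w) = 1" for k
    using weak_eigenpair_normalized[OF \<mu>(1)[of k]] by (metis fst_conv snd_conv)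
  then obtain w where w: "\<And>k. weak_eigenpair (\<mu> k) (fst (w k)) (snd (w k))" "\<And>k. modular (fst (w k)) = 1"
    by metis
  obtain \<Lambda> where \<Lambda>: "\<And>k. \<bar>\<mu> k\<bar> \<le> \<Lambda>"
    using convergent_imp_Bseq[OF convergentI[OF \<mu>(2)]] unfolding Bseq_def by auto
  define L where "L = \<Lambda> / a powr p"
  have grad_bound: "modular (snd (w k)) \<le> L" for k
  proof -
    have "a powr p * modular (snd (w k)) \<le> \<Lambda>"
      using weak_eigenpair_gradient_bound[OF w(1,2), of k] \<Lambda>[of k] by linarith
    thus ?thesis using a by (simp add: L_def pos_le_divide_eq mult.commute)
  qed
  obtain r where r: "strict_mono (r :: nat \<Rightarrow> nat)" "Cauchy_Lp (\<lambda>k. fst (w (r k)))"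
    using rellich[of "\<lambda>k. fst (w k)" "\<lambda>k. snd (w k)" 1 L] weak_eigenpairD(1)[OF w(1)] w(2) grad_bound
    by (metis order_refl)
  note E = w(1)[of "r _"]
  have g: "Cauchy_Lp (\<lambda>k. snd (w (r k)))"
    by (rule Cauchy_Lp_gradients[OF E _ grad_bound \<Lambda> r(2)]) (simp add: w(2))
  note uL = W0_pair_Lp(1)[OF weak_eigenpairD(1)[OF E]] and gL = W0_pair_Lp(2)[OF weak_eigenpairD(1)[OF E]]
  obtain v where v: "v \<in> Lp p \<Omega>" "(\<lambda>k. modular (\<lambda>x. fst (w (r k)) x - v x)) \<longlonglongrightarrow> 0"
    using Lp_complete[OF uL r(2)] by blast
  obtain h where h: "h \<in> Lp p \<Omega>" "(\<lambda>k. modular (\<lambda>x. snd (w (r k)) x - h x)) \<longlonglongrightarrow> 0"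
    using Lp_complete[OF gL g] by blast
  have "(\<lambda>k. \<mu> (r k)) \<longlonglongrightarrow> \<nu>" using LIMSEQ_subseq_LIMSEQ[OF \<mu>(2) r(1)] by (simp add: o_def)
  from weak_eigenpair_limit[OF E v(1) h(1) this v(2) h(2)] have "weak_eigenpair \<nu> v h" .
  moreover have "modular v \<noteq> 0"
  proof
    assume "modular v = 0"
    have "1 \<le> 2 powr p * modular (\<lambda>x. fst (w (r k)) x - v x)" for k
      using modular_add_le[OF Lp_diff[OF uL v(1)] v(1), of k] w(2)[of "r k"] \<open>modular v = 0\<close> by simp
    moreover have "(\<lambda>k. 2 powr p * modular (\<lambda>x. fst (w (r k)) x - v x)) \<longlonglongrightarrow> 0"
      by (rule tendsto_mult_right_zero[OF v(2)])
    ultimately have "(1::real) \<le> 0"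
      by (intro tendsto_lowerbound[of "\<lambda>k. 2 powr p * modular (\<lambda>x. fst (w (r k)) x - v x)" 0 sequentially]) auto
    thus False by simp
  qed
  ultimately have "is_eigenfunction F p \<Omega> \<nu> v" by (rule weak_eigenpair_imp_eigenfunction)
  thus "\<nu> \<in> spectrum F p \<Omega>" by (auto simp: spectrum_def)
qed

end

theorem proposition3p7:
  fixes F :: "real ^ 'n \<Rightarrow> real" and p a :: real and \<Omega> :: "(real ^ 'n) set"
  assumes "CARD('n) \<ge> 2"
    and "1 < p"
    and "\<And>\<xi>. 0 \<le> F \<xi>"
    and "convex_on UNIV F"
    and "\<And>t \<xi>. F (t *\<^sub>R \<xi>) = \<bar>t\<bar> * F \<xi>"
    and "a > 0" and "\<And>\<xi>. a * norm \<xi> \<le> F \<xi>"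
    and "Ck_on 2 F (- {0})"
    and "\<And>\<xi>. \<xi> \<noteq> 0 \<Longrightarrow> positive_definite (hessian (\<lambda>\<eta>. F \<eta> powr p) \<xi>)"
    and "bounded \<Omega>" and "open \<Omega>" and "\<Omega> \<noteq> {}"
  shows "closed (spectrum F p \<Omega>)"
proof -
  interpret anisotropic_eigenvalue_problem \<Omega> F p a
    using assms by unfold_locales auto
  show ?thesis by (rule spectrum_closed)
qed

end
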